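(* Let $K$ be a closed convex subset of $\mathbf{R}^d$ with $k=\dim(K)\in\{1,\ldots,d-1\}$, let $\Omega=\mathbf{R}^d\setminus K$ and $\Gamma=\partial\Omega$. Let $c_\Omega=c\circ d_\Gamma$ where $c(s)=s^\delta(1+s)^{\delta'-\delta}$ for $s>0$, with $\delta,\delta'\in[0,2)$, and let $H=-\mathrm{div}(c_\Omega\nabla)$ on $C_c^2(\Omega)$. Let $p\in(1,\infty)$ with $d-k+p\,(\delta\wedge\delta')-2p>0$. Then the optimal constant $$\nu_p(\Omega)=\inf\Big\{\int_\Omega|H\varphi|^p\Big/\int_\Omega c_\Omega^{\,p}\,d_\Gamma^{\,-2p}\,|\varphi|^p:\ \varphi\in C_c^2(\Omega),\ \varphi\neq0\Big\}$$ in the weighted Rellich inequality on $\Omega$ satisfies the upper bound $$\nu_p(\Omega)\leq\big((p-1)(d-k)(d-k+p\,\delta-2p)\,p^{-2}\big)^p.$$ If, in addition, $k_\infty=k$ then $$\nu_p(\Omega)\leq\big((p-1)(d-k)(d-k+p\,(\delta\wedge\delta')-2p)\,p^{-2}\big)^p,$$ and for $\delta=\delta'$ one has equality.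
   Context: All functions are real-valued. $\dim(K)$ is the dimension of the affine hull $A_K$ of $K$. Identifying $A_K$ with $\mathbf{R}^k$, the dimension at infinity of $K$ is $k_\infty=\liminf_{r\to\infty}\big(\log|K\cap B_r|/\log r\big)$, where $B_r=\{y\in\mathbf{R}^k:|y|<r\}$ and $|S|$ is the $k$-dimensional Lebesgue measure of $S$. $d_\Gamma(x)=\inf_{y\in\mathbf{R}^d\setminus\Omega}|x-y|$ for $x\in\Omega$ is the Euclidean distance to $\Gamma$. $H\varphi=-\sum_{j=1}^d\partial_j(c_\Omega\,\partial_j\varphi)$, defined almost everywhere on $\Omega$. $\delta\wedge\delta'=\min(\delta,\delta')$. *)

theory Defs
  imports "HOL-Analysis.Analysis"
begin

section \<open>Distance to the boundary and coefficients\<close>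

definition bdist :: "'a::euclidean_space set \<Rightarrow> 'a \<Rightarrow> real"
  where "bdist \<Omega> x = infdist x (- \<Omega>)"

definition degen_coeff :: "real \<Rightarrow> real \<Rightarrow> real \<Rightarrow> real"
  where "degen_coeff \<delta> \<delta>' s = s powr \<delta> * (1 + s) powr (\<delta>' - \<delta>)"

section \<open>Test functions and the divergence-form operator\<close>

definition partial :: "'a::euclidean_space \<Rightarrow> ('a \<Rightarrow> real) \<Rightarrow> 'a \<Rightarrow> real"
  where "partial b f x = deriv (\<lambda>t. f (x + t *\<^sub>R b)) 0"

definition C1_on :: "'a::euclidean_space set \<Rightarrow> ('a \<Rightarrow> real) \<Rightarrow> bool"
  where "C1_on S f \<longleftrightarrow>
    (\<forall>x\<in>S. f differentiable (at x)) \<and> (\<forall>b\<in>Basis. continuous_on S (partial b f))"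

definition C2_on :: "'a::euclidean_space set \<Rightarrow> ('a \<Rightarrow> real) \<Rightarrow> bool"
  where "C2_on S f \<longleftrightarrow> C1_on S f \<and> (\<forall>b\<in>Basis. C1_on S (partial b f))"

text \<open>Functions on the open set \<open>\<Omega>\<close> with compact support in \<open>\<Omega>\<close> are represented by their
  extension by zero to the whole space.\<close>

definition Cc2 :: "'a::euclidean_space set \<Rightarrow> ('a \<Rightarrow> real) set"
  where "Cc2 \<Omega> = {\<phi>. C2_on \<Omega> \<phi> \<and> compact (closure {x. \<phi> x \<noteq> 0}) \<and> closure {x. \<phi> x \<noteq> 0} \<subseteq> \<Omega>}"

definition div_op :: "('a::euclidean_space \<Rightarrow> real) \<Rightarrow> ('a \<Rightarrow> real) \<Rightarrow> 'a \<Rightarrow> real"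
  where "div_op c \<phi> x = - (\<Sum>b\<in>Basis. partial b (\<lambda>y. c y * partial b \<phi> y) x)"

text \<open>The optimal constant \<open>\<nu>\<^sub>p(\<Omega>)\<close>. If \<open>\<Omega>\<close> is the complement of a nonempty closed convex
  set and \<open>c\<close> is the composition of \<open>degen_coeff \<delta> \<delta>'\<close> with the distance to the boundary, then \<open>c\<close> is
  continuously differentiable on \<open>\<Omega>\<close>, so both integrands are continuous with compact support in
  \<open>\<Omega>\<close> and the Bochner integrals are the actual finite integrals.\<close>

definition rellich_const :: "'a::euclidean_space set \<Rightarrow> ('a \<Rightarrow> real) \<Rightarrow> real \<Rightarrow> real"
  where "rellich_const \<Omega> c p =
    Inf {(LINT x:\<Omega>|lebesgue. \<bar>div_op c \<phi> x\<bar> powr p) /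
         (LINT x:\<Omega>|lebesgue. c x powr p * bdist \<Omega> x powr (- 2 * p) * \<bar>\<phi> x\<bar> powr p)
        | \<phi>. \<phi> \<in> Cc2 \<Omega> \<and> \<phi> \<noteq> (\<lambda>_. 0)}"

section \<open>Dimension at infinity\<close>

text \<open>The affine space \<open>A\<close> is identified with \<open>\<real>\<^sup>k\<close> (functions on \<open>{..<k}\<close>) by an origin
  \<open>a\<close> and an orthonormal frame \<open>e\<close>.\<close>

definition frame_point :: "nat \<Rightarrow> 'a::euclidean_space \<Rightarrow> (nat \<Rightarrow> 'a) \<Rightarrow> (nat \<Rightarrow> real) \<Rightarrow> 'a"
  where "frame_point k a e y = a + (\<Sum>i<k. y i *\<^sub>R e i)"

definition affine_frame :: "'a::euclidean_space set \<Rightarrow> nat \<Rightarrow> 'a \<Rightarrow> (nat \<Rightarrow> 'a) \<Rightarrow> bool"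
  where "affine_frame A k a e \<longleftrightarrow>
    (\<forall>i<k. \<forall>j<k. e i \<bullet> e j = (if i = j then 1 else 0)) \<and> A = range (frame_point k a e)"

definition slice_volume :: "nat \<Rightarrow> 'a::euclidean_space \<Rightarrow> (nat \<Rightarrow> 'a) \<Rightarrow> 'a set \<Rightarrow> real \<Rightarrow> real"
  where "slice_volume k a e K r =
    measure (Pi\<^sub>M {..<k} (\<lambda>_. lborel))
      {y \<in> {..<k} \<rightarrow>\<^sub>E UNIV. frame_point k a e y \<in> K \<and> L2_set y {..<k} < r}"

text \<open>The lower limit depends neither on the origin nor on the frame, so an arbitrary choice is
  made; one exists by the lemma \<open>affine_frame_exists\<close> below. The convention \<open>ln 0 = 0\<close> is
  irrelevant for closed convex \<open>K\<close>, since the volume is positive for all large \<open>r\<close>.\<close>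

definition dim_at_infinity :: "'a::euclidean_space set \<Rightarrow> ereal"
  where "dim_at_infinity K =
    (let k = nat (aff_dim K);
         (a, e) = (SOME (a, e). affine_frame (affine hull K) k a e)
     in Liminf at_top (\<lambda>r::real. ereal (ln (slice_volume k a e K r) / ln r)))"

lemma affine_frame_exists:
  fixes K :: "'a::euclidean_space set"
  assumes "K \<noteq> {}"
  shows "\<exists>a e. affine_frame (affine hull K) (nat (aff_dim K)) a e"
proof -
  obtain a where a: "a \<in> K" using assms by auto
  define L where "L = (\<lambda>x. - a + x) ` (affine hull K)"
  have aA: "a \<in> affine hull K" using a hull_inc by metis
  have sub: "subspace L"
    unfolding L_def using affine_diffs_subspace[OF affine_affine_hull aA] by simp
  have AL: "affine hull K = (\<lambda>x. a + x) ` L" unfolding L_def by (simp add: image_image)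
  have "aff_dim K = aff_dim L"
    unfolding L_def by (metis aff_dim_affine_hull aff_dim_translation_eq)
  also have "\<dots> = int (dim L)" using sub aff_dim_subspace by blast
  finally have d: "nat (aff_dim K) = dim L" by simp
  obtain B where B: "B \<subseteq> L" "pairwise orthogonal B" "\<And>x. x \<in> B \<Longrightarrow> norm x = 1"
      "independent B" "card B = dim L" "span B = L"
    using orthonormal_basis_subspace[OF sub] by blast
  have fB: "finite B" using B(4) independent_imp_finite by blast
  obtain e where e: "bij_betw e {..<dim L} B"
    using ex_bij_betw_nat_finite[OF fB] B(5) by (auto simp: atLeast0LessThan)
  have inj: "inj_on e {..<dim L}" and im: "e ` {..<dim L} = B"
    using e by (auto simp: bij_betw_def)
  have on: "e i \<bullet> e j = (if i = j then 1 else 0)" if "i < dim L" "j < dim L" for i j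
  proof (cases "i = j")
    case True
    have "e i \<in> B" using im that by auto
    then show ?thesis using B(3) True by (auto simp: norm_eq_1)
  next
    case False
    have "e i \<in> B" "e j \<in> B" "e i \<noteq> e j" using im that inj False by (auto dest: inj_onD)
    then show ?thesis using B(2) False by (auto simp: pairwise_def orthogonal_def)
  qed
  have "L = range (\<lambda>y. \<Sum>i<dim L. y i *\<^sub>R e i)"
  proof
    show "range (\<lambda>y. \<Sum>i<dim L. y i *\<^sub>R e i) \<subseteq> L"
      using im B(1) by (auto intro!: subspace_sum[OF sub] subspace_scale[OF sub])
    show "L \<subseteq> range (\<lambda>y. \<Sum>i<dim L. y i *\<^sub>R e i)"
    proof
      fix x assume "x \<in> L"
      then obtain u where "x = (\<Sum>v\<in>B. u v *\<^sub>R v)"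
        using B(6) span_finite[OF fB] by auto
      also have "\<dots> = (\<Sum>i<dim L. u (e i) *\<^sub>R e i)"
        using sum.reindex_bij_betw[OF e, of "\<lambda>v. u v *\<^sub>R v"] by simp
      finally show "x \<in> range (\<lambda>y. \<Sum>i<dim L. y i *\<^sub>R e i)"
        by (auto intro!: image_eqI[where x = "\<lambda>i. u (e i)"])
    qed
  qed
  then have "affine hull K = range (frame_point (dim L) a e)"
    unfolding AL frame_point_def by (metis image_image)
  with on d have "affine_frame (affine hull K) (nat (aff_dim K)) a e"
    unfolding affine_frame_def by simp
  then show ?thesis by blast
qed

end

theory Submission
  imports Defs
begin

text \<open>Write \<open>d\<close> for the distance to \<open>K\<close>, \<open>n\<close> for the codimension of \<open>K\<close>, and \<open>c \<sim> d\<^sup>\<gamma>\<close> for the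
  behaviour of the coefficient near \<open>K\<close> (\<open>\<gamma> = \<delta>\<close>) or far from it (\<open>\<gamma> = \<delta>'\<close>).  Where \<open>d\<close> is the
  Euclidean norm \<open>\<bar>z\<bar>\<close> of the component normal to the affine hull, the function \<open>\<bar>z\<bar>\<^sup>-\<^sup>m\<close> with
  \<open>p m = n + p \<gamma> - 2 p\<close> satisfies \<open>H \<bar>z\<bar>\<^sup>-\<^sup>m = C \<bar>z\<bar>\<^sup>\<gamma>\<^sup>-\<^sup>2\<^sup>-\<^sup>m\<close> with
  \<open>C = (p - 1) n (n + p \<gamma> - 2 p) / p\<^sup>2\<close>, and \<open>(\<bar>z\<bar>\<^sup>\<gamma>\<^sup>-\<^sup>2 \<bar>z\<bar>\<^sup>-\<^sup>m)\<^sup>p = \<bar>z\<bar>\<^sup>-\<^sup>n\<close> just fails to be integrable.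
  So \<open>\<bar>z\<bar>\<^sup>-\<^sup>m\<close> is a virtual extremal with Rellich quotient \<open>C\<^sup>p\<close>.

  Upper bounds.  Cut \<open>\<bar>z\<bar>\<^sup>-\<^sup>m\<close> off by a bump in \<open>ln \<bar>z\<bar>\<^sup>2\<close> spread over a long interval and by a bump in the
  tangential variable \<open>y\<close> at a much larger scale than \<open>\<bar>z\<bar>\<close>.  All error terms in \<open>H\<phi>\<close> are small multiples
  of the main term, in the sense of the integrals, because of a scale invariance: the functional
  \<open>h \<mapsto> \<integral> \<bar>z\<bar>\<^sup>-\<^sup>n h(ln \<bar>z\<bar>\<^sup>2) W\<close> kills derivatives \<open>h = F'\<close> if \<open>W\<close> does not depend on \<open>z\<close>, and is thus
  proportional to \<open>\<integral> h\<close> (\<open>integral_log_radial_proportional\<close>); this replaces polar coordinates and Fubini.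
  The construction needs a ball of the affine hull inside \<open>K\<close>, above which \<open>d = \<bar>z\<bar>\<close>.  A small ball in the
  relative interior suffices as \<open>\<bar>z\<bar> \<rightarrow> 0\<close> and gives the bound with \<open>\<delta>\<close>; arbitrarily large balls allow
  \<open>\<bar>z\<bar> \<rightarrow> \<infinity>\<close> and give the bound with \<open>\<delta>'\<close>.  Large balls exist if the dimension at infinity is \<open>k\<close>: the
  points of \<open>K\<close> within distance \<open>t\<close> of leaving \<open>K\<close> in a coordinate direction have volume of order
  \<open>t r\<^sup>k\<^sup>-\<^sup>1\<close> only in a ball of radius \<open>r\<close> (\<open>slice_exit_volume\<close>), which is less than the volume of \<open>K\<close> there.

  Lower bound for \<open>\<delta> = \<delta>'\<close>.  The only geometric input is \<open>\<Delta>(d\<^sup>2/2) \<ge> n\<close> in the weak sense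
  (\<open>integral_offset_gradient_le\<close>), where convexity enters through the nonexpansive closest-point map.  One tests
  \<open>H\<phi>\<close> against \<open>\<phi> \<bar>\<phi>\<bar>\<^sup>p\<^sup>-\<^sup>2 d\<^sup>-\<^sup>\<sigma>\<close> with \<open>\<sigma> = (2 - \<delta>) (p - 1)\<close>, integrates by parts, bounds the energy below by a
  Hardy inequality obtained from a completed square, and finishes with Young's inequality.\<close>

section \<open>Integration by parts for compactly supported functions\<close>

lemma integrable_compact_support:
  fixes f :: "'a::euclidean_space \<Rightarrow> real"
  assumes "continuous_on UNIV f" "compact T" "\<And>x. x \<notin> T \<Longrightarrow> f x = 0"
  shows "integrable lborel f"
proof -
  have "integrable lborel (\<lambda>x. indicator T x *\<^sub>R f x)"
    using assms(1,2) borel_integrable_compact continuous_on_subset by blast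
  moreover have "(\<lambda>x. indicator T x *\<^sub>R f x) = f"
    using assms(3) by (auto simp: fun_eq_iff indicator_def)
  ultimately show ?thesis by simp
qed

lemma DERIV_along_line:
  fixes f :: "'a::real_normed_vector \<Rightarrow> real"
  assumes "((\<lambda>t. f ((x + s *\<^sub>R v) + t *\<^sub>R v)) has_real_derivative D) (at 0)"
  shows "((\<lambda>t. f (x + t *\<^sub>R v)) has_real_derivative D) (at s)"
proof -
  have "((\<lambda>t. f (x + (s + t) *\<^sub>R v)) has_real_derivative D) (at 0)"
    using assms by (simp add: algebra_simps)
  then show ?thesis
    using DERIV_shift[of "\<lambda>t. f (x + t *\<^sub>R v)" D 0 s] by (simp add: add.commute)
qed

lemma directional_derivative_extend_by_zero:
  fixes f :: "'a::real_normed_vector \<Rightarrow> real"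
  assumes "closed T" "\<And>x. x \<notin> T \<Longrightarrow> f x = 0" "x \<notin> T"
  shows "((\<lambda>t. f (x + t *\<^sub>R v)) has_real_derivative 0) (at 0)"
proof -
  have op: "open ((\<lambda>t::real. x + t *\<^sub>R v) -` (- T))"
    using assms(1) by (intro continuous_open_vimage) (auto intro!: continuous_intros)
  have "\<forall>\<^sub>F t in nhds 0. f (x + t *\<^sub>R v) = 0"
    unfolding eventually_nhds
    by (rule exI[of _ "(\<lambda>t::real. x + t *\<^sub>R v) -` (- T)"]) (use op assms(2,3) in auto)
  then show ?thesis
    using DERIV_cong_ev[of 0 0 "\<lambda>t. f (x + t *\<^sub>R v)" "\<lambda>t. 0" 0 0] by simp
qed

lemma directional_derivative_zero_outside_support:
  fixes f :: "'a::real_normed_vector \<Rightarrow> real"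
  assumes "closed T" "\<And>x. x \<notin> T \<Longrightarrow> f x = 0" "x \<notin> T"
    and "((\<lambda>t. f (x + t *\<^sub>R v)) has_real_derivative D) (at 0)"
  shows "D = 0"
proof -
  have "((\<lambda>t. f (x + t *\<^sub>R v)) has_real_derivative 0) (at 0)"
    by (rule directional_derivative_extend_by_zero[where T=T]) (use assms in auto)
  then show ?thesis using assms(4) DERIV_unique by blast
qed

text \<open>Dominated convergence: the mean value theorem along the line bounds the quotients by the maximum of
  \<open>\<bar>f'\<bar>\<close>, and they all vanish outside the support swept along \<open>v\<close>.\<close>

lemma difference_quotients_tendsto:
  fixes f f' g :: "'a::euclidean_space \<Rightarrow> real" and v :: 'a
  assumes T: "compact T" "\<And>x. x \<notin> T \<Longrightarrow> f x = 0"
    and cont: "continuous_on UNIV f" "continuous_on UNIV f'" "continuous_on UNIV g"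
    and der: "\<And>x. ((\<lambda>t. f (x + t *\<^sub>R v)) has_real_derivative f' x) (at 0)"
  shows "(\<lambda>n. \<integral>x. g x * ((f (x + (1 / Suc n) *\<^sub>R v) - f x) / (1 / Suc n)) \<partial>lborel)
           \<longlonglongrightarrow> (\<integral>x. g x * f' x \<partial>lborel)"
proof -
  define T' where "T' = (\<lambda>(x, t::real). x - t *\<^sub>R v) ` (T \<times> {0..1})"
  have T': "compact T'"
    unfolding T'_def using T(1)
    by (intro compact_continuous_image compact_Times compact_Icc) (auto intro!: continuous_intros simp: case_prod_unfold)
  have f'0: "f' x = 0" if "x \<notin> T" for x
    using directional_derivative_zero_outside_support[of T f x v] T der that compact_imp_closed by blast
  obtain M where M: "M \<ge> 0" "\<And>x. \<bar>f' x\<bar> \<le> M"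
  proof -
    have "bounded (f' ` T)"
      using T(1) cont(2) by (meson compact_continuous_image compact_imp_bounded continuous_on_subset subset_UNIV)
    then obtain M where "M > 0" "\<And>x. x \<in> T \<Longrightarrow> \<bar>f' x\<bar> \<le> M"
      unfolding bounded_pos by auto
    then show ?thesis using that[of M] f'0 by (metis abs_zero less_eq_real_def)
  qed
  have quot: "\<bar>(f (x + h *\<^sub>R v) - f x) / h\<bar> \<le> M * indicator T' x" if h: "0 < h" "h \<le> 1" for x h
  proof (cases "x \<in> T'")
    case True
    have "\<exists>z. 0 < z \<and> z < h \<and> f (x + h *\<^sub>R v) - f (x + 0 *\<^sub>R v) = (h - 0) * f' (x + z *\<^sub>R v)"
      by (rule MVT2[of 0 h "\<lambda>t. f (x + t *\<^sub>R v)" "\<lambda>t. f' (x + t *\<^sub>R v)"])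
         (use h DERIV_along_line[OF der] in auto)
    then show ?thesis using h True M(2) by (auto simp: abs_mult)
  next
    case False
    have "x + h *\<^sub>R v \<notin> T"
    proof
      assume "x + h *\<^sub>R v \<in> T"
      then have "x \<in> T'" unfolding T'_def using h by (auto intro!: image_eqI[of _ _ "(x + h *\<^sub>R v, h)"])
      with False show False by simp
    qed
    moreover have "x \<notin> T"
    proof
      assume "x \<in> T"
      then have "x \<in> T'" unfolding T'_def by (auto intro!: image_eqI[of _ _ "(x, 0)"])
      with False show False by simp
    qed
    ultimately show ?thesis using T(2) False by simp
  qed
  have contsh: "continuous_on UNIV (\<lambda>x. f (x + h *\<^sub>R v))" for h
    by (rule continuous_on_compose2[OF cont(1)]) (auto intro!: continuous_intros)
  show ?thesis
  proof (rule integral_dominated_convergence[where w="\<lambda>x. M * (indicator T' x *\<^sub>R \<bar>g x\<bar>)"])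
    show "(\<lambda>x. g x * f' x) \<in> borel_measurable lborel"
      using cont by (auto intro!: borel_measurable_continuous_onI continuous_intros)
    show "(\<lambda>x. g x * ((f (x + (1 / Suc n) *\<^sub>R v) - f x) / (1 / Suc n))) \<in> borel_measurable lborel" for n
      using cont contsh by (auto intro!: borel_measurable_continuous_onI continuous_intros)
    show "integrable lborel (\<lambda>x. M * (indicator T' x *\<^sub>R \<bar>g x\<bar>))"
      using T' cont(3) continuous_on_subset
      by (intro integrable_mult_right borel_integrable_compact) (auto intro!: continuous_intros)
    show "AE x in lborel. norm (g x * ((f (x + (1 / Suc n) *\<^sub>R v) - f x) / (1 / Suc n)))
             \<le> M * (indicator T' x *\<^sub>R \<bar>g x\<bar>)" for n
    proof (rule AE_I2)
      fix x
      have "\<bar>g x\<bar> * \<bar>(f (x + (1 / Suc n) *\<^sub>R v) - f x) / (1 / Suc n)\<bar> \<le> \<bar>g x\<bar> * (M * indicator T' x)"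
        by (intro mult_left_mono quot) auto
      then show "norm (g x * ((f (x + (1 / Suc n) *\<^sub>R v) - f x) / (1 / Suc n)))
             \<le> M * (indicator T' x *\<^sub>R \<bar>g x\<bar>)"
        unfolding real_norm_def abs_mult by (simp add: mult_ac)
    qed
    have "(\<lambda>n. (f (x + (1 / Suc n) *\<^sub>R v) - f x) / (1 / Suc n)) \<longlonglongrightarrow> f' x" for x
    proof -
      have "((\<lambda>h. (f (x + h *\<^sub>R v) - f x) / h) \<longlongrightarrow> f' x) (at 0)"
        using der[of x] unfolding DERIV_def by simp
      moreover have "filterlim (\<lambda>n. 1 / real (Suc n)) (at 0) sequentially"
        unfolding filterlim_at using LIMSEQ_inverse_real_of_nat
        by (auto simp: divide_inverse)
      ultimately show ?thesis by (rule filterlim_compose)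
    qed
    then show "AE x in lborel. (\<lambda>n. g x * ((f (x + (1 / Suc n) *\<^sub>R v) - f x) / (1 / Suc n))) \<longlonglongrightarrow> g x * f' x"
      by (intro AE_I2 tendsto_mult) auto
  qed
qed

lemma lborel_integral_shift:
  fixes f :: "'a::euclidean_space \<Rightarrow> real"
  assumes "f \<in> borel_measurable borel"
  shows "(\<integral>x. f (x + w) \<partial>lborel) = (\<integral>x. f x \<partial>lborel)"
proof -
  have "(\<integral>x. f x \<partial>lborel) = (\<integral>x. f x \<partial>(distr lborel borel ((+) w)))"
    by (simp add: lborel_distr_plus)
  also have "\<dots> = (\<integral>x. f (w + x) \<partial>lborel)"
    using assms by (subst integral_distr) auto
  finally show ?thesis by (simp add: add.commute)
qed

text \<open>The identity \<open>- \<integral> g \<partial>\<^sub>v f = \<integral> f \<partial>\<^sub>v g\<close> survives as an inequality when \<open>g\<close> is only continuous and its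
  increments along \<open>v\<close> are bounded below, which serves as a one-sided weak derivative.\<close>

lemma integral_mult_directional_derivative_le:
  fixes f f' g :: "'a::euclidean_space \<Rightarrow> real" and v :: 'a
  assumes T: "compact T" "\<And>x. x \<notin> T \<Longrightarrow> f x = 0"
    and cont: "continuous_on UNIV f" "continuous_on UNIV f'" "continuous_on UNIV g"
    and der: "\<And>x. ((\<lambda>t. f (x + t *\<^sub>R v)) has_real_derivative f' x) (at 0)"
    and nonneg: "\<And>x. f x \<ge> 0"
    and incr: "\<And>x h. h > 0 \<Longrightarrow> g x - g (x - h *\<^sub>R v) \<ge> \<kappa> * h"
  shows "(\<integral>x. g x * f' x \<partial>lborel) \<le> - \<kappa> * (\<integral>x. f x \<partial>lborel)"
proof -
  have intf: "integrable lborel f" by (rule integrable_compact_support[OF cont(1) T])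
  have contsh: "continuous_on UNIV (\<lambda>x. G (x + h *\<^sub>R v))" if "continuous_on UNIV G" for h and G :: "'a \<Rightarrow> real"
    by (rule continuous_on_compose2[OF that]) (auto intro!: continuous_intros)
  have "(\<integral>x. g x * ((f (x + h *\<^sub>R v) - f x) / h) \<partial>lborel) \<le> - \<kappa> * (\<integral>x. f x \<partial>lborel)" if h: "h > 0" for h
  proof -
    define T' where "T' = (\<lambda>x. x - h *\<^sub>R v) ` T"
    have T': "compact T'" unfolding T'_def using T(1)
      by (intro compact_continuous_image) (auto intro!: continuous_intros)
    have zero: "f (x + h *\<^sub>R v) = 0" if "x \<notin> T'" for x
    proof -
      have "x + h *\<^sub>R v \<notin> T"
      proof
        assume "x + h *\<^sub>R v \<in> T"
        then show False using that unfolding T'_def by (metis add_diff_cancel_right' image_eqI)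
      qed
      then show ?thesis by (rule T(2))
    qed
    have i1: "integrable lborel (\<lambda>x. g x * f (x + h *\<^sub>R v))"
      by (rule integrable_compact_support[OF _ T']) (use zero cont contsh in \<open>auto intro!: continuous_intros\<close>)
    have i2: "integrable lborel (\<lambda>x. g x * f x)"
      by (rule integrable_compact_support[OF _ T(1)]) (use T(2) cont in \<open>auto intro!: continuous_intros\<close>)
    have cg: "continuous_on UNIV (\<lambda>x. g (x - h *\<^sub>R v))"
      using contsh[OF cont(3), of "- h"] by simp
    have i3: "integrable lborel (\<lambda>x. g (x - h *\<^sub>R v) * f x)"
      by (rule integrable_compact_support[OF _ T(1)]) (use T(2) cont cg in \<open>auto intro!: continuous_intros\<close>)
    have "(\<integral>x. g x * f (x + h *\<^sub>R v) \<partial>lborel) = (\<integral>x. g (x - h *\<^sub>R v) * f x \<partial>lborel)"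
    proof -
      have "(\<lambda>x. g (x - h *\<^sub>R v) * f x) \<in> borel_measurable borel"
        using cg cont(1) by (intro borel_measurable_continuous_onI continuous_intros)
      from lborel_integral_shift[OF this, of "h *\<^sub>R v"] show ?thesis by simp
    qed
    then have "(\<integral>x. g x * ((f (x + h *\<^sub>R v) - f x) / h) \<partial>lborel)
        = (\<integral>x. g (x - h *\<^sub>R v) * f x \<partial>lborel) / h - (\<integral>x. g x * f x \<partial>lborel) / h"
      using i1 i2 by (simp add: right_diff_distrib diff_divide_distrib)
    also have "\<dots> = (\<integral>x. (g (x - h *\<^sub>R v) - g x) / h * f x \<partial>lborel)"
      using i3 i2 by (simp add: left_diff_distrib diff_divide_distrib)
    also have "\<dots> \<le> (\<integral>x. - \<kappa> * f x \<partial>lborel)"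
    proof (rule integral_mono)
      show "integrable lborel (\<lambda>x. (g (x - h *\<^sub>R v) - g x) / h * f x)"
        using i3 i2 by (simp add: left_diff_distrib diff_divide_distrib)
      show "integrable lborel (\<lambda>x. - \<kappa> * f x)" using intf by simp
      fix x
      show "(g (x - h *\<^sub>R v) - g x) / h * f x \<le> - \<kappa> * f x"
        using incr[OF h, of x] h nonneg[of x] by (intro mult_right_mono) (auto simp: field_simps)
    qed
    finally show ?thesis by simp
  qed
  then have "(\<integral>x. g x * ((f (x + (1 / Suc n) *\<^sub>R v) - f x) / (1 / Suc n)) \<partial>lborel) \<le> - \<kappa> * (\<integral>x. f x \<partial>lborel)" for n
    by (simp only: zero_less_divide_1_iff of_nat_0_less_iff zero_less_Suc)
  moreover have "(\<lambda>n. \<integral>x. g x * ((f (x + (1 / Suc n) *\<^sub>R v) - f x) / (1 / Suc n)) \<partial>lborel)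
      \<longlonglongrightarrow> (\<integral>x. g x * f' x \<partial>lborel)"
    by (rule difference_quotients_tendsto[where T=T]) (use T cont der in auto)
  ultimately show ?thesis
    by (intro LIMSEQ_le_const2) auto
qed

lemma integral_directional_derivative_eq_0:
  fixes f f' :: "'a::euclidean_space \<Rightarrow> real" and v :: 'a
  assumes T: "compact T" "\<And>x. x \<notin> T \<Longrightarrow> f x = 0"
    and cont: "continuous_on UNIV f" "continuous_on UNIV f'"
    and der: "\<And>x. ((\<lambda>t. f (x + t *\<^sub>R v)) has_real_derivative f' x) (at 0)"
  shows "(\<integral>x. f' x \<partial>lborel) = 0"
proof -
  have intf: "integrable lborel f" by (rule integrable_compact_support[OF cont(1) T])
  have "(\<integral>x. 1 * ((f (x + h *\<^sub>R v) - f x) / h) \<partial>lborel) = 0" for h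
  proof -
    have "integrable lborel (\<lambda>x. f (x + h *\<^sub>R v))"
    proof (rule integrable_compact_support)
      show "continuous_on UNIV (\<lambda>x. f (x + h *\<^sub>R v))"
        by (rule continuous_on_compose2[OF cont(1)]) (auto intro!: continuous_intros)
      show "compact ((\<lambda>x. x - h *\<^sub>R v) ` T)" using T(1)
        by (intro compact_continuous_image) (auto intro!: continuous_intros)
      fix x assume "x \<notin> (\<lambda>x. x - h *\<^sub>R v) ` T"
      then have "x + h *\<^sub>R v \<notin> T" by (metis add_diff_cancel_right' image_eqI)
      then show "f (x + h *\<^sub>R v) = 0" by (rule T(2))
    qed
    then show ?thesis using intf lborel_integral_shift[of f "h *\<^sub>R v"] cont(1)
      by (simp add: borel_measurable_continuous_onI)
  qed
  moreover have "(\<lambda>n. \<integral>x. 1 * ((f (x + (1 / Suc n) *\<^sub>R v) - f x) / (1 / Suc n)) \<partial>lborel)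
      \<longlonglongrightarrow> (\<integral>x. 1 * f' x \<partial>lborel)"
    by (rule difference_quotients_tendsto[where T=T]) (use T cont der in auto)
  ultimately have "(\<lambda>n. 0) \<longlonglongrightarrow> (\<integral>x. 1 * f' x \<partial>lborel)"
    by (simp only:)
  then show ?thesis by (simp add: LIMSEQ_const_iff)
qed

lemma continuous_on_extend_by_zero:
  fixes f :: "'a::t2_space \<Rightarrow> real"
  assumes "open \<Omega>" "closed T" "T \<subseteq> \<Omega>" "continuous_on \<Omega> f" "\<And>x. x \<notin> T \<Longrightarrow> f x = 0"
  shows "continuous_on UNIV f"
proof -
  have "continuous_on (- T) f"
    by (rule continuous_on_eq[of _ "\<lambda>_. 0"]) (use assms(5) in auto)
  then have "continuous_on (\<Omega> \<union> - T) f"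
    using assms(1,2,4) by (intro continuous_on_open_Un) auto
  moreover have "\<Omega> \<union> - T = UNIV" using assms(3) by auto
  ultimately show ?thesis by simp
qed


text \<open>Both facts for functions that are smooth only on an open set and have compact support in it.\<close>

lemma
  fixes f f' g :: "'a::euclidean_space \<Rightarrow> real" and v :: 'a
  assumes \<Omega>: "open \<Omega>" "compact T" "T \<subseteq> \<Omega>" and zero: "\<And>x. x \<notin> T \<Longrightarrow> f x = 0" "\<And>x. x \<notin> T \<Longrightarrow> f' x = 0"
    and cont: "continuous_on \<Omega> f" "continuous_on \<Omega> f'"
    and der: "\<And>x. x \<in> \<Omega> \<Longrightarrow> ((\<lambda>t. f (x + t *\<^sub>R v)) has_real_derivative f' x) (at 0)"
  shows integral_directional_derivative_on_eq_0: "(\<integral>x. f' x \<partial>lborel) = 0"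
    and integral_mult_directional_derivative_on_le: "\<lbrakk>continuous_on UNIV g; \<And>x. f x \<ge> 0; \<And>x h. h > 0 \<Longrightarrow> g x - g (x - h *\<^sub>R v) \<ge> \<kappa> * h\<rbrakk>
       \<Longrightarrow> (\<integral>x. g x * f' x \<partial>lborel) \<le> - \<kappa> * (\<integral>x. f x \<partial>lborel)"
proof -
  have cl: "closed T" using \<Omega>(2) by (rule compact_imp_closed)
  have c: "continuous_on UNIV f" "continuous_on UNIV f'"
    using continuous_on_extend_by_zero[OF \<Omega>(1) cl \<Omega>(3)] cont zero by blast+
  have d: "((\<lambda>t. f (x + t *\<^sub>R v)) has_real_derivative f' x) (at 0)" for x
  proof (cases "x \<in> T")
    case True
    then show ?thesis using der \<Omega>(3) by auto
  next
    case False
    then show ?thesis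
      using directional_derivative_extend_by_zero[OF cl zero(1)] zero(2) by simp
  qed
  show "(\<integral>x. f' x \<partial>lborel) = 0"
    by (rule integral_directional_derivative_eq_0[OF \<Omega>(2) zero(1) c d])
  show "(\<integral>x. g x * f' x \<partial>lborel) \<le> - \<kappa> * (\<integral>x. f x \<partial>lborel)"
    if "continuous_on UNIV g" "\<And>x. f x \<ge> 0" "\<And>x h. h > 0 \<Longrightarrow> g x - g (x - h *\<^sub>R v) \<ge> \<kappa> * h"
    by (rule integral_mult_directional_derivative_le[OF \<Omega>(2) zero(1) c that(1) d that(2,3)])
qed

section \<open>The distance to a closed convex set\<close>

lemma has_derivative_imp_directional:
  fixes f :: "'a::real_normed_vector \<Rightarrow> real"
  assumes "(f has_derivative f') (at x)"
  shows "((\<lambda>t. f (x + t *\<^sub>R v)) has_real_derivative f' v) (at 0)"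
proof -
  have "((\<lambda>t::real. x + t *\<^sub>R v) has_derivative (\<lambda>t. t *\<^sub>R v)) (at 0)"
    by (auto intro!: derivative_eq_intros)
  then have "((\<lambda>t. f (x + t *\<^sub>R v)) has_derivative (\<lambda>t. f' (t *\<^sub>R v))) (at 0)"
    using has_derivative_compose[of "\<lambda>t::real. x + t *\<^sub>R v" "\<lambda>t. t *\<^sub>R v" 0 UNIV f f'] assms
    by simp
  moreover have "(\<lambda>t. f' (t *\<^sub>R v)) = (*) (f' v)"
    using bounded_linear.linear[OF has_derivative_bounded_linear[OF assms]]
    by (auto simp: linear_cmul)
  ultimately show ?thesis unfolding has_field_derivative_def by simp
qed

definition orthonormal :: "'a::euclidean_space set \<Rightarrow> bool"
  where "orthonormal B \<longleftrightarrow> finite B \<and> (\<forall>e\<in>B. \<forall>e'\<in>B. e \<bullet> e' = (if e = e' then 1 else 0))"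

lemma orthonormalI:
  assumes "pairwise orthogonal B" "\<And>x. x \<in> B \<Longrightarrow> norm x = 1" "finite B"
  shows "orthonormal B"
  using assms unfolding orthonormal_def pairwise_def orthogonal_def by (auto simp: norm_eq_1)

lemma inner_eq_sum_orthonormal:
  assumes "orthonormal B" "v \<in> span B"
  shows "v \<bullet> w = (\<Sum>e\<in>B. (v \<bullet> e) * (w \<bullet> e))"
proof -
  have fB: "finite B" and on: "\<And>e e'. e \<in> B \<Longrightarrow> e' \<in> B \<Longrightarrow> e \<bullet> e' = (if e = e' then 1 else 0)"
    using assms(1) unfolding orthonormal_def by auto
  obtain u where u: "v = (\<Sum>e\<in>B. u e *\<^sub>R e)"
    using assms(2) span_finite[OF fB] by auto
  have "v \<bullet> e' = u e'" if "e' \<in> B" for e'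
  proof -
    have "v \<bullet> e' = (\<Sum>e\<in>B. u e * (if e = e' then 1 else 0))"
      unfolding u inner_sum_left using on that by (intro sum.cong) auto
    also have "\<dots> = u e'" using fB that by (subst sum.remove[of B e']) (auto intro!: sum.neutral)
    finally show ?thesis .
  qed
  then show ?thesis unfolding u inner_sum_left by (auto simp: inner_commute intro!: sum.cong)
qed

text \<open>Directions along and normal to \<open>K\<close>; Parseval's identity translates between this frame and the
  coordinate directions that define the operator.\<close>

lemma orthonormal_split_exists:
  fixes L :: "'a::euclidean_space set"
  assumes "subspace L"
  obtains B1 B2 where "orthonormal B1" "orthonormal B2" "span B1 = L" "card B1 = dim L"
    "card B2 = DIM('a) - dim L" "\<And>e l. e \<in> B2 \<Longrightarrow> l \<in> L \<Longrightarrow> l \<bullet> e = 0"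
    "\<And>v w :: 'a. v \<bullet> w = (\<Sum>e\<in>B1. (v \<bullet> e) * (w \<bullet> e)) + (\<Sum>e\<in>B2. (v \<bullet> e) * (w \<bullet> e))"
proof -
  define M where "M = {y. \<forall>x\<in>L. orthogonal x y}"
  have sM: "subspace M" unfolding M_def by (rule subspace_orthogonal_to_vectors)
  have "dim M + dim L = DIM('a)"
    using dim_subspace_orthogonal_to_vectors[OF assms subspace_UNIV] unfolding M_def by simp
  then have dM: "dim M = DIM('a) - dim L" by simp
  obtain B1 where B1: "B1 \<subseteq> L" "pairwise orthogonal B1" "\<And>x. x \<in> B1 \<Longrightarrow> norm x = 1"
      "independent B1" "card B1 = dim L" "span B1 = L"
    using orthonormal_basis_subspace[OF assms] by blast
  obtain B2 where B2: "B2 \<subseteq> M" "pairwise orthogonal B2" "\<And>x. x \<in> B2 \<Longrightarrow> norm x = 1"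
      "independent B2" "card B2 = dim M" "span B2 = M"
    using orthonormal_basis_subspace[OF sM] by blast
  have on: "orthonormal B1" "orthonormal B2"
    using B1 B2 independent_imp_finite by (auto intro!: orthonormalI)
  have orth: "l \<bullet> e = 0" if "e \<in> M" "l \<in> L" for e l
    using that unfolding M_def orthogonal_def by auto
  have dec: "v \<bullet> w = (\<Sum>e\<in>B1. (v \<bullet> e) * (w \<bullet> e)) + (\<Sum>e\<in>B2. (v \<bullet> e) * (w \<bullet> e))" for v w :: 'a
  proof -
    obtain y z where yz: "y \<in> span L" "\<And>w. w \<in> span L \<Longrightarrow> orthogonal z w" "v = y + z"
      using orthogonal_subspace_decomp_exists[of L v] by blast
    have yL: "y \<in> L" using yz(1) assms by (simp add: span_eq_iff[THEN iffD2])
    have zM: "z \<in> M" unfolding M_def using yz(2) by (auto simp: orthogonal_commute span_base)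
    have "y \<bullet> w = (\<Sum>e\<in>B1. (y \<bullet> e) * (w \<bullet> e))"
      using inner_eq_sum_orthonormal[OF on(1)] yL B1(6) by simp
    also have "\<dots> = (\<Sum>e\<in>B1. (v \<bullet> e) * (w \<bullet> e))"
    proof (intro sum.cong refl)
      fix e assume "e \<in> B1"
      then have "z \<bullet> e = 0" using orth[OF zM, of e] B1(1) by (auto simp: inner_commute)
      then show "(y \<bullet> e) * (w \<bullet> e) = (v \<bullet> e) * (w \<bullet> e)" by (simp add: yz(3) inner_add_left)
    qed
    finally have 1: "y \<bullet> w = (\<Sum>e\<in>B1. (v \<bullet> e) * (w \<bullet> e))" .
    have "z \<bullet> w = (\<Sum>e\<in>B2. (z \<bullet> e) * (w \<bullet> e))"
      using inner_eq_sum_orthonormal[OF on(2)] zM B2(6) by simp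
    also have "\<dots> = (\<Sum>e\<in>B2. (v \<bullet> e) * (w \<bullet> e))"
      using orth[OF _ yL] B2(1) by (intro sum.cong) (auto simp: yz(3) inner_add_left)
    finally show ?thesis using 1 by (simp add: yz(3) inner_add_left)
  qed
  have "card B2 = DIM('a) - dim L" using B2(5) dM by simp
  moreover have "l \<bullet> e = 0" if "e \<in> B2" "l \<in> L" for e l using orth that B2(1) by blast
  ultimately show ?thesis by (rule that[OF on B1(6) B1(5) _ _ dec])
qed

lemma direction_subspace:
  fixes K :: "'a::euclidean_space set"
  assumes "a \<in> K" "aff_dim K = int k"
  shows "subspace ((\<lambda>x. - a + x) ` (affine hull K))" "dim ((\<lambda>x. - a + x) ` (affine hull K)) = k"
proof -
  have aA: "a \<in> affine hull K" using assms(1) hull_inc by metis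
  show sub: "subspace ((\<lambda>x. - a + x) ` (affine hull K))"
    using affine_diffs_subspace[OF affine_affine_hull aA] by simp
  have "aff_dim K = aff_dim ((\<lambda>x. - a + x) ` (affine hull K))"
    by (metis aff_dim_affine_hull aff_dim_translation_eq)
  then show "dim ((\<lambda>x. - a + x) ` (affine hull K)) = k" using assms(2) aff_dim_subspace[OF sub] by simp
qed

text \<open>This vector field is \<open>d \<nabla>d\<close>, half the gradient of the squared distance; unlike \<open>\<nabla>d\<close> it is
  continuous on the whole space.\<close>

definition offset :: "'a::euclidean_space set \<Rightarrow> 'a \<Rightarrow> 'a"
  where "offset K x = x - closest_point K x"

context
  fixes K :: "'a::euclidean_space set"
  assumes K: "closed K" "convex K" "K \<noteq> {}"
begin

lemma norm_offset: "norm (offset K x) = infdist x K"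
proof -
  have "infdist x K = dist x (closest_point K x)"
    using setdist_closest_point[OF K(1,3)] infdist_eq_setdist by metis
  then show ?thesis by (simp add: offset_def dist_norm)
qed

lemma continuous_on_offset: "continuous_on S (offset K)"
  unfolding offset_def[abs_def]
  by (intro continuous_intros continuous_on_closest_point K)

lemma infdist_pos: "x \<notin> K \<Longrightarrow> infdist x K > 0"
  using in_closed_iff_infdist_zero[OF K(1,3)] infdist_nonneg[of x K] by (metis less_eq_real_def)

text \<open>The squared distance is differentiable everywhere: comparing with the closest point of \<open>x\<close>
  and with that of \<open>y\<close> bounds its increment from both sides, up to a quadratic error, and the two
  bounds match because the closest-point map is nonexpansive.\<close>

lemma has_derivative_infdist_squared:
  "((\<lambda>x. (infdist x K)\<^sup>2) has_derivative (\<lambda>h. 2 * (offset K x \<bullet> h))) (at x)"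
proof -
  have sq: "(infdist x K)\<^sup>2 = offset K x \<bullet> offset K x" for x
    by (simp add: norm_offset[symmetric] power2_norm_eq_inner)
  have upper: "(infdist y K)\<^sup>2 \<le> (infdist x K)\<^sup>2 + 2 * (offset K x \<bullet> (y - x)) + (y - x) \<bullet> (y - x)" for x y
  proof -
    have "infdist y K \<le> dist y (closest_point K x)"
      by (intro infdist_le closest_point_in_set K)
    then have "(infdist y K)\<^sup>2 \<le> (norm (offset K x + (y - x)))\<^sup>2"
      by (intro power_mono infdist_nonneg) (simp add: offset_def dist_norm)
    then show ?thesis unfolding power2_norm_eq_inner sq by (simp add: inner_add inner_commute)
  qed
  have mono: "(offset K y - offset K x) \<bullet> (y - x) \<ge> 0" for x y
  proof -
    have "(closest_point K y - closest_point K x) \<bullet> (y - x)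
        \<le> norm (closest_point K y - closest_point K x) * norm (y - x)"
      by (rule norm_cauchy_schwarz)
    also have "\<dots> \<le> norm (y - x) * norm (y - x)"
      using closest_point_lipschitz[OF K(2,1,3), of y x] by (intro mult_right_mono) (auto simp: dist_norm)
    finally show ?thesis unfolding offset_def
      by (simp add: algebra_simps power2_norm_eq_inner flip: power2_eq_square)
  qed
  have "\<bar>(infdist y K)\<^sup>2 - (infdist x K)\<^sup>2 - 2 * (offset K x \<bullet> (y - x))\<bar> \<le> norm (y - x) * norm (y - x)" for y
    using upper[of y x] upper[of x y] mono[of y x]
    by (simp add: inner_diff_left inner_diff_right inner_commute flip: power2_eq_square power2_norm_eq_inner)
       (simp add: power2_norm_eq_inner inner_diff_left inner_diff_right inner_commute)
  note est = this
  show ?thesis unfolding has_derivative_at_alt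
  proof (intro conjI allI impI)
    show "bounded_linear (\<lambda>h. 2 * (offset K x \<bullet> h))"
      by (intro bounded_linear_intros)
    fix e :: real assume e: "e > 0"
    show "\<exists>d>0. \<forall>y. norm (y - x) < d \<longrightarrow>
        norm ((infdist y K)\<^sup>2 - (infdist x K)\<^sup>2 - 2 * (offset K x \<bullet> (y - x))) \<le> e * norm (y - x)"
    proof (intro exI[of _ e] conjI allI impI e)
      fix y assume "norm (y - x) < e"
      then have "norm (y - x) * norm (y - x) \<le> e * norm (y - x)" by (intro mult_right_mono) auto
      then show "norm ((infdist y K)\<^sup>2 - (infdist x K)\<^sup>2 - 2 * (offset K x \<bullet> (y - x))) \<le> e * norm (y - x)"
        using est[of y] by simp
    qed
  qed
qed

lemma has_derivative_infdist_powr: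
  assumes "x \<notin> K"
  shows "((\<lambda>x. infdist x K powr s) has_derivative
           (\<lambda>h. s * infdist x K powr (s - 2) * (offset K x \<bullet> h))) (at x)"
proof -
  have eq: "infdist y K powr t = (infdist y K)\<^sup>2 powr (t / 2)" for y t
  proof (cases "infdist y K = 0")
    case False
    then have "infdist y K > 0" using infdist_nonneg[of y K] by linarith
    then show ?thesis by (simp add: powr_powr flip: powr_numeral)
  qed simp
  have pos: "(infdist x K)\<^sup>2 > 0" using infdist_pos[OF assms] by simp
  have "((\<lambda>z. z powr (s / 2)) has_real_derivative s / 2 * (infdist x K)\<^sup>2 powr (s / 2 - 1)) (at ((infdist x K)\<^sup>2))"
    using has_real_derivative_powr[OF pos, of "s / 2"] by simp
  from has_derivative_compose[OF has_derivative_infdist_squared this[unfolded has_field_derivative_def]]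
  have "((\<lambda>x. (infdist x K)\<^sup>2 powr (s / 2)) has_derivative
          (\<lambda>h. s / 2 * (infdist x K)\<^sup>2 powr (s / 2 - 1) * (2 * (offset K x \<bullet> h)))) (at x)" .
  note der = this
  have fn: "s / 2 * (infdist x K)\<^sup>2 powr (s / 2 - 1) * (2 * (offset K x \<bullet> h))
      = s * infdist x K powr (s - 2) * (offset K x \<bullet> h)" for h
    unfolding eq[of x "s - 2"] by (simp add: diff_divide_distrib)
  have "(\<lambda>x. (infdist x K)\<^sup>2 powr (s / 2)) = (\<lambda>x. infdist x K powr s)"
    using eq[of _ s] by (intro ext) simp
  then show ?thesis using der unfolding fn by simp
qed

text \<open>This is \<open>\<Delta>(d\<^sup>2/2) \<ge> DIM - dim K\<close> in the weak sense.  Normally to the affine hull the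
  offset grows with slope one; along it the offset is monotone because the closest-point map is
  nonexpansive.\<close>

lemma integral_offset_gradient_le:
  assumes T: "compact T" "T \<subseteq> - K" and zero: "\<And>x. x \<notin> T \<Longrightarrow> u x = 0" "\<And>x. x \<notin> T \<Longrightarrow> G x = 0"
    and der: "\<And>x. x \<notin> K \<Longrightarrow> (u has_derivative (\<lambda>h. G x \<bullet> h)) (at x)"
    and cont: "continuous_on (- K) G"
    and nonneg: "\<And>x. u x \<ge> 0"
    and dim: "aff_dim K = int k"
  shows "(\<integral>x. offset K x \<bullet> G x \<partial>lborel) \<le> - (real DIM('a) - real k) * (\<integral>x. u x \<partial>lborel)"
proof -
  obtain a where a: "a \<in> K" using K(3) by auto
  define L where "L = (\<lambda>x. - a + x) ` (affine hull K)"
  have sub: "subspace L" and dimL: "dim L = k"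
    unfolding L_def using direction_subspace[OF a dim] by auto
  have kd: "k \<le> DIM('a)" using dimL dim_subset_UNIV[of L] by simp
  obtain B1 B2 where B: "orthonormal B1" "orthonormal B2" "span B1 = L" "card B1 = dim L" "card B2 = DIM('a) - dim L"
      "\<And>e l. e \<in> B2 \<Longrightarrow> l \<in> L \<Longrightarrow> l \<bullet> e = 0"
      "\<And>v w :: 'a. v \<bullet> w = (\<Sum>e\<in>B1. (v \<bullet> e) * (w \<bullet> e)) + (\<Sum>e\<in>B2. (v \<bullet> e) * (w \<bullet> e))"
    by (rule orthonormal_split_exists[OF sub]) blast
  have op: "open (- K)" using K(1) by (rule open_Compl)
  have contu: "continuous_on (- K) u"
    by (meson ComplD der continuous_at_imp_continuous_on has_derivative_continuous)
  have diffL: "closest_point K x - closest_point K y \<in> L" for x y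
  proof -
    have "closest_point K z - a \<in> L" for z
      using closest_point_in_set[OF K(1,3), of z] hull_inc[of "closest_point K z" K affine]
      unfolding L_def by (auto intro!: image_eqI[of _ _ "closest_point K z"])
    from subspace_diff[OF sub this[of x] this[of y]] show ?thesis by simp
  qed
  have le: "(\<integral>x. (offset K x \<bullet> e) * (G x \<bullet> e) \<partial>lborel) \<le> - \<kappa> * (\<integral>x. u x \<partial>lborel)"
    if \<kappa>: "\<And>x h. h > 0 \<Longrightarrow> offset K x \<bullet> e - offset K (x - h *\<^sub>R e) \<bullet> e \<ge> \<kappa> * h" for e \<kappa>
  proof (rule integral_mult_directional_derivative_on_le[OF op T zero(1) _ contu _ _ _ nonneg \<kappa>])
    show "\<And>x. x \<notin> T \<Longrightarrow> G x \<bullet> e = 0" using zero(2) by simp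
    show "continuous_on (- K) (\<lambda>x. G x \<bullet> e)" using cont by (intro continuous_intros)
    show "continuous_on UNIV (\<lambda>x. offset K x \<bullet> e)"
      by (intro continuous_intros continuous_on_offset)
    fix x assume x: "x \<in> - K"
    then show "((\<lambda>t. u (x + t *\<^sub>R e)) has_real_derivative G x \<bullet> e) (at 0)"
      using has_derivative_imp_directional[OF der] by simp
  qed auto
  have b1: "(\<integral>x. (offset K x \<bullet> e) * (G x \<bullet> e) \<partial>lborel) \<le> 0" if "e \<in> B1" for e
  proof -
    have ee: "e \<bullet> e = 1" using B(1) that unfolding orthonormal_def by auto
    have "offset K x \<bullet> e - offset K (x - h *\<^sub>R e) \<bullet> e \<ge> 0 * h" if h: "h > 0" for x h
    proof -
      have "(closest_point K x - closest_point K (x - h *\<^sub>R e)) \<bullet> e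
          \<le> norm (closest_point K x - closest_point K (x - h *\<^sub>R e)) * norm e"
        by (rule norm_cauchy_schwarz)
      also have "\<dots> \<le> h"
        using closest_point_lipschitz[OF K(2,1,3), of x "x - h *\<^sub>R e"] ee h
        by (simp add: dist_norm norm_eq_1[THEN iffD2])
      finally show ?thesis using ee by (simp add: offset_def inner_diff_left)
    qed
    from le[OF this] show ?thesis by simp
  qed
  have b2: "(\<integral>x. (offset K x \<bullet> e) * (G x \<bullet> e) \<partial>lborel) \<le> - (\<integral>x. u x \<partial>lborel)" if "e \<in> B2" for e
  proof -
    have ee: "e \<bullet> e = 1" using B(2) that unfolding orthonormal_def by auto
    have "offset K x \<bullet> e - offset K (x - h *\<^sub>R e) \<bullet> e \<ge> 1 * h" for x h
      using B(6)[OF that diffL, of x "x - h *\<^sub>R e"] ee by (simp add: offset_def inner_diff_left)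
    from le[OF this] show ?thesis by simp
  qed
  have int: "integrable lborel (\<lambda>x. (offset K x \<bullet> e) * (G x \<bullet> e))" for e
  proof (rule integrable_compact_support[OF _ T(1)])
    have "continuous_on UNIV (\<lambda>x. G x \<bullet> e)"
      by (rule continuous_on_extend_by_zero[OF op compact_imp_closed[OF T(1)] T(2)])
         (use cont zero(2) in \<open>auto intro!: continuous_intros\<close>)
    moreover have "continuous_on UNIV (\<lambda>x. offset K x \<bullet> e)"
      by (intro continuous_intros continuous_on_offset)
    ultimately show "continuous_on UNIV (\<lambda>x. (offset K x \<bullet> e) * (G x \<bullet> e))"
      by (intro continuous_on_mult)
  qed (use zero in auto)
  have "(\<integral>x. offset K x \<bullet> G x \<partial>lborel)
      = (\<Sum>e\<in>B1. \<integral>x. (offset K x \<bullet> e) * (G x \<bullet> e) \<partial>lborel) + (\<Sum>e\<in>B2. \<integral>x. (offset K x \<bullet> e) * (G x \<bullet> e) \<partial>lborel)"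
    by (subst B(7)) (simp add: int Bochner_Integration.integral_sum)
  also have "\<dots> \<le> 0 + (\<Sum>e\<in>B2. - (\<integral>x. u x \<partial>lborel))"
    by (intro add_mono sum_nonpos sum_mono b1 b2)
  also have "\<dots> = - (real DIM('a) - real k) * (\<integral>x. u x \<partial>lborel)"
    using B(5) dimL kd by (simp add: of_nat_diff algebra_simps)
  finally show ?thesis .
qed

end

section \<open>The operator on test functions\<close>

lemma integrable_extend_by_zero:
  fixes f :: "'a::euclidean_space \<Rightarrow> real"
  assumes "open \<Omega>" "compact T" "T \<subseteq> \<Omega>" "continuous_on \<Omega> f" "\<And>x. x \<notin> T \<Longrightarrow> f x = 0"
  shows "integrable lborel f"
proof (rule integrable_compact_support[OF _ assms(2,5)])
  show "continuous_on UNIV f"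
    by (rule continuous_on_extend_by_zero[OF assms(1) compact_imp_closed[OF assms(2)] assms(3-5)])
qed

definition grad :: "('a::euclidean_space \<Rightarrow> real) \<Rightarrow> 'a \<Rightarrow> 'a"
  where "grad f x = (\<Sum>b\<in>Basis. partial b f x *\<^sub>R b)"

lemma partial_eqI:
  assumes "(f has_derivative f') (at x)"
  shows "partial b f x = f' b"
  unfolding partial_def by (rule DERIV_imp_deriv[OF has_derivative_imp_directional[OF assms]])

lemma has_derivative_grad:
  assumes "f differentiable (at x)"
  shows "(f has_derivative (\<lambda>h. grad f x \<bullet> h)) (at x)"
proof -
  obtain f' where f': "(f has_derivative f') (at x)" using assms unfolding differentiable_def by blast
  interpret bounded_linear f' using has_derivative_bounded_linear[OF f'] .
  have "f' h = grad f x \<bullet> h" for h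
  proof -
    have "f' h = f' (\<Sum>b\<in>Basis. (h \<bullet> b) *\<^sub>R b)" by (simp add: euclidean_representation)
    also have "\<dots> = (\<Sum>b\<in>Basis. (h \<bullet> b) * f' b)" by (simp add: sum scaleR)
    also have "\<dots> = (\<Sum>b\<in>Basis. (h \<bullet> b) * partial b f x)" using partial_eqI[OF f'] by simp
    also have "\<dots> = grad f x \<bullet> h"
      unfolding grad_def inner_sum_left by (intro sum.cong) (auto simp: inner_commute)
    finally show ?thesis .
  qed
  then have "f' = (\<lambda>h. grad f x \<bullet> h)" by (rule ext)
  then show ?thesis using f' by simp
qed

lemma partial_zero_outside_support:
  assumes "closed T" "\<And>x. x \<notin> T \<Longrightarrow> f x = 0" "x \<notin> T"
  shows "partial b f x = 0"
  unfolding partial_def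
  by (rule DERIV_imp_deriv) (rule directional_derivative_extend_by_zero[OF assms])

lemma div_op_zero_outside_support:
  assumes "closed T" "\<And>x. x \<notin> T \<Longrightarrow> f x = 0" "x \<notin> T"
  shows "div_op c f x = 0"
proof -
  have "partial b f y = 0" if "y \<notin> T" for b y
    using partial_zero_outside_support[of T f y b] assms that by blast
  then have "partial b (\<lambda>y. c y * partial b f y) x = 0" for b
    by (intro partial_zero_outside_support[OF assms(1) _ assms(3)]) auto
  then show ?thesis unfolding div_op_def by simp
qed

context
  fixes \<Omega> :: "'a::euclidean_space set" and \<phi> :: "'a \<Rightarrow> real" and T :: "'a set"
  assumes \<phi>: "\<phi> \<in> Cc2 \<Omega>" and T_def: "T = closure {x. \<phi> x \<noteq> 0}"
begin

lemma Cc2_support: "compact T" "T \<subseteq> \<Omega>" "x \<notin> T \<Longrightarrow> \<phi> x = 0"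
  using \<phi> closure_subset[of "{x. \<phi> x \<noteq> 0}"] unfolding Cc2_def T_def by auto

lemma Cc2_has_derivative: "x \<in> \<Omega> \<Longrightarrow> (\<phi> has_derivative (\<lambda>h. grad \<phi> x \<bullet> h)) (at x)"
  using \<phi> unfolding Cc2_def C2_on_def C1_on_def by (auto intro!: has_derivative_grad)

lemma Cc2_partial_has_derivative:
  "b \<in> Basis \<Longrightarrow> x \<in> \<Omega> \<Longrightarrow> (partial b \<phi> has_derivative (\<lambda>h. grad (partial b \<phi>) x \<bullet> h)) (at x)"
  using \<phi> unfolding Cc2_def C2_on_def C1_on_def by (auto intro!: has_derivative_grad)

lemma Cc2_continuous_on_grad: "continuous_on \<Omega> (grad \<phi>)"
  using \<phi> unfolding Cc2_def C2_on_def C1_on_def grad_def[abs_def] by (auto intro!: continuous_intros)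

lemma Cc2_continuous_on_grad_partial: "b \<in> Basis \<Longrightarrow> continuous_on \<Omega> (grad (partial b \<phi>))"
  using \<phi> unfolding Cc2_def C2_on_def C1_on_def grad_def[abs_def] by (auto intro!: continuous_intros)

lemma Cc2_continuous_on: "continuous_on \<Omega> \<phi>"
  by (meson Cc2_has_derivative continuous_at_imp_continuous_on has_derivative_continuous)

lemma Cc2_partial_zero: "x \<notin> T \<Longrightarrow> partial b \<phi> x = 0"
  by (rule partial_zero_outside_support[OF compact_imp_closed[OF Cc2_support(1)] Cc2_support(3)])

lemma Cc2_grad_zero: "x \<notin> T \<Longrightarrow> grad \<phi> x = 0"
  unfolding grad_def by (simp add: Cc2_partial_zero)

lemma div_op_product_rule:
  assumes c: "(c has_derivative (\<lambda>h. Gc \<bullet> h)) (at x)" and x: "x \<in> \<Omega>" and b: "b \<in> Basis"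
  shows "((\<lambda>y. c y * partial b \<phi> y) has_derivative
           (\<lambda>h. (partial b \<phi> x *\<^sub>R Gc + c x *\<^sub>R grad (partial b \<phi>) x) \<bullet> h)) (at x)"
  using has_derivative_mult[OF c Cc2_partial_has_derivative[OF b x]]
  by (rule has_derivative_eq_rhs) (auto simp: inner_add_left algebra_simps)

lemma continuous_on_div_op:
  assumes c: "\<And>x. x \<in> \<Omega> \<Longrightarrow> (c has_derivative (\<lambda>h. Gc x \<bullet> h)) (at x)" and Gc: "continuous_on \<Omega> Gc"
  shows "continuous_on \<Omega> (div_op c \<phi>)"
proof -
  have "div_op c \<phi> x = - (\<Sum>b\<in>Basis. (partial b \<phi> x *\<^sub>R Gc x + c x *\<^sub>R grad (partial b \<phi>) x) \<bullet> b)"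
    if "x \<in> \<Omega>" for x
    unfolding div_op_def using partial_eqI[OF div_op_product_rule[OF c[OF that] that]] by simp
  note eq = this
  have cc: "continuous_on \<Omega> c"
    by (meson c continuous_at_imp_continuous_on has_derivative_continuous)
  have cp: "continuous_on \<Omega> (partial b \<phi>)" if "b \<in> Basis" for b
    using \<phi> that unfolding Cc2_def C2_on_def C1_on_def by auto
  have "continuous_on \<Omega> (\<lambda>x. - (\<Sum>b\<in>Basis. (partial b \<phi> x *\<^sub>R Gc x + c x *\<^sub>R grad (partial b \<phi>) x) \<bullet> b))"
    by (intro continuous_intros cc cp Gc Cc2_continuous_on_grad_partial)
  then show ?thesis by (rule continuous_on_eq) (rule eq[symmetric])
qed

text \<open>The field \<open>c v \<nabla>\<phi>\<close> inherits compact support from \<open>\<phi>\<close>, so its divergence integrates to zero.\<close>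

lemma integral_div_op_mult:
  assumes op: "open \<Omega>"
    and c: "\<And>x. x \<in> \<Omega> \<Longrightarrow> (c has_derivative (\<lambda>h. Gc x \<bullet> h)) (at x)" "continuous_on \<Omega> Gc"
    and v: "\<And>x. x \<in> \<Omega> \<Longrightarrow> (v has_derivative (\<lambda>h. Gv x \<bullet> h)) (at x)" "continuous_on \<Omega> Gv"
  shows "(\<integral>x. div_op c \<phi> x * v x \<partial>lborel) = (\<integral>x. c x * (grad \<phi> x \<bullet> Gv x) \<partial>lborel)"
proof -
  have clT: "closed T" unfolding T_def by simp
  have cc: "continuous_on \<Omega> c" by (meson c(1) continuous_at_imp_continuous_on has_derivative_continuous)
  have cv: "continuous_on \<Omega> v" by (meson v(1) continuous_at_imp_continuous_on has_derivative_continuous)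
  have p0: "partial b \<phi> x = 0" if "x \<notin> T" for x b
    using that by (rule Cc2_partial_zero)
  have cp: "continuous_on \<Omega> (partial b \<phi>)" if "b \<in> Basis" for b
    using \<phi> that unfolding Cc2_def C2_on_def C1_on_def by auto
  define P where "P = (\<lambda>b x. partial b (\<lambda>y. c y * partial b \<phi> y) x)"
  have P0: "P b x = 0" if "x \<notin> T" for x b
    unfolding P_def using p0 by (intro partial_zero_outside_support[OF clT _ that]) auto
  have P: "P b x = (partial b \<phi> x *\<^sub>R Gc x + c x *\<^sub>R grad (partial b \<phi>) x) \<bullet> b" if "b \<in> Basis" "x \<in> \<Omega>" for b x
    unfolding P_def using partial_eqI[OF div_op_product_rule[OF c(1)[OF that(2)] that(2,1)]] .
  have cP: "continuous_on \<Omega> (P b)" if b: "b \<in> Basis" for b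
  proof -
    have "continuous_on \<Omega> (\<lambda>x. (partial b \<phi> x *\<^sub>R Gc x + c x *\<^sub>R grad (partial b \<phi>) x) \<bullet> b)"
      by (intro continuous_intros cp b c(2) cc Cc2_continuous_on_grad_partial)
    then show ?thesis by (rule continuous_on_eq) (rule P[OF b, symmetric])
  qed
  define R where "R = (\<lambda>b x. P b x * v x + c x * (partial b \<phi> x * (Gv x \<bullet> b)))"
  have R0: "R b x = 0" if "x \<notin> T" for x b unfolding R_def using P0[OF that] p0[OF that] by simp
  have cR: "continuous_on \<Omega> (R b)" if b: "b \<in> Basis" for b
    unfolding R_def by (intro continuous_intros cP cp b cv v(2) cc)
  have iR: "(\<integral>x. R b x \<partial>lborel) = 0" if b: "b \<in> Basis" for b
  proof (rule integral_directional_derivative_on_eq_0[OF op Cc2_support(1,2) _ R0 _ cR[OF b]])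
    show "\<And>x. x \<notin> T \<Longrightarrow> c x * partial b \<phi> x * v x = 0" using p0 by simp
    show "continuous_on \<Omega> (\<lambda>x. c x * partial b \<phi> x * v x)" by (intro continuous_intros cc cp b cv)
    fix x assume x: "x \<in> \<Omega>"
    have "((\<lambda>x. c x * partial b \<phi> x * v x) has_derivative
      (\<lambda>h. c x * partial b \<phi> x * (Gv x \<bullet> h) + ((partial b \<phi> x *\<^sub>R Gc x + c x *\<^sub>R grad (partial b \<phi>) x) \<bullet> h) * v x)) (at x)"
      by (rule has_derivative_mult[OF div_op_product_rule[OF c(1)[OF x] x b] v(1)[OF x]])
    from has_derivative_imp_directional[OF this, of b]
    show "((\<lambda>t. c (x + t *\<^sub>R b) * partial b \<phi> (x + t *\<^sub>R b) * v (x + t *\<^sub>R b)) has_real_derivative R b x) (at 0)"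
      by (rule DERIV_cong) (simp add: R_def P[OF b x] algebra_simps)
  qed
  have int: "integrable lborel f" if "continuous_on \<Omega> f" "\<And>x. x \<notin> T \<Longrightarrow> f x = 0" for f :: "'a \<Rightarrow> real"
    by (rule integrable_extend_by_zero[OF op Cc2_support(1,2) that])
  have sumR: "(\<Sum>b\<in>Basis. R b x) = c x * (grad \<phi> x \<bullet> Gv x) - div_op c \<phi> x * v x" for x
  proof -
    have "grad \<phi> x \<bullet> Gv x = (\<Sum>b\<in>Basis. partial b \<phi> x * (Gv x \<bullet> b))"
      unfolding grad_def inner_sum_left by (intro sum.cong) (auto simp: inner_commute)
    then show ?thesis unfolding R_def div_op_def P_def
      by (simp add: sum.distrib sum_distrib_left sum_distrib_right)
  qed
  have i1: "integrable lborel (\<lambda>x. c x * (grad \<phi> x \<bullet> Gv x))"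
  proof (rule int)
    show "continuous_on \<Omega> (\<lambda>x. c x * (grad \<phi> x \<bullet> Gv x))"
      by (intro continuous_intros cc v(2) Cc2_continuous_on_grad)
  qed (simp add: Cc2_grad_zero)
  have i2: "integrable lborel (\<lambda>x. div_op c \<phi> x * v x)"
  proof (rule int)
    show "continuous_on \<Omega> (\<lambda>x. div_op c \<phi> x * v x)"
      by (intro continuous_intros cv continuous_on_div_op[OF c])
  qed (simp add: div_op_zero_outside_support[OF clT Cc2_support(3)])
  have "0 = (\<Sum>b\<in>Basis. \<integral>x. R b x \<partial>lborel)" using iR by simp
  also have "\<dots> = (\<integral>x. (\<Sum>b\<in>Basis. R b x) \<partial>lborel)"
    by (rule Bochner_Integration.integral_sum[symmetric]) (use int cR R0 in blast)
  also have "\<dots> = (\<integral>x. c x * (grad \<phi> x \<bullet> Gv x) \<partial>lborel) - (\<integral>x. div_op c \<phi> x * v x \<partial>lborel)"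
    unfolding sumR by (rule Bochner_Integration.integral_diff[OF i1 i2])
  finally show ?thesis by simp
qed

end

lemma set_integral_lebesgue_eq_lborel:
  fixes f :: "'a::euclidean_space \<Rightarrow> real"
  assumes "f \<in> borel_measurable borel" "\<And>x. x \<notin> \<Omega> \<Longrightarrow> f x = 0"
  shows "(LINT x:\<Omega>|lebesgue. f x) = (\<integral>x. f x \<partial>lborel)"
proof -
  have "(LINT x:\<Omega>|lebesgue. f x) = (\<integral>x. f x \<partial>lebesgue)"
    unfolding set_lebesgue_integral_def
    by (intro Bochner_Integration.integral_cong refl) (use assms(2) in \<open>auto simp: indicator_def\<close>)
  also have "\<dots> = (\<integral>x. f x \<partial>lborel)"
    using assms(1) by (intro integral_completion) simp
  finally show ?thesis .
qed

section \<open>The Rellich inequality for a power of the distance\<close>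

text \<open>With the constant \<open>C\<close> built in, integrating this pointwise bound loses nothing compared with
  Hoelder's inequality, since it is an equality for \<open>a = C b\<close>.\<close>

lemma Young_homogeneous:
  fixes a b C p :: real
  assumes "p > 1" "a \<ge> 0" "b \<ge> 0" "C > 0"
  shows "p * C powr (p - 1) * (a * b powr (p - 1)) \<le> a powr p + (p - 1) * (C powr p * b powr p)"
proof -
  define q where "q = p / (p - 1)"
  have q: "q > 1" "1 / p + 1 / q = 1" using assms(1) unfolding q_def by (auto simp: field_simps)
  have "a * (C * b) powr (p - 1) \<le> a powr p / p + ((C * b) powr (p - 1)) powr q / q"
    by (rule Youngs_inequality) (use assms q in auto)
  also have "((C * b) powr (p - 1)) powr q = (C * b) powr p"
    using assms(1) unfolding powr_powr q_def by simp
  finally have "p * (a * (C * b) powr (p - 1)) \<le> p * (a powr p / p + (C * b) powr p / q)"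
    using assms(1) by (intro mult_left_mono) auto
  also have "\<dots> = a powr p + (p - 1) * (C * b) powr p"
    using assms(1) unfolding q_def by (simp add: field_simps)
  finally show ?thesis using assms by (simp add: powr_mult mult_ac)
qed

context
  fixes K :: "'a::euclidean_space set" and k :: nat and \<delta> p n \<beta> C :: real and \<phi> :: "'a \<Rightarrow> real" and T :: "'a set"
  assumes K: "closed K" "convex K" "K \<noteq> {}" and dim: "aff_dim K = int k"
    and par: "p > 1" "\<delta> < 2" "n = real DIM('a) - real k" "\<beta> = n + p * \<delta> - 2 * p" "\<beta> > 0"
    and C: "C = (p - 1) * n * \<beta> / p\<^sup>2"
    and \<phi>: "\<phi> \<in> Cc2 (- K)" and T: "T = closure {x. \<phi> x \<noteq> 0}"
begin

private abbreviation "d x \<equiv> infdist x K"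
private abbreviation "cpow x \<equiv> infdist x K powr \<delta>"

private lemma op: "open (- K)" using K(1) by (rule open_Compl)

private lemmas supp = Cc2_support[OF \<phi> T]

private lemma clT: "closed T" by (rule compact_imp_closed[OF supp(1)])

private lemma dpos: "x \<in> - K \<Longrightarrow> d x > 0" using infdist_pos[OF K] by simp

private lemma cont_d_powr: "continuous_on (- K) (\<lambda>x. d x powr s)"
  by (intro continuous_intros) (use dpos in force)

private lemma cont_offset: "continuous_on (- K) (offset K)"
  by (rule continuous_on_offset[OF K])

private lemma d_powr_deriv:
  "x \<in> - K \<Longrightarrow> ((\<lambda>x. d x powr s) has_derivative (\<lambda>h. (s * d x powr (s - 2)) *\<^sub>R offset K x \<bullet> h)) (at x)"
  using has_derivative_infdist_powr[OF K, of x s] by simp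

private lemma cont_grad_d_powr: "continuous_on (- K) (\<lambda>x. (s * d x powr (s - 2)) *\<^sub>R offset K x)"
  by (intro continuous_intros cont_d_powr cont_offset)

private lemma integrable_supp: "continuous_on (- K) f \<Longrightarrow> (\<And>x. x \<notin> T \<Longrightarrow> f x = 0) \<Longrightarrow> integrable lborel f"
  for f :: "'a \<Rightarrow> real"
  by (rule integrable_extend_by_zero[OF op supp(1,2)])

private lemma integrable_indicator_T: "continuous_on (- K) f \<Longrightarrow> integrable lborel (\<lambda>x. indicator T x * f x)"
  for f :: "'a \<Rightarrow> real"
  using borel_integrable_compact[OF supp(1) continuous_on_subset[OF _ supp(2)], of f] by simp

private lemma n_pos: "n > 0"
proof -
  have "p * \<delta> < p * 2" using par(1,2) by (intro mult_strict_left_mono) auto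
  then show ?thesis using par by linarith
qed

private lemma C_pos: "C > 0" using C par n_pos by simp

private lemma cont_H: "continuous_on (- K) (div_op cpow \<phi>)"
  by (rule continuous_on_div_op[OF \<phi> T d_powr_deriv cont_grad_d_powr])

private lemma H_zero: "x \<notin> T \<Longrightarrow> div_op cpow \<phi> x = 0"
  by (rule div_op_zero_outside_support[OF clT supp(3)])

text \<open>For \<open>p < 2\<close> the function \<open>\<phi> \<bar>\<phi>\<bar>\<^sup>p\<^sup>-\<^sup>2\<close> is not differentiable at zeros of \<open>\<phi>\<close>; here \<open>\<bar>\<phi>\<bar>\<close> is replaced by
  \<open>f = sqrt (\<phi>\<^sup>2 + \<epsilon>\<^sup>2)\<close>, at the cost of an error of order \<open>\<epsilon>\<^sup>p\<close>: the primitive that vanishes with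
  \<open>\<phi>\<close> is \<open>(f\<^sup>p - \<epsilon>\<^sup>p) / p\<close> instead of \<open>f\<^sup>p / p\<close>.
  The test function is \<open>v = f\<^sup>p\<^sup>-\<^sup>2 \<phi> d\<^sup>-\<^sup>\<sigma>\<close>.  The weak inequality \<open>\<Delta>(d\<^sup>2/2) \<ge> n\<close> is applied to
  \<open>Q = d\<^sup>\<gamma> (f\<^sup>p - \<epsilon>\<^sup>p) / p\<close>; it controls both the cross term produced by differentiating \<open>d\<^sup>-\<^sup>\<sigma>\<close> and
  the one left by completing the square in the energy.\<close>

private lemma rellich_regularised:
  assumes \<epsilon>: "\<epsilon> > 0"
  defines "f \<equiv> \<lambda>x. sqrt ((\<phi> x)\<^sup>2 + \<epsilon>\<^sup>2)"
    and "\<gamma> \<equiv> - (2 - \<delta>) * p"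
  shows "C powr p * (\<integral>x. indicator T x * (d x powr \<gamma> * f x powr p) \<partial>lborel)
     \<le> (\<integral>x. \<bar>div_op cpow \<phi> x\<bar> powr p \<partial>lborel)
       + p * C powr (p - 1) * ((2 - \<delta>) * (p - 1) + 2 * (\<beta> * (p - 1) / p)) * \<beta> / p
          * (\<integral>x. indicator T x * d x powr \<gamma> \<partial>lborel) * \<epsilon> powr p"
proof -
  define \<sigma> where "\<sigma> = (2 - \<delta>) * (p - 1)"
  define \<tau> where "\<tau> = \<beta> * (p - 1) / p"
  define G where "G = grad \<phi>"
  define \<xi> where "\<xi> = offset K"
  have \<sigma>: "\<sigma> \<ge> 0" and \<tau>: "\<tau> > 0" using par unfolding \<sigma>_def \<tau>_def by auto
  have fpos: "f x > 0" for x unfolding f_def using \<epsilon> by (intro real_sqrt_gt_zero add_nonneg_pos) auto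
  have fsq: "(f x)\<^sup>2 = (\<phi> x)\<^sup>2 + \<epsilon>\<^sup>2" for x unfolding f_def by simp
  have contphi: "continuous_on (- K) \<phi>" by (rule Cc2_continuous_on[OF \<phi> T])
  have contG: "continuous_on (- K) G" unfolding G_def by (rule Cc2_continuous_on_grad[OF \<phi> T])
  have contf: "continuous_on (- K) f" unfolding f_def by (intro continuous_intros contphi)
  have contfp: "continuous_on (- K) (\<lambda>x. f x powr s)" for s
    by (intro continuous_intros contf ballI less_imp_neq[OF fpos, symmetric])
  have G0: "G x = 0" if "x \<notin> T" for x unfolding G_def by (rule Cc2_grad_zero[OF \<phi> T that])
  have f_powr_deriv: "((\<lambda>x. f x powr s) has_derivative (\<lambda>h. (s * f x powr (s - 2) * \<phi> x) *\<^sub>R G x \<bullet> h)) (at x)"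
    if x: "x \<in> - K" for x s
  proof -
    have eq: "f y powr t = ((\<phi> y)\<^sup>2 + \<epsilon>\<^sup>2) powr (t / 2)" for y t
      using fpos[of y] unfolding fsq[symmetric] by (simp add: powr_powr flip: powr_numeral)
    have pos: "(\<phi> x)\<^sup>2 + \<epsilon>\<^sup>2 > 0" using \<epsilon> by (intro add_nonneg_pos) auto
    have "((\<lambda>x. (\<phi> x)\<^sup>2 + \<epsilon>\<^sup>2) has_derivative (\<lambda>h. 2 * \<phi> x * (G x \<bullet> h))) (at x)"
      unfolding G_def using Cc2_has_derivative[OF \<phi> T x] by (auto intro!: derivative_eq_intros)
    moreover have "((\<lambda>z. z powr (s / 2)) has_real_derivative s / 2 * ((\<phi> x)\<^sup>2 + \<epsilon>\<^sup>2) powr (s / 2 - 1)) (at ((\<phi> x)\<^sup>2 + \<epsilon>\<^sup>2))"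
      using has_real_derivative_powr[OF pos, of "s / 2"] by simp
    ultimately have "((\<lambda>x. ((\<phi> x)\<^sup>2 + \<epsilon>\<^sup>2) powr (s / 2)) has_derivative
        (\<lambda>h. s / 2 * ((\<phi> x)\<^sup>2 + \<epsilon>\<^sup>2) powr (s / 2 - 1) * (2 * \<phi> x * (G x \<bullet> h)))) (at x)"
      unfolding has_field_derivative_def by (rule has_derivative_compose)
    then show ?thesis unfolding eq
      by (rule has_derivative_eq_rhs) (simp add: diff_divide_distrib mult_ac)
  qed
  define S where "S = (\<lambda>x. f x powr (p - 2) * \<phi> x)"
  define S' where "S' = (\<lambda>x. f x powr (p - 2) + (p - 2) * f x powr (p - 4) * (\<phi> x)\<^sup>2)"
  have S_deriv: "(S has_derivative (\<lambda>h. S' x *\<^sub>R G x \<bullet> h)) (at x)" if x: "x \<in> - K" for x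
    using has_derivative_mult[OF f_powr_deriv[OF x, of "p - 2"] Cc2_has_derivative[OF \<phi> T x]]
    unfolding S_def S'_def G_def[symmetric]
    by (rule has_derivative_eq_rhs) (auto simp: algebra_simps power2_eq_square)
  have contS: "continuous_on (- K) S" unfolding S_def by (intro continuous_intros contfp contphi)
  have contS': "continuous_on (- K) S'" unfolding S'_def by (intro continuous_intros contfp contphi)
  define v where "v = (\<lambda>x. S x * d x powr (- \<sigma>))"
  define Gv where "Gv = (\<lambda>x. (d x powr (- \<sigma>) * S' x) *\<^sub>R G x - (\<sigma> * d x powr (- \<sigma> - 2) * S x) *\<^sub>R \<xi> x)"
  have v_deriv: "(v has_derivative (\<lambda>h. Gv x \<bullet> h)) (at x)" if x: "x \<in> - K" for x
    using has_derivative_mult[OF S_deriv[OF x] d_powr_deriv[OF x, of "- \<sigma>"]]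
    unfolding v_def Gv_def \<xi>_def
    by (rule has_derivative_eq_rhs) (auto simp: algebra_simps inner_diff_left)
  have contGv: "continuous_on (- K) Gv" unfolding Gv_def \<xi>_def
    by (intro continuous_intros cont_d_powr contS contS' contG cont_offset)
  have contv: "continuous_on (- K) v" unfolding v_def by (intro continuous_intros contS cont_d_powr)
  have ibp: "(\<integral>x. div_op cpow \<phi> x * v x \<partial>lborel) = (\<integral>x. cpow x * (G x \<bullet> Gv x) \<partial>lborel)"
    unfolding G_def
    by (rule integral_div_op_mult[OF \<phi> T op d_powr_deriv cont_grad_d_powr v_deriv contGv])

  define X where "X = (\<lambda>x. d x powr \<gamma> * S x * (\<xi> x \<bullet> G x))"
  define P where "P = (\<integral>x. indicator T x * (d x powr \<gamma> * f x powr p) \<partial>lborel)"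
  define M where "M = (\<integral>x. indicator T x * d x powr \<gamma> \<partial>lborel)"
  define Q where "Q = (\<lambda>x. d x powr \<gamma> * ((f x powr p - \<epsilon> powr p) / p))"
  have exps: "d x powr \<delta> * d x powr (- \<sigma>) = d x powr (\<gamma> + 2)"
    "d x powr \<delta> * d x powr (- \<sigma> - 2) = d x powr \<gamma>" for x
    unfolding powr_add[symmetric] \<sigma>_def \<gamma>_def by (simp_all add: algebra_simps)
  have dd: "d x powr (\<gamma> + 2) = d x powr \<gamma> * (d x)\<^sup>2" if "x \<in> - K" for x
    using dpos[OF that] by (simp add: powr_add)
  \<comment> \<open>Completing the square with a free parameter \<open>\<tau>\<close> yields in the end the constant
      \<open>\<sigma> \<beta> / p + 2 \<tau> \<beta> / p - \<tau>\<^sup>2 / (p - 1)\<close>, which the chosen \<open>\<tau>\<close> maximises.\<close>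
  have point: "cpow x * (G x \<bullet> Gv x) \<ge> - (\<sigma> + 2 * \<tau>) * X x - \<tau>\<^sup>2 / (p - 1) * (indicator T x * (d x powr \<gamma> * f x powr p))" for x
  proof (cases "x \<in> T")
    case False
    then show ?thesis using G0[OF False] unfolding X_def by simp
  next
    case True
    then have x: "x \<in> - K" using supp(2) by blast
    have d: "d x > 0" using dpos[OF x] .
    have fx: "f x > 0" by (rule fpos)
    define g2 where "g2 = G x \<bullet> G x"
    define xg where "xg = \<xi> x \<bullet> G x"
    have xx: "\<xi> x \<bullet> \<xi> x = (d x)\<^sup>2"
      unfolding \<xi>_def using norm_offset[OF K, of x] by (simp add: power2_norm_eq_inner[symmetric])
    define w where "w = f x powr (p - 4)"
    have w: "w > 0" unfolding w_def using fx by simp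
    have w2: "f x powr (p - 2) = w * (f x)\<^sup>2"
      unfolding w_def using fx by (simp add: powr_diff field_simps flip: powr_numeral powr_add)
    have w4: "f x powr p = w * (f x)\<^sup>2 * (f x)\<^sup>2"
      unfolding w_def using fx by (simp add: powr_diff field_simps flip: powr_numeral powr_add)
    have S'ge: "S' x \<ge> (p - 1) * w * (\<phi> x)\<^sup>2"
    proof -
      have "w * (\<phi> x)\<^sup>2 \<le> w * (f x)\<^sup>2" using w unfolding fsq by (intro mult_left_mono) auto
      then show ?thesis unfolding S'_def w2 w_def[symmetric] by (simp add: algebra_simps)
    qed
    have "0 \<le> (((p - 1) * \<phi> x * (d x)\<^sup>2) *\<^sub>R G x + (\<tau> * (f x)\<^sup>2) *\<^sub>R \<xi> x)
            \<bullet> (((p - 1) * \<phi> x * (d x)\<^sup>2) *\<^sub>R G x + (\<tau> * (f x)\<^sup>2) *\<^sub>R \<xi> x)"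
      by (rule inner_ge_zero)
    also have "\<dots> = (p - 1)\<^sup>2 * (\<phi> x)\<^sup>2 * (d x)\<^sup>2 * (d x)\<^sup>2 * g2
        + 2 * \<tau> * (p - 1) * (f x)\<^sup>2 * \<phi> x * (d x)\<^sup>2 * xg + \<tau>\<^sup>2 * (f x)\<^sup>2 * (f x)\<^sup>2 * (d x)\<^sup>2"
      unfolding g2_def xg_def inner_add_left inner_add_right inner_scaleR_left inner_scaleR_right xx
      by (simp add: inner_commute[of "G x" "\<xi> x"] power2_eq_square algebra_simps)
    finally have "0 \<le> ((p - 1) * (d x)\<^sup>2) * ((p - 1) * (\<phi> x)\<^sup>2 * (d x)\<^sup>2 * g2
        + 2 * \<tau> * (f x)\<^sup>2 * \<phi> x * xg + \<tau>\<^sup>2 / (p - 1) * (f x)\<^sup>2 * (f x)\<^sup>2)"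
    proof -
      assume *: "0 \<le> (p - 1)\<^sup>2 * (\<phi> x)\<^sup>2 * (d x)\<^sup>2 * (d x)\<^sup>2 * g2
        + 2 * \<tau> * (p - 1) * (f x)\<^sup>2 * \<phi> x * (d x)\<^sup>2 * xg + \<tau>\<^sup>2 * (f x)\<^sup>2 * (f x)\<^sup>2 * (d x)\<^sup>2"
      have "\<tau>\<^sup>2 = (p - 1) * (\<tau>\<^sup>2 / (p - 1))" using par(1) by simp
      then obtain r where r: "\<tau>\<^sup>2 = (p - 1) * r" "\<tau>\<^sup>2 / (p - 1) = r" by blast
      show ?thesis using * unfolding r(2) unfolding r(1) by (simp add: algebra_simps power2_eq_square)
    qed
    then have "0 \<le> (p - 1) * (\<phi> x)\<^sup>2 * (d x)\<^sup>2 * g2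
        + 2 * \<tau> * (f x)\<^sup>2 * \<phi> x * xg + \<tau>\<^sup>2 / (p - 1) * (f x)\<^sup>2 * (f x)\<^sup>2"
    proof (rule mult_left_le_imp_le[of "(p - 1) * (d x)\<^sup>2" 0, unfolded mult_zero_right])
      show "0 < (p - 1) * (d x)\<^sup>2" using par(1) d by simp
    qed
    then have "0 \<le> (w * d x powr \<gamma>) * ((p - 1) * (\<phi> x)\<^sup>2 * (d x)\<^sup>2 * g2
        + 2 * \<tau> * (f x)\<^sup>2 * \<phi> x * xg + \<tau>\<^sup>2 / (p - 1) * (f x)\<^sup>2 * (f x)\<^sup>2)"
      using w by (intro mult_nonneg_nonneg) auto
    then have sq: "d x powr \<gamma> * (d x)\<^sup>2 * g2 * ((p - 1) * w * (\<phi> x)\<^sup>2) \<ge> - 2 * \<tau> * X x - \<tau>\<^sup>2 / (p - 1) * (d x powr \<gamma> * f x powr p)"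
      unfolding X_def S_def w2 w4 xg_def[symmetric] by (simp add: algebra_simps)
    have "d x powr \<gamma> * (d x)\<^sup>2 * g2 * ((p - 1) * w * (\<phi> x)\<^sup>2) \<le> d x powr \<gamma> * (d x)\<^sup>2 * g2 * S' x"
      using S'ge unfolding g2_def by (intro mult_left_mono) auto
    moreover have "cpow x * (G x \<bullet> Gv x) = d x powr \<gamma> * (d x)\<^sup>2 * g2 * S' x - \<sigma> * X x"
    proof -
      have "cpow x * (G x \<bullet> Gv x) = (d x powr \<delta> * d x powr (- \<sigma>)) * g2 * S' x
          - \<sigma> * ((d x powr \<delta> * d x powr (- \<sigma> - 2)) * S x * xg)"
        unfolding Gv_def g2_def xg_def
        by (simp add: inner_diff_right inner_commute[of "G x" "\<xi> x"] algebra_simps)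
      then show ?thesis unfolding exps dd[OF x] X_def xg_def .
    qed
    ultimately show ?thesis using sq True by (simp add: algebra_simps)
  qed
  have contX: "continuous_on (- K) X"
    unfolding X_def \<xi>_def by (intro continuous_intros cont_d_powr contS contG cont_offset)
  have iX: "integrable lborel X"
    by (rule integrable_supp[OF contX]) (simp add: X_def G0)
  have iP: "integrable lborel (\<lambda>x. indicator T x * (d x powr \<gamma> * f x powr p))"
    by (rule integrable_indicator_T) (intro continuous_intros cont_d_powr contfp)
  have iM: "integrable lborel (\<lambda>x. indicator T x * d x powr \<gamma>)"
    by (rule integrable_indicator_T) (intro continuous_intros cont_d_powr)
  have "- (\<sigma> + 2 * \<tau>) * (\<integral>x. X x \<partial>lborel) - \<tau>\<^sup>2 / (p - 1) * P
      = (\<integral>x. - (\<sigma> + 2 * \<tau>) * X x - \<tau>\<^sup>2 / (p - 1) * (indicator T x * (d x powr \<gamma> * f x powr p)) \<partial>lborel)"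
    unfolding P_def using iX iP by simp
  also have "\<dots> \<le> (\<integral>x. cpow x * (G x \<bullet> Gv x) \<partial>lborel)"
  proof (rule integral_mono[OF _ _ point])
    show "integrable lborel (\<lambda>x. - (\<sigma> + 2 * \<tau>) * X x - \<tau>\<^sup>2 / (p - 1) * (indicator T x * (d x powr \<gamma> * f x powr p)))"
      using iX iP by simp
    show "integrable lborel (\<lambda>x. cpow x * (G x \<bullet> Gv x))"
      by (rule integrable_supp) (auto intro!: continuous_intros cont_d_powr contG contGv simp: G0)
  qed
  finally have energy: "(\<integral>x. div_op cpow \<phi> x * v x \<partial>lborel) \<ge> - (\<sigma> + 2 * \<tau>) * (\<integral>x. X x \<partial>lborel) - \<tau>\<^sup>2 / (p - 1) * P"
    unfolding ibp .

  define GQ where "GQ = (\<lambda>x. ((f x powr p - \<epsilon> powr p) / p * \<gamma> * d x powr (\<gamma> - 2)) *\<^sub>R \<xi> x + (d x powr \<gamma> * S x) *\<^sub>R G x)"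
  have Q0: "Q x = 0" and GQ0: "GQ x = 0" if "x \<notin> T" for x
  proof -
    have "f x = \<epsilon>" unfolding f_def using supp(3)[OF that] \<epsilon> by simp
    then show "Q x = 0" "GQ x = 0" unfolding Q_def GQ_def using G0[OF that] by auto
  qed
  have Q_nonneg: "Q x \<ge> 0" for x
  proof -
    have "\<epsilon> \<le> f x" using real_sqrt_le_mono[of "\<epsilon>\<^sup>2" "(\<phi> x)\<^sup>2 + \<epsilon>\<^sup>2"] \<epsilon> unfolding f_def by simp
    then have "\<epsilon> powr p \<le> f x powr p" using \<epsilon> par(1) by (intro powr_mono2) auto
    then show ?thesis unfolding Q_def using par(1) by simp
  qed
  have weak: "(\<integral>x. offset K x \<bullet> GQ x \<partial>lborel) \<le> - (real DIM('a) - real k) * (\<integral>x. Q x \<partial>lborel)"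
  proof (rule integral_offset_gradient_le[OF K supp(1,2) Q0 GQ0 _ _ Q_nonneg dim])
    show "continuous_on (- K) GQ"
      unfolding GQ_def \<xi>_def
      by (intro continuous_intros cont_d_powr contS contG cont_offset contfp) (use par(1) in auto)
    fix x assume "x \<notin> K"
    then have x: "x \<in> - K" by simp
    have "((\<lambda>x. (f x powr p - \<epsilon> powr p) / p) has_derivative
        (\<lambda>h. ((p * f x powr (p - 2) * \<phi> x) *\<^sub>R G x \<bullet> h - 0) * inverse p)) (at x)"
      unfolding divide_inverse
      by (rule has_derivative_mult_left[OF has_derivative_diff[OF f_powr_deriv[OF x] has_derivative_const]])
    then have "((\<lambda>x. (f x powr p - \<epsilon> powr p) / p) has_derivative (\<lambda>h. (S x *\<^sub>R G x) \<bullet> h)) (at x)"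
      by (rule has_derivative_eq_rhs) (use par(1) in \<open>auto simp: S_def\<close>)
    from has_derivative_mult[OF d_powr_deriv[OF x, of \<gamma>] this]
    show "(Q has_derivative (\<lambda>h. GQ x \<bullet> h)) (at x)"
      unfolding Q_def GQ_def \<xi>_def
      by (rule has_derivative_eq_rhs) (simp add: inner_add_left algebra_simps)
  qed
  have "offset K x \<bullet> GQ x = \<gamma> * Q x + X x" for x
  proof (cases "x \<in> T")
    case True
    then have x: "x \<in> - K" using supp(2) by blast
    have "\<xi> x \<bullet> \<xi> x = (d x)\<^sup>2"
      unfolding \<xi>_def using norm_offset[OF K, of x] by (simp add: power2_norm_eq_inner[symmetric])
    moreover have "d x powr \<gamma> = d x powr (\<gamma> - 2) * (d x)\<^sup>2"
      using dpos[OF x] by (simp add: powr_diff)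
    ultimately show ?thesis
      unfolding GQ_def Q_def X_def \<xi>_def[symmetric] by (simp add: inner_add_right algebra_simps)
  next
    case False
    then show ?thesis using Q0 GQ0 G0 unfolding X_def by simp
  qed
  moreover have contQ: "continuous_on (- K) Q"
    unfolding Q_def by (intro continuous_intros cont_d_powr contfp) (use par(1) in auto)
  then have iQ: "integrable lborel Q" using Q0 by (rule integrable_supp)
  ultimately have "\<gamma> * (\<integral>x. Q x \<partial>lborel) + (\<integral>x. X x \<partial>lborel) \<le> - (real DIM('a) - real k) * (\<integral>x. Q x \<partial>lborel)"
    using weak iX by simp
  then have "(\<integral>x. X x \<partial>lborel) \<le> - (n + \<gamma>) * (\<integral>x. Q x \<partial>lborel)"
    unfolding par(3) by (simp add: algebra_simps)
  moreover have "n + \<gamma> = \<beta>" unfolding par(4) \<gamma>_def by (simp add: algebra_simps)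
  ultimately have X_le: "(\<integral>x. X x \<partial>lborel) \<le> - \<beta> * (\<integral>x. Q x \<partial>lborel)"
    by simp
  have Q_eq: "(\<integral>x. Q x \<partial>lborel) = (P - \<epsilon> powr p * M) / p"
  proof -
    have "Q x = (indicator T x * (d x powr \<gamma> * f x powr p) - \<epsilon> powr p * (indicator T x * d x powr \<gamma>)) / p" for x
      using Q0[of x] unfolding Q_def by (cases "x \<in> T") (auto simp: algebra_simps)
    then show ?thesis unfolding P_def M_def using iP iM by simp
  qed
  have "(\<sigma> + 2 * \<tau>) * (\<integral>x. X x \<partial>lborel) \<le> (\<sigma> + 2 * \<tau>) * (- \<beta> * ((P - \<epsilon> powr p * M) / p))"
    using X_le \<sigma> \<tau> unfolding Q_eq by (intro mult_left_mono) auto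
  then have "(\<integral>x. div_op cpow \<phi> x * v x \<partial>lborel)
      \<ge> (\<sigma> + 2 * \<tau>) * (\<beta> * ((P - \<epsilon> powr p * M) / p)) - \<tau>\<^sup>2 / (p - 1) * P"
    using energy unfolding mult_minus_left mult_minus_right by linarith
  moreover have "(\<sigma> + 2 * \<tau>) * (\<beta> * ((P - \<epsilon> powr p * M) / p)) - \<tau>\<^sup>2 / (p - 1) * P
      = C * P - (\<sigma> + 2 * \<tau>) * \<beta> / p * M * \<epsilon> powr p"
  proof -
    have "(\<sigma> + 2 * \<tau>) * \<beta> / p - \<tau>\<^sup>2 / (p - 1) = (p - 1) * \<beta> * ((2 - \<delta>) * p + \<beta>) / p\<^sup>2"
      unfolding \<sigma>_def \<tau>_def using par(1) by (simp add: field_simps power2_eq_square)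
    also have "(2 - \<delta>) * p + \<beta> = n" unfolding par(4) by (simp add: algebra_simps)
    finally have C': "(\<sigma> + 2 * \<tau>) * \<beta> / p - \<tau>\<^sup>2 / (p - 1) = C" unfolding C by (simp add: mult_ac)
    show ?thesis unfolding C'[symmetric] by (simp add: algebra_simps diff_divide_distrib add_divide_distrib)
  qed
  ultimately have lower: "(\<integral>x. div_op cpow \<phi> x * v x \<partial>lborel) \<ge> C * P - (\<sigma> + 2 * \<tau>) * \<beta> / p * M * \<epsilon> powr p"
    by simp

  have young: "p * C powr (p - 1) * (div_op cpow \<phi> x * v x)
      \<le> \<bar>div_op cpow \<phi> x\<bar> powr p + (p - 1) * C powr p * (indicator T x * (d x powr \<gamma> * f x powr p))" for x
  proof (cases "x \<in> T")
    case False
    then show ?thesis using H_zero[OF False] par(1) by simp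
  next
    case True
    then have x: "x \<in> - K" using supp(2) by blast
    define b where "b = f x * d x powr (- (2 - \<delta>))"
    have b: "b \<ge> 0" unfolding b_def using fpos[of x] by simp
    have bp: "b powr p = d x powr \<gamma> * f x powr p"
      unfolding b_def \<gamma>_def using fpos[of x] by (simp add: powr_mult powr_powr)
    have bp1: "b powr (p - 1) = d x powr (- \<sigma>) * f x powr (p - 1)"
      unfolding b_def \<sigma>_def using fpos[of x] by (simp add: powr_mult powr_powr algebra_simps)
    have "\<bar>\<phi> x\<bar> \<le> f x" unfolding f_def by (rule real_le_rsqrt) simp
    then have "\<bar>S x\<bar> \<le> f x powr (p - 2) * f x" unfolding S_def by (simp add: abs_mult mult_left_mono)
    also have "\<dots> = f x powr (p - 1)" using fpos[of x] powr_add[of "f x" "p - 2" 1] by simp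
    finally have vb: "\<bar>v x\<bar> \<le> b powr (p - 1)"
      unfolding v_def bp1 mult.commute[of "d x powr (- \<sigma>)"] by (simp add: abs_mult mult_right_mono)
    have "div_op cpow \<phi> x * v x \<le> \<bar>div_op cpow \<phi> x\<bar> * \<bar>v x\<bar>"
      by (metis abs_ge_self abs_mult)
    also have "\<dots> \<le> \<bar>div_op cpow \<phi> x\<bar> * b powr (p - 1)" using vb by (intro mult_left_mono) auto
    finally have "p * C powr (p - 1) * (div_op cpow \<phi> x * v x)
        \<le> p * C powr (p - 1) * (\<bar>div_op cpow \<phi> x\<bar> * b powr (p - 1))"
      using par(1) by (intro mult_left_mono) auto
    also have "\<dots> \<le> \<bar>div_op cpow \<phi> x\<bar> powr p + (p - 1) * (C powr p * b powr p)"
      using b C_pos par(1) by (intro Young_homogeneous) auto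
    finally show ?thesis using True bp by (simp add: mult_ac)
  qed
  have iH: "integrable lborel (\<lambda>x. \<bar>div_op cpow \<phi> x\<bar> powr p)"
  proof (rule integrable_supp)
    show "continuous_on (- K) (\<lambda>x. \<bar>div_op cpow \<phi> x\<bar> powr p)"
      by (rule continuous_on_powr') (use par(1) in \<open>auto intro!: continuous_intros cont_H\<close>)
  qed (simp add: H_zero)
  have "p * C powr (p - 1) * (\<integral>x. div_op cpow \<phi> x * v x \<partial>lborel) = (\<integral>x. p * C powr (p - 1) * (div_op cpow \<phi> x * v x) \<partial>lborel)"
    by simp
  also have "\<dots> \<le> (\<integral>x. \<bar>div_op cpow \<phi> x\<bar> powr p + (p - 1) * C powr p * (indicator T x * (d x powr \<gamma> * f x powr p)) \<partial>lborel)"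
  proof (rule integral_mono[OF _ _ young])
    have "integrable lborel (\<lambda>x. div_op cpow \<phi> x * v x)"
    proof (rule integrable_supp)
      show "continuous_on (- K) (\<lambda>x. div_op cpow \<phi> x * v x)" by (intro continuous_intros cont_H contv)
    qed (simp add: H_zero)
    then show "integrable lborel (\<lambda>x. p * C powr (p - 1) * (div_op cpow \<phi> x * v x))" by simp
  qed (use iH iP in simp)
  also have "\<dots> = (\<integral>x. \<bar>div_op cpow \<phi> x\<bar> powr p \<partial>lborel) + (p - 1) * C powr p * P"
    unfolding P_def using iH iP by simp
  finally have upper: "p * C powr (p - 1) * (\<integral>x. div_op cpow \<phi> x * v x \<partial>lborel)
      \<le> (\<integral>x. \<bar>div_op cpow \<phi> x\<bar> powr p \<partial>lborel) + (p - 1) * C powr p * P" .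
  have "p * C powr (p - 1) * (C * P - (\<sigma> + 2 * \<tau>) * \<beta> / p * M * \<epsilon> powr p)
      \<le> p * C powr (p - 1) * (\<integral>x. div_op cpow \<phi> x * v x \<partial>lborel)"
    using lower par(1) by (intro mult_left_mono) auto
  with upper have "p * C powr (p - 1) * (C * P - (\<sigma> + 2 * \<tau>) * \<beta> / p * M * \<epsilon> powr p)
      \<le> (\<integral>x. \<bar>div_op cpow \<phi> x\<bar> powr p \<partial>lborel) + (p - 1) * C powr p * P"
    by linarith
  moreover have "C powr p = C powr (p - 1) * C" using C_pos powr_add[of C "p - 1" 1] by simp
  ultimately show ?thesis unfolding P_def[symmetric] M_def[symmetric] \<sigma>_def[symmetric] \<tau>_def[symmetric]
    by (simp add: algebra_simps)
qed

lemma rellich_lower_bound_lborel: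
  "C powr p * (\<integral>x. d x powr (- (2 - \<delta>) * p) * \<bar>\<phi> x\<bar> powr p \<partial>lborel) \<le> (\<integral>x. \<bar>div_op cpow \<phi> x\<bar> powr p \<partial>lborel)"
proof -
  define \<gamma> where "\<gamma> = - (2 - \<delta>) * p"
  define E where "E = p * C powr (p - 1) * ((2 - \<delta>) * (p - 1) + 2 * (\<beta> * (p - 1) / p)) * \<beta> / p
          * (\<integral>x. indicator T x * d x powr \<gamma> \<partial>lborel)"
  define N where "N = (\<integral>x. \<bar>div_op cpow \<phi> x\<bar> powr p \<partial>lborel)"
  define D where "D = (\<integral>x. d x powr \<gamma> * \<bar>\<phi> x\<bar> powr p \<partial>lborel)"
  have contphi: "continuous_on (- K) \<phi>" by (rule Cc2_continuous_on[OF \<phi> T])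
  have main: "C powr p * D \<le> N + E * \<epsilon> powr p" if \<epsilon>: "\<epsilon> > 0" for \<epsilon>
  proof -
    have "D \<le> (\<integral>x. indicator T x * (d x powr \<gamma> * sqrt ((\<phi> x)\<^sup>2 + \<epsilon>\<^sup>2) powr p) \<partial>lborel)"
      unfolding D_def
    proof (rule integral_mono)
      show "integrable lborel (\<lambda>x. d x powr \<gamma> * \<bar>\<phi> x\<bar> powr p)"
      proof (rule integrable_supp)
        have "continuous_on (- K) (\<lambda>x. \<bar>\<phi> x\<bar> powr p)"
          by (rule continuous_on_powr') (use par(1) in \<open>auto intro!: continuous_intros contphi\<close>)
        then show "continuous_on (- K) (\<lambda>x. d x powr \<gamma> * \<bar>\<phi> x\<bar> powr p)"
          by (intro continuous_on_mult cont_d_powr)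
      qed (simp add: supp(3))
      show "integrable lborel (\<lambda>x. indicator T x * (d x powr \<gamma> * sqrt ((\<phi> x)\<^sup>2 + \<epsilon>\<^sup>2) powr p))"
      proof (rule integrable_indicator_T)
        have "continuous_on (- K) (\<lambda>x. sqrt ((\<phi> x)\<^sup>2 + \<epsilon>\<^sup>2) powr p)"
          by (rule continuous_on_powr') (use par(1) in \<open>auto intro!: continuous_intros contphi\<close>)
        then show "continuous_on (- K) (\<lambda>x. d x powr \<gamma> * sqrt ((\<phi> x)\<^sup>2 + \<epsilon>\<^sup>2) powr p)"
          by (intro continuous_on_mult cont_d_powr)
      qed
      fix x
      have "\<bar>\<phi> x\<bar> powr p \<le> sqrt ((\<phi> x)\<^sup>2 + \<epsilon>\<^sup>2) powr p"
        using par(1) by (intro powr_mono2) (auto intro!: real_le_rsqrt)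
      then show "d x powr \<gamma> * \<bar>\<phi> x\<bar> powr p \<le> indicator T x * (d x powr \<gamma> * sqrt ((\<phi> x)\<^sup>2 + \<epsilon>\<^sup>2) powr p)"
        using supp(3)[of x] by (cases "x \<in> T") (auto intro!: mult_left_mono)
    qed
    then have "C powr p * D \<le> C powr p * (\<integral>x. indicator T x * (d x powr \<gamma> * sqrt ((\<phi> x)\<^sup>2 + \<epsilon>\<^sup>2) powr p) \<partial>lborel)"
      by (intro mult_left_mono) auto
    also have "\<dots> \<le> N + E * \<epsilon> powr p"
      using rellich_regularised[OF \<epsilon>] unfolding \<gamma>_def E_def N_def .
    finally show ?thesis .
  qed
  have "((\<lambda>\<epsilon>. N + E * \<epsilon> powr p) \<longlongrightarrow> N + E * 0) (at_right 0)"
  proof (intro tendsto_intros)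
    have "((\<lambda>\<epsilon>. \<epsilon> powr p) \<longlongrightarrow> 0 powr p) (at_right 0)"
      using par(1) by (intro tendsto_powr') (auto intro!: tendsto_intros simp: eventually_at_right_less eventually_at_filter)
    then show "((\<lambda>\<epsilon>. \<epsilon> powr p) \<longlongrightarrow> 0) (at_right 0)" by simp
  qed
  moreover have "\<forall>\<^sub>F \<epsilon> in at_right 0. C powr p * D \<le> N + E * \<epsilon> powr p"
    using main by (auto simp: eventually_at_filter)
  ultimately have "C powr p * D \<le> N + E * 0"
    by (intro tendsto_lowerbound[of _ _ "at_right 0"]) auto
  then show ?thesis unfolding N_def D_def \<gamma>_def by simp
qed

end

section \<open>Cut-off profiles of one variable\<close>

text \<open>The cube of the tent is twice continuously differentiable, and its first two derivatives are
  bounded by the tent itself.  The errors due to the cut-off are therefore bounded by integrals of the same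
  kind as the main term, with \<open>tent\<close> in place of \<open>bump\<close>.\<close>

definition tent :: "real \<Rightarrow> real"
  where "tent t = max 0 (t * (1 - t))"

definition bump :: "real \<Rightarrow> real"
  where "bump t = tent t ^ 3"

definition bump' :: "real \<Rightarrow> real"
  where "bump' t = 3 * tent t ^ 2 * (1 - 2 * t)"

definition bump'' :: "real \<Rightarrow> real"
  where "bump'' t = 6 * tent t * (1 - 2 * t)^2 - 6 * tent t ^ 2"

lemma tent_nonneg: "tent t \<ge> 0"
  unfolding tent_def by simp

lemma tent_zero: "t \<notin> {0..1} \<Longrightarrow> tent t = 0"
  unfolding tent_def by (auto simp: max_def mult_le_0_iff zero_le_mult_iff)

lemma tent_le: "tent t \<le> 1 / 4"
proof -
  have "0 \<le> (t - 1 / 2)\<^sup>2" by simp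
  then have "t * (1 - t) \<le> 1 / 4" by (simp add: power2_eq_square algebra_simps)
  then show ?thesis unfolding tent_def by simp
qed

lemma continuous_on_tent [continuous_intros]:
  "continuous_on S f \<Longrightarrow> continuous_on S (\<lambda>x. tent (f x))"
  unfolding tent_def by (intro continuous_intros)

lemma DERIV_max_power2: "((\<lambda>x::real. max 0 x ^ 2) has_real_derivative 2 * max 0 x) (at x)"
proof (cases x "0::real" rule: linorder_cases)
  case greater
  have "((\<lambda>x::real. x ^ 2) has_real_derivative 2 * x) (at x)" by (auto intro!: derivative_eq_intros)
  then have "((\<lambda>x::real. max 0 x ^ 2) has_real_derivative 2 * x) (at x)"
    by (rule has_field_derivative_transform_within_open[of _ _ _ "{0<..}"]) (use greater in auto)
  then show ?thesis using greater by simp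
next
  case less
  have "((\<lambda>x::real. 0) has_real_derivative 0) (at x)" by simp
  then have "((\<lambda>x::real. max 0 x ^ 2) has_real_derivative 0) (at x)"
    by (rule has_field_derivative_transform_within_open[of _ _ _ "{..<0}"]) (use less in auto)
  then show ?thesis using less by simp
next
  case equal
  have "((\<lambda>h::real. max 0 h ^ 2 / h) \<longlongrightarrow> 0) (at 0)"
  proof (rule Lim_null_comparison)
    show "\<forall>\<^sub>F h::real in at 0. norm (max 0 h ^ 2 / h) \<le> \<bar>h\<bar>"
      by (auto simp: eventually_at_filter max_def power2_eq_square)
    show "((\<lambda>h::real. \<bar>h\<bar>) \<longlongrightarrow> 0) (at 0)" by (auto intro!: tendsto_eq_intros)
  qed
  then show ?thesis using equal by (simp add: DERIV_def)
qed

lemma DERIV_max_power3: "((\<lambda>x::real. max 0 x ^ 3) has_real_derivative 3 * max 0 x ^ 2) (at x)"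
proof -
  have "(\<lambda>x::real. max 0 x ^ 3) = (\<lambda>x. x * max 0 x ^ 2)"
    by (auto simp: max_def power2_eq_square power3_eq_cube)
  moreover have "((\<lambda>x::real. x * max 0 x ^ 2) has_real_derivative 1 * max 0 x ^ 2 + 2 * max 0 x * x) (at x)"
    by (rule DERIV_mult[OF DERIV_ident DERIV_max_power2])
  moreover have "1 * max 0 x ^ 2 + 2 * max 0 x * x = 3 * max 0 x ^ 2"
    by (auto simp: max_def power2_eq_square)
  ultimately show ?thesis by (simp only:)
qed

lemma DERIV_bump: "(bump has_real_derivative bump' t) (at t)"
proof -
  have "((\<lambda>t::real. t * (1 - t)) has_real_derivative (1 - 2 * t)) (at t)"
    by (auto intro!: derivative_eq_intros)
  from DERIV_chain2[OF DERIV_max_power3 this] show ?thesis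
    unfolding bump_def[abs_def] bump'_def tent_def .
qed

lemma DERIV_bump': "(bump' has_real_derivative bump'' t) (at t)"
proof -
  have "((\<lambda>t::real. t * (1 - t)) has_real_derivative (1 - 2 * t)) (at t)"
    by (auto intro!: derivative_eq_intros)
  from DERIV_chain2[OF DERIV_max_power2 this]
  have *: "((\<lambda>t. tent t ^ 2) has_real_derivative 2 * tent t * (1 - 2 * t)) (at t)"
    unfolding tent_def .
  show ?thesis
    unfolding bump'_def[abs_def] bump''_def
    by (rule derivative_eq_intros * refl)+ (simp add: algebra_simps power2_eq_square)
qed

lemma continuous_on_bump'': "continuous_on S bump''"
  unfolding bump''_def[abs_def] by (intro continuous_intros)

lemma bump_bounds:
  "0 \<le> bump t" "bump t \<le> tent t" "\<bar>bump' t\<bar> \<le> 3 * tent t" "\<bar>bump'' t\<bar> \<le> 8 * tent t"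
proof -
  have m: "0 \<le> tent t" "tent t \<le> 1 / 4" using tent_nonneg tent_le by auto
  have sq: "tent t ^ 2 \<le> 1 / 4 * tent t"
    unfolding power2_eq_square using m by (intro mult_right_mono) auto
  show "0 \<le> bump t" unfolding bump_def using m by simp
  have "tent t ^ 3 = tent t ^ 2 * tent t" by (simp add: power3_eq_cube power2_eq_square)
  also have "\<dots> \<le> 1 * tent t" using m sq by (intro mult_right_mono) auto
  finally show "bump t \<le> tent t" unfolding bump_def by simp
  show "\<bar>bump' t\<bar> \<le> 3 * tent t" "\<bar>bump'' t\<bar> \<le> 8 * tent t"
  proof -
    have a: "\<bar>1 - 2 * t\<bar> \<le> 1" if "tent t \<noteq> 0"
    proof -
      have "t \<in> {0..1}" using tent_zero that by blast
      then show ?thesis by auto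
    qed
    show "\<bar>bump' t\<bar> \<le> 3 * tent t"
    proof (cases "tent t = 0")
      case False
      have "\<bar>bump' t\<bar> = 3 * tent t ^ 2 * \<bar>1 - 2 * t\<bar>" unfolding bump'_def by (simp add: abs_mult)
      also have "\<dots> \<le> 3 * tent t ^ 2 * 1" using a[OF False] by (intro mult_left_mono) auto
      finally show ?thesis using sq m by linarith
    qed (simp add: bump'_def)
    show "\<bar>bump'' t\<bar> \<le> 8 * tent t"
    proof (cases "tent t = 0")
      case False
      have "(1 - 2 * t)\<^sup>2 \<le> 1" using a[OF False] by (simp add: abs_square_le_1)
      then have "6 * tent t * (1 - 2 * t)\<^sup>2 \<le> 6 * tent t * 1" using m by (intro mult_left_mono) auto
      moreover have "0 \<le> 6 * tent t * (1 - 2 * t)\<^sup>2" using m by simp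
      moreover have "0 \<le> tent t ^ 2" by simp
      ultimately show ?thesis unfolding bump''_def using sq m by linarith
    qed (simp add: bump''_def)
  qed
qed

lemma bump_zero: "t \<notin> {0..1} \<Longrightarrow> bump t = 0" "t \<notin> {0..1} \<Longrightarrow> bump' t = 0" "t \<notin> {0..1} \<Longrightarrow> bump'' t = 0"
  using tent_zero[of t] unfolding bump_def bump'_def bump''_def by simp_all

text \<open>\<open>q\<^sup>s h(ln q)\<close> on the positive half-line, extended by zero.  For \<open>h\<close> supported in a half-line bounded
  below this is as smooth as \<open>h\<close>, and differentiation acts on \<open>h\<close> as \<open>h' + s h\<close> while lowering \<open>s\<close> by one.\<close>

definition pull :: "real \<Rightarrow> (real \<Rightarrow> real) \<Rightarrow> real \<Rightarrow> real"
  where "pull s h q = (if q > 0 then q powr s * h (ln q) else 0)"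

lemma pull_zero: "(\<And>u. u < lo \<Longrightarrow> h u = 0) \<Longrightarrow> q < exp lo \<Longrightarrow> pull s h q = 0"
  unfolding pull_def by (auto simp: ln_less_cancel_iff[of q "exp lo", simplified])

lemma DERIV_pull:
  assumes "\<And>u. (h has_real_derivative h' u) (at u)" "\<And>u. u < lo \<Longrightarrow> h u = 0"
  shows "(pull s h has_real_derivative pull (s - 1) (\<lambda>u. h' u + s * h u) q) (at q)"
proof (cases "q > 0")
  case True
  have "((\<lambda>q. q powr s * h (ln q)) has_real_derivative q powr s * (h' (ln q) * inverse q) + s * q powr (s - 1) * h (ln q)) (at q)"
    using DERIV_mult'[OF has_real_derivative_powr[OF True, of s] DERIV_chain2[OF assms(1) DERIV_ln[OF True]]] .
  moreover have "q powr s * (h' (ln q) * inverse q) + s * q powr (s - 1) * h (ln q) = pull (s - 1) (\<lambda>u. h' u + s * h u) q"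
    using True unfolding pull_def by (simp add: powr_diff field_simps)
  ultimately have "((\<lambda>q. q powr s * h (ln q)) has_real_derivative pull (s - 1) (\<lambda>u. h' u + s * h u) q) (at q)"
    by simp
  then show ?thesis
    by (rule has_field_derivative_transform_within_open[of _ _ _ "{0<..}"]) (use True in \<open>auto simp: pull_def\<close>)
next
  case False
  have "((\<lambda>q. 0::real) has_real_derivative 0) (at q)" by simp
  then have "(pull s h has_real_derivative 0) (at q)"
  proof (rule has_field_derivative_transform_within_open[of _ _ _ "{..<exp lo}"])
    show "q \<in> {..<exp lo}" using False exp_gt_zero[of lo] by (simp del: exp_gt_zero)
  qed (auto simp: pull_zero[OF assms(2)])
  then show ?thesis using False by (simp add: pull_def)
qed

lemma continuous_on_pull:
  assumes "continuous_on UNIV h" "\<And>u. u < lo \<Longrightarrow> h u = 0"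
  shows "continuous_on UNIV (pull s h)"
proof -
  have "continuous_on {0<..} (\<lambda>q. q powr s * h (ln q))"
    by (intro continuous_intros continuous_on_compose2[OF assms(1)]) auto
  then have 1: "continuous_on {0<..} (pull s h)"
    by (rule continuous_on_eq) (simp add: pull_def)
  have 2: "continuous_on {..<exp lo} (pull s h)"
    by (rule continuous_on_eq[of _ "\<lambda>_. 0"]) (auto simp: pull_zero[OF assms(2)])
  have "q < exp lo" if "q \<le> 0" for q :: real
    using that exp_gt_zero[of lo] by linarith
  then have "{0<..} \<union> {..<exp lo} = UNIV" by (auto simp: not_less)
  then show ?thesis using continuous_on_open_Un[OF _ _ 1 2] by simp
qed

lemma compactly_supported_antiderivative_exists:
  fixes g :: "real \<Rightarrow> real"
  assumes cont: "continuous_on UNIV g" and zero: "\<And>t. t \<notin> {0..1} \<Longrightarrow> g t = 0"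
    and int: "integral {0..1} g = 0"
  obtains F where "\<And>t. (F has_real_derivative g t) (at t)" "\<And>t. t \<notin> {0..1} \<Longrightarrow> F t = 0"
proof
  define F where "F = (\<lambda>t. integral {-1..t} g)"
  have intg: "g integrable_on {a..b}" for a b
    by (rule integrable_continuous_interval) (use cont continuous_on_subset in blast)
  have z: "F t = 0" if "t < 0" for t
    unfolding F_def by (rule integral_unique, rule has_integral_is_0) (use that zero in auto)
  show F0: "F t = 0" if "t \<notin> {0..1}" for t
  proof (cases "t < 0")
    case False
    then have t: "t > 1" using that by auto
    have "integral {-1..t} g = integral {-1..0} g + integral {0..t} g"
      using t by (intro Henstock_Kurzweil_Integration.integral_combine[symmetric] intg) auto
    also have "integral {0..t} g = integral {0..1} g + integral {1..t} g"
      using t by (intro Henstock_Kurzweil_Integration.integral_combine[symmetric] intg) auto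
    also have "integral {1..t} g = 0"
    proof (rule integral_unique, rule has_integral_spike_finite[of "{1}"])
      show "((\<lambda>x. 0::real) has_integral 0) {1..t}" by simp
    qed (use zero in auto)
    also have "integral {-1..0} g = 0"
    proof (rule integral_unique, rule has_integral_spike_finite[of "{0}"])
      show "((\<lambda>x. 0::real) has_integral 0) {-1..0}" by simp
    qed (use zero in auto)
    finally show ?thesis using int unfolding F_def by simp
  qed (rule z)
  show "(F has_real_derivative g t) (at t)" for t
  proof (cases "t < 0")
    case True
    have "((\<lambda>t. 0::real) has_real_derivative 0) (at t)" by simp
    then have "(F has_real_derivative 0) (at t)"
      by (rule has_field_derivative_transform_within_open[of _ _ _ "{..<0}"]) (use True z in auto)
    then show ?thesis using True zero by simp
  next
    case False
    have "(F has_real_derivative g t) (at t within {-1..t + 1})"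
      unfolding F_def
      by (rule integral_has_real_derivative) (use False cont continuous_on_subset in auto)
    then show ?thesis using False at_within_interior[of t "{-1..t + 1}"] by simp
  qed
qed

lemma integral_tent_powr_pos:
  assumes "r > 0" "continuous_on {0..1} f" "\<And>t. f t > 0"
  shows "integral {0..1} (\<lambda>t. f t * tent t powr r) > 0"
proof -
  have cont: "continuous_on {0..1} (\<lambda>t. f t * tent t powr r)"
    by (intro continuous_on_mult assms continuous_on_powr') (use assms tent_nonneg in \<open>auto intro!: continuous_intros\<close>)
  have nn: "\<And>t. t \<in> {0..1} \<Longrightarrow> 0 \<le> f t * tent t powr r" using assms(3) by (simp add: less_imp_le)
  have "integral {0..1} (\<lambda>t. f t * tent t powr r) \<noteq> 0"
  proof
    assume "integral {0..1} (\<lambda>t. f t * tent t powr r) = 0"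
    then have "\<forall>t\<in>{0..1}. f t * tent t powr r = 0"
      using integral_eq_0_iff[OF cont _ nn] by simp
    then have "f (1/2) * tent (1/2) powr r = 0" by simp
    then show False using assms(3)[of "1/2"] unfolding tent_def by simp
  qed
  moreover have "integral {0..1} (\<lambda>t. f t * tent t powr r) \<ge> 0"
    by (rule integral_nonneg[OF integrable_continuous_interval[OF cont] nn])
  ultimately show ?thesis by linarith
qed

section \<open>Functions of the tangential and normal distances\<close>

definition pr :: "'a::euclidean_space set \<Rightarrow> 'a \<Rightarrow> 'a"
  where "pr B v = (\<Sum>e\<in>B. (v \<bullet> e) *\<^sub>R e)"

definition sqn :: "'a::euclidean_space set \<Rightarrow> 'a \<Rightarrow> real"
  where "sqn B v = (\<Sum>e\<in>B. (v \<bullet> e)\<^sup>2)"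

lemma sqn_nonneg: "sqn B v \<ge> 0"
  unfolding sqn_def by (intro sum_nonneg) auto

lemma pr_inner: "pr B v \<bullet> w = (\<Sum>e\<in>B. (v \<bullet> e) * (w \<bullet> e))"
  unfolding pr_def inner_sum_left by (intro sum.cong) (auto simp: inner_commute)

lemma pr_self_adjoint: "pr B v \<bullet> w = pr B w \<bullet> v"
  unfolding pr_inner by (intro sum.cong) auto

lemma pr_inner_self: "pr B v \<bullet> v = sqn B v"
  unfolding pr_inner sqn_def by (simp add: power2_eq_square)

lemma pr_inner_frame:
  assumes "orthonormal B" "e \<in> B"
  shows "pr B v \<bullet> e = v \<bullet> e"
proof -
  have "pr B v \<bullet> e = (\<Sum>e'\<in>B. (v \<bullet> e') * (if e = e' then 1 else 0))"
    unfolding pr_inner using assms unfolding orthonormal_def by (intro sum.cong) auto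
  also have "\<dots> = v \<bullet> e"
    using assms unfolding orthonormal_def by (subst sum.remove[of B e]) (auto intro!: sum.neutral split: if_splits)
  finally show ?thesis .
qed

lemma pr_inner_pr:
  assumes "orthonormal B"
  shows "pr B v \<bullet> pr B w = pr B v \<bullet> w"
  unfolding pr_inner[of _ _ "pr B w"] pr_inner[of _ _ w]
  by (intro sum.cong refl) (simp add: pr_inner_frame[OF assms])

lemma pr_orthogonal:
  assumes "\<And>e e'. e \<in> B \<Longrightarrow> e' \<in> B' \<Longrightarrow> e \<bullet> e' = 0"
  shows "pr B v \<bullet> pr B' w = 0"
  unfolding pr_def inner_sum_left inner_sum_right using assms by (intro sum.neutral ballI) auto

text \<open>This trace is where the dimension and codimension of \<open>K\<close> enter the Laplacian of a function of the
  squared tangential and normal distances.\<close>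

lemma trace_pr:
  fixes B :: "'a::euclidean_space set"
  assumes "orthonormal B"
  shows "(\<Sum>b\<in>Basis. pr B b \<bullet> b) = real (card B)"
proof -
  have "(\<Sum>b\<in>Basis. pr B b \<bullet> b) = (\<Sum>b\<in>(Basis :: 'a set). \<Sum>e\<in>B. (e \<bullet> b) * (e \<bullet> b))"
    unfolding pr_inner by (simp add: inner_commute)
  also have "\<dots> = (\<Sum>e\<in>B. e \<bullet> e)"
    by (subst sum.swap) (simp add: euclidean_inner[symmetric])
  also have "\<dots> = (\<Sum>e\<in>B. 1)"
    using assms unfolding orthonormal_def by (intro sum.cong) auto
  finally show ?thesis by simp
qed

lemma has_derivative_sqn: "((\<lambda>x. sqn B (x - a)) has_derivative (\<lambda>h. 2 * (pr B (x - a) \<bullet> h))) (at x)"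
proof -
  have "((\<lambda>x. sqn B (x - a)) has_derivative (\<lambda>h. \<Sum>e\<in>B. 2 * (((x - a) \<bullet> e) * (h \<bullet> e)))) (at x)"
    unfolding sqn_def
    by (intro has_derivative_sum) (auto intro!: derivative_eq_intros simp: algebra_simps)
  then show ?thesis unfolding pr_inner by (simp add: sum_distrib_left)
qed

lemma continuous_on_sqn: "continuous_on S (\<lambda>x. sqn B (x - a))"
  unfolding sqn_def by (intro continuous_intros)

lemma continuous_on_pr: "continuous_on S (\<lambda>x. pr B (x - a))"
  unfolding pr_def by (intro continuous_intros)

text \<open>The vector field \<open>z \<bar>z\<bar>\<^sup>-\<^sup>n F(ln \<bar>z\<bar>\<^sup>2)\<close> on \<open>\<real>\<^sup>n\<close> has divergence \<open>2 \<bar>z\<bar>\<^sup>-\<^sup>n F'(ln \<bar>z\<bar>\<^sup>2)\<close>, so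
  integration against \<open>\<bar>z\<bar>\<^sup>-\<^sup>n\<close> of functions of \<open>ln \<bar>z\<bar>\<^sup>2\<close> annihilates derivatives.\<close>

lemma integral_log_radial_derivative_eq_0:
  fixes a :: "'a::euclidean_space" and F h :: "real \<Rightarrow> real"
  assumes B: "orthonormal B"
    and F: "\<And>u. (F has_real_derivative h u) (at u)" "continuous_on UNIV h"
    and supp: "\<And>u. u \<notin> {lo..hi} \<Longrightarrow> F u = 0" "\<And>u. u \<notin> {lo..hi} \<Longrightarrow> h u = 0"
    and W: "continuous_on UNIV W" "\<And>x e t. e \<in> B \<Longrightarrow> W (x + t *\<^sub>R e) = W x"
    and T: "compact T" "\<And>x. x \<notin> T \<Longrightarrow> sqn B (x - a) \<le> exp hi \<Longrightarrow> W x = 0"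
  shows "(\<integral>x. pull (- real (card B) / 2) h (sqn B (x - a)) * W x \<partial>lborel) = 0"
proof -
  define s :: real where "s = - real (card B) / 2"
  define h2 where "h2 = (\<lambda>u. h u + s * F u)"
  define Q where "Q = (\<lambda>x. sqn B (x - a))"
  have Qnn: "Q x \<ge> 0" for x unfolding Q_def by (rule sqn_nonneg)
  have lo0: "F u = 0" "h u = 0" "h2 u = 0" if "u < lo" for u
    using supp[of u] that unfolding h2_def by auto
  have contF: "continuous_on UNIV F"
    by (meson F(1) DERIV_isCont continuous_at_imp_continuous_on)
  have conth2: "continuous_on UNIV h2" unfolding h2_def by (intro continuous_intros F(2) contF)
  have contQ: "continuous_on UNIV Q" unfolding Q_def by (rule continuous_on_sqn)
  have cpull: "continuous_on UNIV (\<lambda>x. pull r g (Q x))" if "continuous_on UNIV g" "\<And>u. u < lo \<Longrightarrow> g u = 0" for r g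
    by (rule continuous_on_compose2[OF continuous_on_pull[OF that] contQ]) auto
  have out: "pull r g (Q x) * W x = 0" if "x \<notin> T" "\<And>u. u \<notin> {lo..hi} \<Longrightarrow> g u = 0" for x r g
  proof (cases "Q x \<le> exp hi")
    case True
    then show ?thesis using T(2)[OF that(1)] unfolding Q_def by simp
  next
    case False
    moreover from False have "Q x > 0" using exp_gt_zero[of hi] by linarith
    ultimately have "ln (Q x) > hi" using ln_less_cancel_iff[of "exp hi" "Q x"] by simp
    then show ?thesis using that(2)[of "ln (Q x)"] unfolding pull_def by simp
  qed
  have h2out: "u \<notin> {lo..hi} \<Longrightarrow> h2 u = 0" for u unfolding h2_def using supp[of u] by simp
  define f where "f = (\<lambda>e x. ((x - a) \<bullet> e) * (pull s F (Q x) * W x))"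
  define f' where "f' = (\<lambda>e x. pull s F (Q x) * W x + 2 * ((x - a) \<bullet> e)\<^sup>2 * (pull (s - 1) h2 (Q x) * W x))"
  have cf': "continuous_on UNIV (f' e)" for e
    unfolding f'_def by (intro continuous_intros cpull contF conth2 W(1) lo0)
  have f'0: "f' e x = 0" if "x \<notin> T" for e x
  proof -
    have "pull s F (Q x) * W x = 0" by (rule out[OF that]) (rule supp(1))
    moreover have "pull (s - 1) h2 (Q x) * W x = 0" by (rule out[OF that]) (rule h2out)
    ultimately show ?thesis unfolding f'_def by (simp only: mult_zero_right add_0)
  qed
  have "(\<integral>x. f' e x \<partial>lborel) = 0" if e: "e \<in> B" for e
  proof (rule integral_directional_derivative_eq_0[OF T(1), of "f e"])
    show "f e x = 0" if "x \<notin> T" for x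
    proof -
      have "pull s F (Q x) * W x = 0" by (rule out[OF that]) (rule supp(1))
      then show ?thesis unfolding f_def by simp
    qed
    show "continuous_on UNIV (f e)"
      unfolding f_def by (intro continuous_intros cpull contF W(1) lo0)
    show "continuous_on UNIV (f' e)" by (rule cf')
    fix x
    have ee: "e \<bullet> e = 1" using B e unfolding orthonormal_def by auto
    have dQ: "((\<lambda>t. Q (x + t *\<^sub>R e)) has_real_derivative 2 * ((x - a) \<bullet> e)) (at 0)"
      using has_derivative_imp_directional[OF has_derivative_sqn[of B a x], of e] pr_inner_frame[OF B e]
      unfolding Q_def by simp
    have dpull: "((\<lambda>t. pull s F (Q (x + t *\<^sub>R e))) has_real_derivative pull (s - 1) h2 (Q x) * (2 * ((x - a) \<bullet> e))) (at 0)"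
      using DERIV_chain2[OF DERIV_pull[where h=F and h'=h and lo=lo and s=s, OF F(1) lo0(1)] dQ]
      unfolding h2_def by simp
    have dlin: "((\<lambda>t. (x + t *\<^sub>R e - a) \<bullet> e) has_real_derivative 1) (at 0)"
      by (auto intro!: derivative_eq_intros simp: ee inner_add_left inner_diff_left)
    have "((\<lambda>t. ((x + t *\<^sub>R e - a) \<bullet> e) * (pull s F (Q (x + t *\<^sub>R e)) * W x)) has_real_derivative f' e x) (at 0)"
      using DERIV_mult[OF dlin DERIV_cmult_right[OF dpull, of "W x"]]
      by (rule DERIV_cong) (simp add: f'_def algebra_simps power2_eq_square)
    then show "((\<lambda>t. f e (x + t *\<^sub>R e)) has_real_derivative f' e x) (at 0)"
      unfolding f_def using W(2)[OF e] by simp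
  qed
  then have "(\<Sum>e\<in>B. \<integral>x. f' e x \<partial>lborel) = 0" by simp
  moreover have "(\<Sum>e\<in>B. \<integral>x. f' e x \<partial>lborel) = (\<integral>x. (\<Sum>e\<in>B. f' e x) \<partial>lborel)"
    by (rule Bochner_Integration.integral_sum[symmetric]) (rule integrable_compact_support[OF cf' T(1) f'0])
  moreover have "(\<Sum>e\<in>B. f' e x) = 2 * (pull s h (Q x) * W x)" for x
  proof -
    have "(\<Sum>e\<in>B. f' e x) = card B * (pull s F (Q x) * W x) + 2 * (Q x * (pull (s - 1) h2 (Q x) * W x))"
      unfolding f'_def Q_def sqn_def
      by (simp add: sum.distrib sum_distrib_left sum_distrib_right mult.assoc)
    also have "\<dots> = (card B * pull s F (Q x) + 2 * (Q x * pull (s - 1) h2 (Q x))) * W x"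
      by (simp add: algebra_simps)
    also have "Q x * pull (s - 1) h2 (Q x) = pull s h2 (Q x)"
      using Qnn[of x] unfolding pull_def by (auto simp: powr_diff)
    also have "card B * pull s F (Q x) + 2 * pull s h2 (Q x) = 2 * pull s h (Q x)"
      unfolding pull_def h2_def s_def by (simp add: algebra_simps)
    finally show ?thesis by simp
  qed
  ultimately show ?thesis unfolding s_def[symmetric] Q_def by simp
qed

text \<open>Hence such an integral depends on the function of \<open>ln \<bar>z\<bar>\<^sup>2\<close> only through its integral over
  the line, up to a common factor.\<close>

lemma integral_log_radial_proportional:
  fixes a :: "'a::euclidean_space" and g1 g2 :: "real \<Rightarrow> real"
  assumes B: "orthonormal B" and N: "N > 0"
    and g: "continuous_on UNIV g1" "continuous_on UNIV g2"
    and supp: "\<And>t. t \<notin> {0..1} \<Longrightarrow> g1 t = 0" "\<And>t. t \<notin> {0..1} \<Longrightarrow> g2 t = 0"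
    and W: "continuous_on UNIV W" "\<And>x e t. e \<in> B \<Longrightarrow> W (x + t *\<^sub>R e) = W x"
    and T: "compact T" "\<And>x. x \<notin> T \<Longrightarrow> sqn B (x - a) \<le> exp (S0 + N) \<Longrightarrow> W x = 0"
  shows "(\<integral>x. pull (- real (card B) / 2) (\<lambda>u. g1 ((u - S0) / N)) (sqn B (x - a)) * W x \<partial>lborel) * integral {0..1} g2
       = (\<integral>x. pull (- real (card B) / 2) (\<lambda>u. g2 ((u - S0) / N)) (sqn B (x - a)) * W x \<partial>lborel) * integral {0..1} g1"
proof -
  define I1 where "I1 = integral {0..1} g1"
  define I2 where "I2 = integral {0..1} g2"
  define g where "g = (\<lambda>t. I2 * g1 t - I1 * g2 t)"
  define s :: real where "s = - real (card B) / 2"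
  define L where "L = (\<lambda>u. (u - S0) / N)"
  have L: "L u \<notin> {0..1}" if "u \<notin> {S0..S0 + N}" for u
    using that N unfolding L_def by (auto simp: field_simps)
  have intg: "g1 integrable_on {0..1}" "g2 integrable_on {0..1}"
    using g by (auto intro!: integrable_continuous_interval intro: continuous_on_subset)
  have contg: "continuous_on UNIV g" unfolding g_def by (intro continuous_intros g)
  have "integral {0..1} g = 0"
    unfolding g_def using integrable_cmul[OF intg(1), of I2] integrable_cmul[OF intg(2), of I1]
    by (subst integral_diff) (auto simp: I1_def I2_def)
  then obtain F where F: "\<And>t. (F has_real_derivative g t) (at t)" "\<And>t. t \<notin> {0..1} \<Longrightarrow> F t = 0"
    using compactly_supported_antiderivative_exists[OF contg] supp unfolding g_def by auto
  have dF: "((\<lambda>u. N * F (L u)) has_real_derivative g (L u)) (at u)" for u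
  proof -
    have "(L has_real_derivative 1 / N) (at u)"
      unfolding L_def by (rule DERIV_cdivide) (auto intro!: derivative_eq_intros)
    from DERIV_cmult[OF DERIV_chain2[OF F(1) this], of N]
    have "((\<lambda>u. N * F (L u)) has_real_derivative N * (g (L u) * (1 / N))) (at u)" .
    moreover have "N * (g (L u) * (1 / N)) = g (L u)" using less_imp_neq[OF N] by simp
    ultimately show ?thesis by (simp only:)
  qed
  have contL: "continuous_on UNIV (\<lambda>u. f (L u))" if "continuous_on UNIV f" for f :: "real \<Rightarrow> real"
    by (rule continuous_on_compose2[OF that]) (use N in \<open>auto simp: L_def intro!: continuous_intros\<close>)
  have zero: "(\<integral>x. pull s (\<lambda>u. g (L u)) (sqn B (x - a)) * W x \<partial>lborel) = 0"
    unfolding s_def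
    by (rule integral_log_radial_derivative_eq_0[OF B dF contL[OF contg] _ _ W T])
       (use L F(2) supp in \<open>auto simp: g_def\<close>)
  have int: "integrable lborel (\<lambda>x. pull s (\<lambda>u. f (L u)) (sqn B (x - a)) * W x)"
    if f: "continuous_on UNIV f" "\<And>t. t \<notin> {0..1} \<Longrightarrow> f t = 0" for f
  proof (rule integrable_compact_support[OF _ T(1)])
    have "\<And>u. u < S0 \<Longrightarrow> f (L u) = 0" using L f(2) by auto
    from continuous_on_pull[OF contL[OF f(1)] this]
    have "continuous_on UNIV (\<lambda>x. pull s (\<lambda>u. f (L u)) (sqn B (x - a)))"
      by (rule continuous_on_compose2[OF _ continuous_on_sqn]) auto
    then show "continuous_on UNIV (\<lambda>x. pull s (\<lambda>u. f (L u)) (sqn B (x - a)) * W x)"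
      using W(1) by (rule continuous_on_mult)
    fix x assume x: "x \<notin> T"
    show "pull s (\<lambda>u. f (L u)) (sqn B (x - a)) * W x = 0"
    proof (cases "sqn B (x - a) \<le> exp (S0 + N)")
      case True
      then show ?thesis using T(2)[OF x] by simp
    next
      case False
      moreover from False have "sqn B (x - a) > 0" using exp_gt_zero[of "S0 + N"] by linarith
      ultimately have "ln (sqn B (x - a)) > S0 + N"
        using ln_less_cancel_iff[of "exp (S0 + N)" "sqn B (x - a)"] by simp
      then have "f (L (ln (sqn B (x - a)))) = 0" by (intro f(2) L) auto
      then show ?thesis unfolding pull_def by simp
    qed
  qed
  have "pull s (\<lambda>u. g (L u)) q * w = I2 * (pull s (\<lambda>u. g1 (L u)) q * w) - I1 * (pull s (\<lambda>u. g2 (L u)) q * w)" for q w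
    unfolding pull_def g_def by (simp add: algebra_simps)
  then have "0 = I2 * (\<integral>x. pull s (\<lambda>u. g1 (L u)) (sqn B (x - a)) * W x \<partial>lborel)
              - I1 * (\<integral>x. pull s (\<lambda>u. g2 (L u)) (sqn B (x - a)) * W x \<partial>lborel)"
    using zero int[OF g(1) supp(1)] int[OF g(2) supp(2)] by simp
  then show ?thesis unfolding I1_def I2_def s_def L_def by (simp add: mult.commute)
qed

lemma has_derivative_profile:
  assumes "(H has_real_derivative H') (at (sqn B (x - a)))"
  shows "((\<lambda>x. H (sqn B (x - a))) has_derivative (\<lambda>h. 2 * H' * (pr B (x - a) \<bullet> h))) (at x)"
  using has_derivative_compose[OF has_derivative_sqn assms[unfolded has_field_derivative_def]]
  by (simp add: mult_ac)

lemma has_derivative_profile_product: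
  assumes "(H1 has_real_derivative H1') (at (sqn B1 (x - a)))" "(H2 has_real_derivative H2') (at (sqn B2 (x - a)))"
  shows "((\<lambda>x. H1 (sqn B1 (x - a)) * H2 (sqn B2 (x - a)) * (pr B (x - a) \<bullet> b)) has_derivative
     (\<lambda>h. (2 * H1' * H2 (sqn B2 (x - a)) * (pr B1 (x - a) \<bullet> h) + 2 * H1 (sqn B1 (x - a)) * H2' * (pr B2 (x - a) \<bullet> h)) * (pr B (x - a) \<bullet> b)
        + H1 (sqn B1 (x - a)) * H2 (sqn B2 (x - a)) * (pr B h \<bullet> b))) (at x)"
proof -
  have lin: "((\<lambda>x. pr B (x - a) \<bullet> b) has_derivative (\<lambda>h. pr B h \<bullet> b)) (at x)"
  proof -
    have "((\<lambda>x. pr B b \<bullet> (x - a)) has_derivative (\<lambda>h. pr B b \<bullet> h)) (at x)"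
      by (auto intro!: derivative_eq_intros)
    then show ?thesis unfolding pr_self_adjoint[of B b] .
  qed
  show ?thesis
    using has_derivative_mult[OF has_derivative_mult[OF has_derivative_profile[OF assms(1)] has_derivative_profile[OF assms(2)]] lin]
    by (rule has_derivative_eq_rhs) (auto simp: algebra_simps)
qed

context
  fixes B1 B2 :: "'a::euclidean_space set" and a :: 'a and G1 G1' G1'' G2 G2' G2'' :: "real \<Rightarrow> real"
  assumes G1: "\<And>q. (G1 has_real_derivative G1' q) (at q)" "\<And>q. (G1' has_real_derivative G1'' q) (at q)" "continuous_on UNIV G1''"
    and G2: "\<And>q. (G2 has_real_derivative G2' q) (at q)" "\<And>q. (G2' has_real_derivative G2'' q) (at q)" "continuous_on UNIV G2''"
begin

private abbreviation "ty x \<equiv> pr B1 (x - a)"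
private abbreviation "nz x \<equiv> pr B2 (x - a)"
private abbreviation "tsq x \<equiv> sqn B1 (x - a)"
private abbreviation "nsq x \<equiv> sqn B2 (x - a)"
private abbreviation "prodfun x \<equiv> G1 (nsq x) * G2 (tsq x)"

lemma has_derivative_product_test:
  "(prodfun has_derivative (\<lambda>h. ((2 * G1' (nsq x) * G2 (tsq x)) *\<^sub>R nz x + (2 * G1 (nsq x) * G2' (tsq x)) *\<^sub>R ty x) \<bullet> h)) (at x)"
  using has_derivative_mult[OF has_derivative_profile[OF G1(1)] has_derivative_profile[OF G2(1)]]
  by (rule has_derivative_eq_rhs) (auto simp: inner_add_left algebra_simps)

lemma partial_product_test:
  "partial b prodfun x = 2 * (G1' (nsq x) * G2 (tsq x) * (nz x \<bullet> b)) + 2 * (G1 (nsq x) * G2' (tsq x) * (ty x \<bullet> b))"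
  using partial_eqI[OF has_derivative_product_test] by (simp add: inner_add_left)

lemma has_derivative_partial_product_test:
  "(partial b prodfun has_derivative (\<lambda>h.
      2 * ((2 * G1'' (nsq x) * G2 (tsq x) * (nz x \<bullet> h) + 2 * G1' (nsq x) * G2' (tsq x) * (ty x \<bullet> h)) * (nz x \<bullet> b)
            + G1' (nsq x) * G2 (tsq x) * (pr B2 h \<bullet> b))
    + 2 * ((2 * G1' (nsq x) * G2' (tsq x) * (nz x \<bullet> h) + 2 * G1 (nsq x) * G2'' (tsq x) * (ty x \<bullet> h)) * (ty x \<bullet> b)
            + G1 (nsq x) * G2' (tsq x) * (pr B1 h \<bullet> b)))) (at x)"
  unfolding partial_product_test[abs_def]
  by (intro has_derivative_add has_derivative_mult_right has_derivative_profile_product G1 G2)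

lemma C2_on_product_test: "C2_on S prodfun"
proof -
  have cont: "continuous_on UNIV G1" "continuous_on UNIV G1'" "continuous_on UNIV G2" "continuous_on UNIV G2'"
    by (meson G1 G2 DERIV_isCont continuous_at_imp_continuous_on)+
  have c: "continuous_on S (\<lambda>x. G (sqn B (x - a)))" if "continuous_on UNIV G" for G :: "real \<Rightarrow> real" and B
    by (rule continuous_on_compose2[OF that continuous_on_sqn]) auto
  have c1: "continuous_on S (partial b prodfun)" for b
    unfolding partial_product_test[abs_def]
    by (intro continuous_intros c cont continuous_on_pr)
  have c2: "continuous_on S (partial b' (partial b prodfun))" for b b'
    unfolding partial_eqI[OF has_derivative_partial_product_test, abs_def]
    by (intro continuous_intros c cont continuous_on_pr G1(3) G2(3))
  show ?thesis unfolding C2_on_def C1_on_def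
    using c1 c2 differentiableI[OF has_derivative_product_test]
      differentiableI[OF has_derivative_partial_product_test] by blast
qed

text \<open>The mixed second-order terms cancel because the tangential and the normal component are orthogonal; for
  the same reason the tangential part of \<open>\<nabla>\<phi>\<close> does not see the gradient of \<open>c\<close>, which is normal.\<close>

lemma div_op_product_test:
  assumes B: "orthonormal B1" "orthonormal B2" "\<And>e e'. e \<in> B1 \<Longrightarrow> e' \<in> B2 \<Longrightarrow> e \<bullet> e' = 0"
    and c: "(c has_derivative (\<lambda>h. (g *\<^sub>R nz x) \<bullet> h)) (at x)"
  shows "div_op c prodfun x = - (g * (2 * G1' (nsq x) * G2 (tsq x) * nsq x)
     + c x * ((4 * nsq x * G1'' (nsq x) + 2 * card B2 * G1' (nsq x)) * G2 (tsq x)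
            + G1 (nsq x) * (4 * tsq x * G2'' (tsq x) + 2 * card B1 * G2' (tsq x))))"
proof -
  have yz: "ty x \<bullet> nz x = 0" by (rule pr_orthogonal[OF B(3)])
  have zz: "nz x \<bullet> nz x = nsq x" unfolding pr_inner_pr[OF B(2)] by (rule pr_inner_self)
  have yy: "ty x \<bullet> ty x = tsq x" unfolding pr_inner_pr[OF B(1)] by (rule pr_inner_self)
  have par: "partial b (\<lambda>w. c w * partial b prodfun w) x =
     c x * (2 * ((2 * G1'' (nsq x) * G2 (tsq x) * (nz x \<bullet> b) + 2 * G1' (nsq x) * G2' (tsq x) * (ty x \<bullet> b)) * (nz x \<bullet> b)
            + G1' (nsq x) * G2 (tsq x) * (pr B2 b \<bullet> b))
    + 2 * ((2 * G1' (nsq x) * G2' (tsq x) * (nz x \<bullet> b) + 2 * G1 (nsq x) * G2'' (tsq x) * (ty x \<bullet> b)) * (ty x \<bullet> b)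
            + G1 (nsq x) * G2' (tsq x) * (pr B1 b \<bullet> b)))
    + g * (nz x \<bullet> b) * (2 * (G1' (nsq x) * G2 (tsq x) * (nz x \<bullet> b)) + 2 * (G1 (nsq x) * G2' (tsq x) * (ty x \<bullet> b)))" for b
    using partial_eqI[OF has_derivative_mult[OF c has_derivative_partial_product_test[of b x]], of b]
    unfolding partial_product_test by simp
  have 1: "(\<Sum>b\<in>Basis. (nz x \<bullet> b) * (nz x \<bullet> b)) = nsq x" "(\<Sum>b\<in>Basis. (ty x \<bullet> b) * (ty x \<bullet> b)) = tsq x"
    "(\<Sum>b\<in>Basis. (ty x \<bullet> b) * (nz x \<bullet> b)) = 0"
    using zz yy yz unfolding euclidean_inner[of "nz x" "nz x"] euclidean_inner[of "ty x" "ty x"] euclidean_inner[of "ty x" "nz x"] by auto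
  have "(\<Sum>b\<in>Basis. partial b (\<lambda>w. c w * partial b prodfun w) x) =
     (\<Sum>b\<in>Basis. (4 * c x * G1'' (nsq x) * G2 (tsq x) + 2 * g * G1' (nsq x) * G2 (tsq x)) * ((nz x \<bullet> b) * (nz x \<bullet> b))
       + (8 * c x * G1' (nsq x) * G2' (tsq x) + 2 * g * G1 (nsq x) * G2' (tsq x)) * ((ty x \<bullet> b) * (nz x \<bullet> b))
       + (4 * c x * G1 (nsq x) * G2'' (tsq x)) * ((ty x \<bullet> b) * (ty x \<bullet> b))
       + (2 * c x * G1' (nsq x) * G2 (tsq x)) * (pr B2 b \<bullet> b)
       + (2 * c x * G1 (nsq x) * G2' (tsq x)) * (pr B1 b \<bullet> b))"
    unfolding par by (intro sum.cong refl) (simp add: algebra_simps)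
  also have "\<dots> = (4 * c x * G1'' (nsq x) * G2 (tsq x) + 2 * g * G1' (nsq x) * G2 (tsq x)) * nsq x
       + (4 * c x * G1 (nsq x) * G2'' (tsq x)) * tsq x
       + (2 * c x * G1' (nsq x) * G2 (tsq x)) * card B2 + (2 * c x * G1 (nsq x) * G2' (tsq x)) * card B1"
    unfolding sum.distrib sum_distrib_left[symmetric] 1 trace_pr[OF B(1)] trace_pr[OF B(2)] by simp
  finally show ?thesis unfolding div_op_def by (simp add: algebra_simps)
qed

end

section \<open>Size of the operator on cut-off powers\<close>

text \<open>The logarithmic derivative of the coefficient, \<open>s c'(s) / c(s)\<close>: the local exponent, which moves
  from \<open>\<delta>\<close> at \<open>0\<close> to \<open>\<delta>'\<close> at infinity.\<close>

definition degen_exponent :: "real \<Rightarrow> real \<Rightarrow> real \<Rightarrow> real"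
  where "degen_exponent \<delta> \<delta>' s = \<delta> + (\<delta>' - \<delta>) * (s / (1 + s))"

lemma DERIV_degen_coeff:
  assumes "s > 0"
  shows "(degen_coeff \<delta> \<delta>' has_real_derivative degen_exponent \<delta> \<delta>' s * degen_coeff \<delta> \<delta>' s / s) (at s)"
proof -
  have 1: "((\<lambda>s. (1 + s) powr (\<delta>' - \<delta>)) has_real_derivative (\<delta>' - \<delta>) * (1 + s) powr (\<delta>' - \<delta> - 1) * 1) (at s)"
    by (rule DERIV_chain2[OF has_real_derivative_powr]) (use assms in \<open>auto intro!: derivative_eq_intros\<close>)
  have "degen_exponent \<delta> \<delta>' s * degen_coeff \<delta> \<delta>' s / s =
      s powr \<delta> * ((\<delta>' - \<delta>) * (1 + s) powr (\<delta>' - \<delta> - 1) * 1) + \<delta> * s powr (\<delta> - 1) * (1 + s) powr (\<delta>' - \<delta>)"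
  proof -
    have eq: "s powr (\<delta> - 1) = s powr \<delta> / s" "(1 + s) powr (\<delta>' - \<delta> - 1) = (1 + s) powr (\<delta>' - \<delta>) / (1 + s)"
      using assms powr_diff[of s \<delta> 1] powr_diff[of "1 + s" "\<delta>' - \<delta>" 1] by simp_all
    have "s \<noteq> 0" "1 + s \<noteq> 0" using assms by auto
    then have "(\<delta> + (\<delta>' - \<delta>) * (s / (1 + s))) * (P * A) / s = P * ((\<delta>' - \<delta>) * (A / (1 + s)) * 1) + \<delta> * (P / s) * A" for P A
      by (simp add: field_simps)
    then show ?thesis
      unfolding degen_exponent_def degen_coeff_def eq .
  qed
  then show ?thesis
    using DERIV_mult'[OF has_real_derivative_powr[OF assms, of \<delta>] 1] unfolding degen_coeff_def[abs_def] by simp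
qed

lemma degen_exponent_bounds:
  assumes "s > 0" "0 \<le> \<delta>" "\<delta> < 2" "0 \<le> \<delta>'" "\<delta>' < 2"
  shows "0 \<le> degen_exponent \<delta> \<delta>' s" "degen_exponent \<delta> \<delta>' s \<le> 2"
proof -
  define w where "w = s / (1 + s)"
  have w: "0 \<le> w" "w \<le> 1" unfolding w_def using assms(1) by auto
  have eq: "degen_exponent \<delta> \<delta>' s = \<delta> * (1 - w) + \<delta>' * w"
    unfolding degen_exponent_def w_def[symmetric] by (simp add: algebra_simps)
  show "0 \<le> degen_exponent \<delta> \<delta>' s" unfolding eq using w assms by (intro add_nonneg_nonneg mult_nonneg_nonneg) auto
  have "\<delta> * (1 - w) \<le> 2 * (1 - w)" "\<delta>' * w \<le> 2 * w"
    using w assms by (intro mult_right_mono; simp)+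
  then show "degen_exponent \<delta> \<delta>' s \<le> 2" unfolding eq by simp
qed

lemma has_derivative_degen_infdist:
  assumes K: "closed K" "convex K" "K \<noteq> {}" and x: "x \<in> - K"
  shows "((\<lambda>x. degen_coeff \<delta> \<delta>' (infdist x K)) has_derivative
     (\<lambda>h. ((degen_exponent \<delta> \<delta>' (infdist x K) * degen_coeff \<delta> \<delta>' (infdist x K) / infdist x K * infdist x K powr (- 1)) *\<^sub>R offset K x) \<bullet> h)) (at x)"
proof -
  have d: "infdist x K > 0" using infdist_pos[OF K] x by simp
  have "(\<lambda>x. infdist x K powr 1) = (\<lambda>x. infdist x K)" by (simp add: infdist_nonneg powr_one)
  then have "((\<lambda>x. infdist x K) has_derivative (\<lambda>h. infdist x K powr (- 1) * (offset K x \<bullet> h))) (at x)"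
    using has_derivative_infdist_powr[OF K, of x 1] x by simp
  from has_derivative_compose[OF this DERIV_degen_coeff[OF d, unfolded has_field_derivative_def]]
  show ?thesis by (rule has_derivative_eq_rhs) (simp add: mult_ac)
qed

lemma continuous_on_degen_gradient:
  assumes K: "closed K" "convex K" "K \<noteq> {}"
  shows "continuous_on (- K) (\<lambda>x. (degen_exponent \<delta> \<delta>' (infdist x K) * degen_coeff \<delta> \<delta>' (infdist x K) / infdist x K * infdist x K powr (- 1)) *\<^sub>R offset K x)"
proof -
  have pos: "infdist x K > 0" if "x \<in> - K" for x using infdist_pos[OF K] that by simp
  have 1: "1 + infdist x K \<noteq> 0" "infdist x K \<noteq> 0" if "x \<in> - K" for x using pos[OF that] by auto
  show ?thesis unfolding degen_exponent_def degen_coeff_def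
    by (intro continuous_intros continuous_on_offset K ballI 1)
qed

text \<open>Convexity of the \<open>p\<close>-th power, in the form that separates a main term (with a factor close to one)
  from an error term (with a large factor).\<close>

lemma powr_add_le:
  fixes X Y p l :: real
  assumes "X \<ge> 0" "Y \<ge> 0" "p > 1" "0 < l" "l < 1"
  shows "(X + Y) powr p \<le> (1 - l) powr (1 - p) * X powr p + l powr (1 - p) * Y powr p"
proof -
  have one: "1 \<le> t powr (1 - p)" if "0 < t" "t < 1" for t :: real
    using powr_mono2'[of "1 - p" t 1] that assms(3) by simp
  consider "X = 0" | "Y = 0" | "X > 0" "Y > 0" using assms by linarith
  then show ?thesis
  proof cases
    case 1
    then show ?thesis using one[of l] assms mult_right_mono[of 1 "l powr (1 - p)" "Y powr p"] by simp
  next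
    case 2
    then show ?thesis using one[of "1 - l"] assms mult_right_mono[of 1 "(1 - l) powr (1 - p)" "X powr p"] by simp
  next
    case 3
    have "((1 - l) *\<^sub>R (X / (1 - l)) + l *\<^sub>R (Y / l)) powr p \<le> (1 - l) * (X / (1 - l)) powr p + l * (Y / l) powr p"
      using convex_onD[OF powr_convex[of p], of l "X / (1 - l)" "Y / l"] 3 assms by simp
    moreover have "(1 - l) *\<^sub>R (X / (1 - l)) + l *\<^sub>R (Y / l) = X + Y" using assms by simp
    moreover have "t * (Z / t) powr p = t powr (1 - p) * Z powr p" if "t > 0" "Z > 0" for t Z :: real
      using that by (simp add: powr_divide powr_diff)
    ultimately show ?thesis using 3 assms by simp
  qed
qed

text \<open>The sum of the coefficients of all terms in which a derivative falls on a cut-off.\<close>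

definition err :: "real \<Rightarrow> nat \<Rightarrow> nat \<Rightarrow> real"
  where "err m n k = 3 * (8 + 4 * m + 2 * real n) + 32 + (44 + 6 * real k)"

text \<open>\<open>X0, X1, X2\<close> and \<open>Y0, Y1, Y2\<close> are the values of the normal and tangential cut-offs and their
  logarithmic derivatives, \<open>\<alpha>\<close> and \<open>\<beta>\<close> the corresponding tents, and \<open>t\<close> is the square of the ratio of normal
  to tangential distance.  Only the term without derivatives of the cut-offs is not small, and its coefficient is
  \<open>C\<close> up to the deviation of the local exponent \<open>\<gamma>\<close> from its limit \<open>\<gamma>0\<close>.\<close>

lemma operator_bound:
  fixes X0 X1 X2 Y0 Y1 Y2 \<alpha> \<beta> \<gamma> \<gamma>0 m t \<epsilon> C :: real and n k :: nat
  assumes X: "0 \<le> X0" "X0 \<le> \<alpha>" "\<bar>X1\<bar> \<le> 3 * \<epsilon> * \<alpha>" "\<bar>X2\<bar> \<le> 8 * \<epsilon> * \<alpha>"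
    and Y: "0 \<le> Y0" "Y0 \<le> \<beta>" "\<bar>Y1\<bar> \<le> 3 * \<beta>" "\<bar>Y2\<bar> \<le> 8 * \<beta>"
    and \<gamma>: "0 \<le> \<gamma>" "\<gamma> \<le> 2" "\<bar>\<gamma> - \<gamma>0\<bar> \<le> \<epsilon>" and t: "0 \<le> t" "t \<le> \<epsilon>" and m: "m > 0"
    and C: "C = m * (\<gamma>0 + real n - 2 - m)" "C \<ge> 0"
  shows "\<bar>2 * \<gamma> * (X1 - m / 2 * X0) * Y0
      + (4 * (X2 - (m + 1) * X1 + m / 2 * (m / 2 + 1) * X0) + 2 * real n * (X1 - m / 2 * X0)) * Y0
      + t * X0 * (4 * (Y2 - Y1) + 2 * real k * Y1)\<bar>
    \<le> (C + m * \<epsilon>) * (X0 * Y0) + err m n k * \<epsilon> * (\<alpha> * \<beta>)"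
proof -
  have e: "\<epsilon> \<ge> 0" using t by simp
  have ab: "\<alpha> \<ge> 0" "\<beta> \<ge> 0" using X Y by linarith+
  have main: "\<bar>- (m * (\<gamma> + real n - 2 - m))\<bar> * (X0 * Y0) \<le> (C + m * \<epsilon>) * (X0 * Y0)"
  proof (rule mult_right_mono)
    have "m * (\<gamma> + real n - 2 - m) = C + m * (\<gamma> - \<gamma>0)" unfolding C by (simp add: algebra_simps)
    moreover have "\<bar>C + m * (\<gamma> - \<gamma>0)\<bar> \<le> \<bar>C\<bar> + m * \<bar>\<gamma> - \<gamma>0\<bar>"
      using m abs_triangle_ineq[of C "m * (\<gamma> - \<gamma>0)"] by (simp add: abs_mult)
    moreover have "m * \<bar>\<gamma> - \<gamma>0\<bar> \<le> m * \<epsilon>" using \<gamma>(3) m by (intro mult_left_mono) auto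
    ultimately show "\<bar>- (m * (\<gamma> + real n - 2 - m))\<bar> \<le> C + m * \<epsilon>" using C(2) by simp
  qed (use X Y in simp)
  have e1: "\<bar>((2 * \<gamma> - 4 * (m + 1) + 2 * real n) * X1 + 4 * X2) * Y0\<bar> \<le> (3 * (8 + 4 * m + 2 * real n) + 32) * \<epsilon> * (\<alpha> * \<beta>)"
  proof -
    have "real n \<ge> 0" by simp
    then have "\<bar>2 * \<gamma> - 4 * (m + 1) + 2 * real n\<bar> \<le> 8 + 4 * m + 2 * real n"
      using \<gamma>(1,2) m by (intro abs_leI) (simp_all add: algebra_simps)
    then have "\<bar>2 * \<gamma> - 4 * (m + 1) + 2 * real n\<bar> * \<bar>X1\<bar> \<le> (8 + 4 * m + 2 * real n) * (3 * \<epsilon> * \<alpha>)"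
      using X(3) m by (intro mult_mono) auto
    moreover have "\<bar>(2 * \<gamma> - 4 * (m + 1) + 2 * real n) * X1 + 4 * X2\<bar> \<le> \<bar>2 * \<gamma> - 4 * (m + 1) + 2 * real n\<bar> * \<bar>X1\<bar> + 4 * \<bar>X2\<bar>"
      using abs_triangle_ineq[of "(2 * \<gamma> - 4 * (m + 1) + 2 * real n) * X1" "4 * X2"] by (simp add: abs_mult)
    ultimately have "\<bar>(2 * \<gamma> - 4 * (m + 1) + 2 * real n) * X1 + 4 * X2\<bar> \<le> (8 + 4 * m + 2 * real n) * (3 * \<epsilon> * \<alpha>) + 4 * (8 * \<epsilon> * \<alpha>)"
      using X(4) by linarith
    then have "\<bar>(2 * \<gamma> - 4 * (m + 1) + 2 * real n) * X1 + 4 * X2\<bar> * \<bar>Y0\<bar> \<le> ((8 + 4 * m + 2 * real n) * (3 * \<epsilon> * \<alpha>) + 4 * (8 * \<epsilon> * \<alpha>)) * \<beta>"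
      using Y m e ab by (intro mult_mono) auto
    also have "\<dots> = (3 * (8 + 4 * m + 2 * real n) + 32) * \<epsilon> * (\<alpha> * \<beta>)" by (simp add: algebra_simps)
    finally show ?thesis by (simp only: abs_mult)
  qed
  have e2: "\<bar>t * X0 * (4 * Y2 + (2 * real k - 4) * Y1)\<bar> \<le> (44 + 6 * real k) * \<epsilon> * (\<alpha> * \<beta>)"
  proof -
    have "\<bar>2 * real k - 4\<bar> * \<bar>Y1\<bar> \<le> (2 * real k + 4) * (3 * \<beta>)" using Y(3) by (intro mult_mono) auto
    moreover have "\<bar>4 * Y2 + (2 * real k - 4) * Y1\<bar> \<le> 4 * \<bar>Y2\<bar> + \<bar>2 * real k - 4\<bar> * \<bar>Y1\<bar>"
      using abs_triangle_ineq[of "4 * Y2" "(2 * real k - 4) * Y1"] by (simp add: abs_mult)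
    ultimately have "\<bar>4 * Y2 + (2 * real k - 4) * Y1\<bar> \<le> (44 + 6 * real k) * \<beta>"
      using Y(4) by (simp add: algebra_simps)
    moreover have "\<bar>t * X0\<bar> \<le> \<epsilon> * \<alpha>" using t X e by (simp add: abs_mult mult_mono)
    ultimately have "\<bar>t * X0\<bar> * \<bar>4 * Y2 + (2 * real k - 4) * Y1\<bar> \<le> (\<epsilon> * \<alpha>) * ((44 + 6 * real k) * \<beta>)"
      using e ab by (intro mult_mono) auto
    also have "\<dots> = (44 + 6 * real k) * \<epsilon> * (\<alpha> * \<beta>)" by (simp add: algebra_simps)
    finally show ?thesis by (simp only: abs_mult)
  qed
  have "2 * \<gamma> * (X1 - m / 2 * X0) * Y0
      + (4 * (X2 - (m + 1) * X1 + m / 2 * (m / 2 + 1) * X0) + 2 * real n * (X1 - m / 2 * X0)) * Y0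
      + t * X0 * (4 * (Y2 - Y1) + 2 * real k * Y1)
    = (- (m * (\<gamma> + real n - 2 - m))) * (X0 * Y0) + ((2 * \<gamma> - 4 * (m + 1) + 2 * real n) * X1 + 4 * X2) * Y0
      + t * X0 * (4 * Y2 + (2 * real k - 4) * Y1)" (is "?l = ?A + ?B + ?D")
    by (simp add: algebra_simps)
  moreover have "\<bar>?A\<bar> \<le> (C + m * \<epsilon>) * (X0 * Y0)"
    using main X Y unfolding abs_mult by simp
  moreover have tri: "\<bar>A + B + D\<bar> \<le> a + b + d" if "\<bar>A\<bar> \<le> a" "\<bar>B\<bar> \<le> b" "\<bar>D\<bar> \<le> d" for A B D a b d :: real
    using that by linarith
  ultimately have "\<bar>?l\<bar> \<le> (C + m * \<epsilon>) * (X0 * Y0) + (3 * (8 + 4 * m + 2 * real n) + 32) * \<epsilon> * (\<alpha> * \<beta>)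
      + (44 + 6 * real k) * \<epsilon> * (\<alpha> * \<beta>)"
    using e1 e2 by (simp only: tri)
  then show ?thesis unfolding err_def by (simp add: algebra_simps)
qed

text \<open>The integral of the error profile divided by that of the main profile, in the normal times the
  tangential direction.  The exponential weight is the volume element \<open>r\<^sup>k\<^sup>/\<^sup>2\<close> of the tangential
  variable in terms of \<open>ln r\<close>.  What matters is that no scale enters.\<close>

definition tent_ratio :: "real \<Rightarrow> nat \<Rightarrow> real"
  where "tent_ratio p k =
    integral {0..1} (\<lambda>t. tent t powr p) / integral {0..1} (\<lambda>t. bump t powr p)
    * (integral {0..1} (\<lambda>t. exp (real k / 2 * t) * tent t powr p)
       / integral {0..1} (\<lambda>t. exp (real k / 2 * t) * bump t powr p))"

text \<open>The bound for the Rellich quotient of the test function: \<open>\<epsilon>\<close> measures the distance to the limiting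
  regime, \<open>l\<close> the weight in the convexity estimate.\<close>

definition test_bound :: "real \<Rightarrow> real \<Rightarrow> real \<Rightarrow> nat \<Rightarrow> nat \<Rightarrow> real \<Rightarrow> real \<Rightarrow> real"
  where "test_bound p C m n k l \<epsilon> =
    ((1 + \<epsilon>) / (1 - \<epsilon>)) powr p
      * ((1 - l) powr (1 - p) * (C + m * \<epsilon>) powr p + l powr (1 - p) * (err m n k * \<epsilon>) powr p * tent_ratio p k)"

lemma pull_pos: "q > 0 \<Longrightarrow> pull s h q = q powr s * h (ln q)"
  unfolding pull_def by simp

text \<open>With \<open>q = \<bar>z\<bar>\<^sup>2\<close> and \<open>r = \<bar>y\<bar>\<^sup>2\<close>, the test function lives on \<open>ln q \<in> [S0, S0 + N]\<close> and
  \<open>ln r \<in> [V, V + 1]\<close>.  Large \<open>N\<close> makes the normal cut-off vary slowly, \<open>exp (S0 + N) \<le> \<epsilon> exp V\<close> makes the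
  tangential derivatives negligible, \<open>exp (V + 1) < R\<close> keeps the support above the flat part of \<open>K\<close>, and the last
  hypothesis says that the coefficient is nearly a power with exponent \<open>\<gamma>0\<close> on the support.\<close>

context
  fixes K :: "'a::euclidean_space set" and a :: 'a and B1 B2 :: "'a set"
    and p m \<gamma>0 \<delta> \<delta>' \<epsilon> l S0 N V R C :: real and n k :: nat
  assumes K: "closed K" "convex K" "K \<noteq> {}"
    and B: "orthonormal B1" "orthonormal B2" "\<And>e e'. e \<in> B1 \<Longrightarrow> e' \<in> B2 \<Longrightarrow> e \<bullet> e' = 0"
    and total: "\<And>v :: 'a. v \<bullet> v = sqn B1 v + sqn B2 v"
    and card: "card B1 = k" "card B2 = n" "0 < k" "0 < n"
    and flat: "\<And>x. sqn B1 (x - a) < R \<Longrightarrow> infdist x K = sqrt (sqn B2 (x - a))"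
    and p: "p > 1" and m: "m > 0" "real n = (m + 2 - \<gamma>0) * p" and C: "C = m * (\<gamma>0 + real n - 2 - m)" "C \<ge> 0"
    and \<delta>: "0 \<le> \<delta>" "\<delta> < 2" "0 \<le> \<delta>'" "\<delta>' < 2"
    and eps: "0 < \<epsilon>" "\<epsilon> < 1" and l: "0 < l" "l < 1"
    and N: "N \<ge> 1" "1 \<le> \<epsilon> * N" and V: "exp (S0 + N) \<le> \<epsilon> * exp V" "exp (V + 1) < R"
    and asym: "\<And>s. s > 0 \<Longrightarrow> S0 \<le> 2 * ln s \<Longrightarrow> 2 * ln s \<le> S0 + N \<Longrightarrow>
        \<bar>degen_exponent \<delta> \<delta>' s - \<gamma>0\<bar> \<le> \<epsilon> \<and> (1 - \<epsilon>) * s powr \<gamma>0 \<le> degen_coeff \<delta> \<delta>' s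
        \<and> degen_coeff \<delta> \<delta>' s \<le> (1 + \<epsilon>) * s powr \<gamma>0"
begin

private abbreviation "z x \<equiv> pr B2 (x - a)"
private abbreviation "r x \<equiv> sqn B1 (x - a)"
private abbreviation "q x \<equiv> sqn B2 (x - a)"
private abbreviation "cK \<equiv> (\<lambda>x. degen_coeff \<delta> \<delta>' (infdist x K))"
private abbreviation "tu u \<equiv> (u - S0) / N"

private definition "X0 = (\<lambda>u. bump (tu u))"
private definition "X1 = (\<lambda>u. bump' (tu u) / N)"
private definition "X2 = (\<lambda>u. bump'' (tu u) / N / N)"
private definition "Y0 = (\<lambda>v. bump (v - V))"
private definition "Y1 = (\<lambda>v. bump' (v - V))"
private definition "Y2 = (\<lambda>v. bump'' (v - V))"
private definition "s = - m / 2"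
private definition "G1 = pull s X0"
private definition "G1' = pull (s - 1) (\<lambda>u. X1 u + s * X0 u)"
private definition "G1'' = pull (s - 1 - 1) (\<lambda>u. (X2 u + s * X1 u) + (s - 1) * (X1 u + s * X0 u))"
private definition "G2 = pull 0 Y0"
private definition "G2' = pull (0 - 1) (\<lambda>u. Y1 u + 0 * Y0 u)"
private definition "G2'' = pull (0 - 1 - 1) (\<lambda>u. (Y2 u + 0 * Y1 u) + (0 - 1) * (Y1 u + 0 * Y0 u))"

private abbreviation "\<phi> \<equiv> (\<lambda>x. G1 (q x) * G2 (r x))"

private definition "T0 = {x. q x \<in> {exp S0..exp (S0 + N)} \<and> r x \<in> {exp V..exp (V + 1)}}"

private lemma Npos: "N > 0" using N by simp

private lemma tu_out: "u \<notin> {S0..S0 + N} \<Longrightarrow> tu u \<notin> {0..1}"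
  using Npos by (auto simp: field_simps)

private lemma X_out: "u \<notin> {S0..S0 + N} \<Longrightarrow> X0 u = 0" "u \<notin> {S0..S0 + N} \<Longrightarrow> X1 u = 0" "u \<notin> {S0..S0 + N} \<Longrightarrow> X2 u = 0"
  using bump_zero tu_out unfolding X0_def X1_def X2_def by simp_all

private lemma Y_out: "v \<notin> {V..V + 1} \<Longrightarrow> Y0 v = 0" "v \<notin> {V..V + 1} \<Longrightarrow> Y1 v = 0" "v \<notin> {V..V + 1} \<Longrightarrow> Y2 v = 0"
  using bump_zero[of "v - V"] unfolding Y0_def Y1_def Y2_def by auto

private lemma X_deriv: "(X0 has_real_derivative X1 u) (at u)" "(X1 has_real_derivative X2 u) (at u)"
proof -
  have L: "((\<lambda>u. tu u) has_real_derivative 1 / N) (at u)"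
    by (rule DERIV_cdivide) (auto intro!: derivative_eq_intros)
  show "(X0 has_real_derivative X1 u) (at u)"
    using DERIV_chain2[OF DERIV_bump L] unfolding X0_def X1_def by simp
  have "((\<lambda>u. bump' (tu u)) has_real_derivative bump'' (tu u) * (1 / N)) (at u)"
    by (rule DERIV_chain2[OF DERIV_bump' L])
  from DERIV_cdivide[OF this, of N] show "(X1 has_real_derivative X2 u) (at u)"
    unfolding X1_def X2_def by simp
qed

private lemma Y_deriv: "(Y0 has_real_derivative Y1 u) (at u)" "(Y1 has_real_derivative Y2 u) (at u)"
proof -
  have L: "((\<lambda>u. u - V) has_real_derivative 1) (at u)"
    by (auto intro!: derivative_eq_intros)
  show "(Y0 has_real_derivative Y1 u) (at u)"
    using DERIV_chain2[OF DERIV_bump L] unfolding Y0_def Y1_def by simp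
  show "(Y1 has_real_derivative Y2 u) (at u)"
    using DERIV_chain2[OF DERIV_bump' L] unfolding Y1_def Y2_def by simp
qed

private lemma cont_X: "continuous_on S X0" "continuous_on S X1" "continuous_on S X2"
proof -
  show "continuous_on S X0" "continuous_on S X1"
    by (meson X_deriv DERIV_isCont continuous_at_imp_continuous_on)+
  have "continuous_on S (\<lambda>u. bump'' (tu u))"
    by (rule continuous_on_compose2[OF continuous_on_bump''[of UNIV]]) (use Npos in \<open>auto intro!: continuous_intros\<close>)
  then show "continuous_on S X2" unfolding X2_def by (intro continuous_intros) (use Npos in auto)
qed

private lemma cont_Y: "continuous_on S Y0" "continuous_on S Y1" "continuous_on S Y2"
proof -
  show "continuous_on S Y0" "continuous_on S Y1"
    by (meson Y_deriv DERIV_isCont continuous_at_imp_continuous_on)+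
  show "continuous_on S Y2" unfolding Y2_def
    by (rule continuous_on_compose2[OF continuous_on_bump''[of UNIV]]) (auto intro!: continuous_intros)
qed

private lemma G1_deriv: "(G1 has_real_derivative G1' t) (at t)" "(G1' has_real_derivative G1'' t) (at t)"
proof -
  have lo: "X0 u = 0" "X1 u + s * X0 u = 0" if "u < S0" for u using X_out[of u] that by auto
  show "(G1 has_real_derivative G1' t) (at t)"
    unfolding G1_def G1'_def by (rule DERIV_pull[OF X_deriv(1) lo(1)])
  have "((\<lambda>u. X1 u + s * X0 u) has_real_derivative X2 u + s * X1 u) (at u)" for u
    by (intro DERIV_add X_deriv DERIV_cmult)
  then show "(G1' has_real_derivative G1'' t) (at t)"
    unfolding G1'_def G1''_def by (rule DERIV_pull[OF _ lo(2)])
qed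

private lemma G2_deriv: "(G2 has_real_derivative G2' t) (at t)" "(G2' has_real_derivative G2'' t) (at t)"
proof -
  have lo: "Y0 u = 0" "Y1 u + 0 * Y0 u = 0" if "u < V" for u using Y_out[of u] that by auto
  show "(G2 has_real_derivative G2' t) (at t)"
    unfolding G2_def G2'_def by (rule DERIV_pull[OF Y_deriv(1) lo(1)])
  have "((\<lambda>u. Y1 u + 0 * Y0 u) has_real_derivative Y2 u + 0 * Y1 u) (at u)" for u
    by (intro DERIV_add Y_deriv DERIV_cmult)
  then show "(G2' has_real_derivative G2'' t) (at t)"
    unfolding G2'_def G2''_def by (rule DERIV_pull[OF _ lo(2)])
qed

private lemma cont_G'': "continuous_on UNIV G1''" "continuous_on UNIV G2''"
proof -
  show "continuous_on UNIV G1''" unfolding G1''_def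
    by (rule continuous_on_pull[of _ S0]) (use X_out in \<open>auto intro!: continuous_intros cont_X\<close>)
  show "continuous_on UNIV G2''" unfolding G2''_def
    by (rule continuous_on_pull[of _ V]) (use Y_out in \<open>auto intro!: continuous_intros cont_Y\<close>)
qed

private lemma pull_out: "t \<notin> {exp lo..exp hi} \<Longrightarrow> (\<And>u. u \<notin> {lo..hi} \<Longrightarrow> h u = 0) \<Longrightarrow> pull e h t = 0"
proof (cases "t > 0")
  case True
  assume t: "t \<notin> {exp lo..exp hi}" and h: "\<And>u. u \<notin> {lo..hi} \<Longrightarrow> h u = 0"
  have "ln t \<notin> {lo..hi}"
  proof
    assume "ln t \<in> {lo..hi}"
    then have "exp (ln t) \<in> {exp lo..exp hi}" by auto
    then show False using t True by simp
  qed
  then show ?thesis using h unfolding pull_def by simp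
qed (simp add: pull_def)

private lemma phi_out: "x \<notin> T0 \<Longrightarrow> \<phi> x = 0"
proof -
  assume "x \<notin> T0"
  then consider "q x \<notin> {exp S0..exp (S0 + N)}" | "r x \<notin> {exp V..exp (V + 1)}" unfolding T0_def by blast
  then show ?thesis
  proof cases
    case 1
    have "G1 (q x) = 0" unfolding G1_def by (rule pull_out[OF 1 X_out(1)])
    then show ?thesis by simp
  next
    case 2
    have "G2 (r x) = 0" unfolding G2_def by (rule pull_out[OF 2 Y_out(1)])
    then show ?thesis by simp
  qed
qed

private lemma closed_T0: "closed T0"
proof -
  have "closed ((\<lambda>x. q x) -` {exp S0..exp (S0 + N)})" "closed ((\<lambda>x. r x) -` {exp V..exp (V + 1)})"
    by (auto intro!: continuous_closed_vimage has_derivative_continuous[OF has_derivative_sqn])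
  then have "closed ((\<lambda>x. q x) -` {exp S0..exp (S0 + N)} \<inter> (\<lambda>x. r x) -` {exp V..exp (V + 1)})" by (rule closed_Int)
  moreover have "(\<lambda>x. q x) -` {exp S0..exp (S0 + N)} \<inter> (\<lambda>x. r x) -` {exp V..exp (V + 1)} = T0"
    unfolding T0_def by auto
  ultimately show ?thesis by simp
qed

private definition "TT = cball a (sqrt (exp (S0 + N) + exp (V + 1)))"

private lemma in_TT: "x \<notin> TT \<Longrightarrow> q x \<le> exp (S0 + N) \<Longrightarrow> r x > exp (V + 1)"
proof -
  assume "x \<notin> TT" and q: "q x \<le> exp (S0 + N)"
  then have "sqrt (exp (S0 + N) + exp (V + 1)) < norm (x - a)"
    unfolding TT_def by (simp add: dist_norm norm_minus_commute)
  then have "(sqrt (exp (S0 + N) + exp (V + 1)))\<^sup>2 < (norm (x - a))\<^sup>2"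
    by (intro power_strict_mono) auto
  then have "exp (S0 + N) + exp (V + 1) < r x + q x"
    unfolding power2_norm_eq_inner total by (simp add: add_pos_pos less_imp_le)
  with q show ?thesis by simp
qed

private lemma T0_subset: "T0 \<subseteq> TT" using in_TT unfolding T0_def by force

private lemma compact_T0: "compact T0"
proof -
  have "bounded T0" using T0_subset unfolding TT_def by (rule bounded_subset[OF bounded_cball])
  then show ?thesis using closed_T0 by (simp add: compact_eq_bounded_closed)
qed

private lemma T0_facts:
  assumes "x \<in> T0"
  shows "q x > 0" "r x > 0" "r x < R" "infdist x K = sqrt (q x)" "x \<in> - K" "q x / r x \<le> \<epsilon>"
proof -
  have q: "exp S0 \<le> q x" "q x \<le> exp (S0 + N)" and r: "exp V \<le> r x" "r x \<le> exp (V + 1)"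
    using assms unfolding T0_def by auto
  show qp: "q x > 0" using q(1) exp_gt_zero[of S0] by linarith
  show rp: "r x > 0" using r(1) exp_gt_zero[of V] by linarith
  show rR: "r x < R" using r(2) V(2) by linarith
  show d: "infdist x K = sqrt (q x)" by (rule flat[OF rR])
  have "infdist x K > 0" using qp unfolding d by simp
  then show "x \<in> - K" using infdist_zero[of x K] by auto
  have "q x \<le> \<epsilon> * r x"
    using q(2) V(1) mult_left_mono[OF r(1), of \<epsilon>] eps by linarith
  then show "q x / r x \<le> \<epsilon>" using rp by (simp add: pos_divide_le_eq)
qed

private lemma phi_Cc2: "\<phi> \<in> Cc2 (- K)"
proof -
  have sub: "closure {x. \<phi> x \<noteq> 0} \<subseteq> T0"
    by (rule closure_minimal) (use phi_out closed_T0 in auto)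
  have "compact (closure {x. \<phi> x \<noteq> 0})"
    using compact_Int_closed[OF compact_T0 closed_closure, of "{x. \<phi> x \<noteq> 0}"] sub by (simp add: Int_absorb1)
  moreover have "closure {x. \<phi> x \<noteq> 0} \<subseteq> - K" using sub T0_facts(5) by blast
  moreover have "C2_on (- K) \<phi>"
    by (rule C2_on_product_test[OF G1_deriv cont_G''(1) G2_deriv cont_G''(2)])
  ultimately show ?thesis unfolding Cc2_def by simp
qed

private lemma phi_nonzero: "\<phi> \<noteq> (\<lambda>_. 0)"
proof -
  obtain e1 e2 where e: "e1 \<in> B1" "e2 \<in> B2" using card by (metis card.empty ex_in_conv less_numeral_extra(3))
  define x where "x = a + exp ((V + 1 / 2) / 2) *\<^sub>R e1 + exp ((S0 + N / 2) / 2) *\<^sub>R e2"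
  have sq: "sqn B (\<alpha> *\<^sub>R e + \<beta> *\<^sub>R e') = \<alpha>\<^sup>2" if "orthonormal B" "e \<in> B" "\<And>b. b \<in> B \<Longrightarrow> e' \<bullet> b = 0" for B :: "'a set" and e e' \<alpha> \<beta>
  proof -
    have "sqn B (\<alpha> *\<^sub>R e + \<beta> *\<^sub>R e') = (\<Sum>b\<in>B. (\<alpha> * (if e = b then 1 else 0))\<^sup>2)"
      unfolding sqn_def using that unfolding orthonormal_def by (intro sum.cong) (auto simp: inner_add_left)
    also have "\<dots> = \<alpha>\<^sup>2"
      using that unfolding orthonormal_def by (subst sum.remove[of B e]) (auto intro!: sum.neutral split: if_splits)
    finally show ?thesis .
  qed
  have "r x = (exp ((V + 1 / 2) / 2))\<^sup>2"
    using sq[OF B(1) e(1), of e2] B(3) e unfolding x_def by (simp add: inner_commute)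
  then have r: "r x = exp (V + 1 / 2)" by (simp add: power2_eq_square flip: exp_add)
  have "q x = sqn B2 (exp ((S0 + N / 2) / 2) *\<^sub>R e2 + exp ((V + 1 / 2) / 2) *\<^sub>R e1)" unfolding x_def by (simp add: add.commute)
  also have "\<dots> = (exp ((S0 + N / 2) / 2))\<^sup>2"
    using sq[OF B(2) e(2), of e1] B(3) e by simp
  finally have q: "q x = exp (S0 + N / 2)" by (simp add: power2_eq_square flip: exp_add)
  have "\<phi> x = exp (S0 + N / 2) powr s * bump (1 / 2) * bump (1 / 2)"
    unfolding G1_def G2_def pull_def X0_def Y0_def q r using Npos by simp
  moreover have "bump (1 / 2) > 0" unfolding bump_def tent_def by simp
  ultimately have "\<phi> x \<noteq> 0" by simp
  then show ?thesis by metis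
qed

private lemma c_deriv_T0:
  assumes "x \<in> T0"
  shows "(cK has_derivative (\<lambda>h. ((degen_exponent \<delta> \<delta>' (sqrt (q x)) * cK x / q x) *\<^sub>R z x) \<bullet> h)) (at x)"
proof -
  have qp: "q x > 0" and rR: "r x < R" using T0_facts[OF assms] by auto
  define A where "A = (\<lambda>t. degen_coeff \<delta> \<delta>' (sqrt t))"
  have "(A has_real_derivative degen_exponent \<delta> \<delta>' (sqrt (q x)) * degen_coeff \<delta> \<delta>' (sqrt (q x)) / sqrt (q x) * (inverse (sqrt (q x)) / 2)) (at (q x))"
    unfolding A_def by (rule DERIV_chain2[OF DERIV_degen_coeff DERIV_real_sqrt]) (use qp in auto)
  from has_derivative_profile[OF this]
  have "((\<lambda>x. A (q x)) has_derivative (\<lambda>h. ((degen_exponent \<delta> \<delta>' (sqrt (q x)) * cK x / q x) *\<^sub>R z x) \<bullet> h)) (at x)"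
    unfolding T0_facts(4)[OF assms]
    by (rule has_derivative_eq_rhs) (use qp in \<open>auto simp: field_simps\<close>)
  moreover have "open {x. r x < R}"
    using open_Collect_less[of "\<lambda>x. r x" "\<lambda>_. R"] continuous_on_sqn by auto
  ultimately show ?thesis
    by (rule has_derivative_transform_within_open) (use rR flat in \<open>auto simp: A_def\<close>)
qed

private lemma H_out: "x \<notin> T0 \<Longrightarrow> div_op cK \<phi> x = 0"
  by (rule div_op_zero_outside_support[OF closed_T0]) (use phi_out in auto)

text \<open>On the support \<open>H\<phi>\<close> is the operator of the one-variable profiles, with \<open>q / r\<close> measuring
  the size of the contribution along \<open>K\<close>.\<close>

private lemma H_formula:
  assumes x: "x \<in> T0"
  defines "u \<equiv> ln (q x)" and "v \<equiv> ln (r x)" and "\<gamma> \<equiv> degen_exponent \<delta> \<delta>' (sqrt (q x))"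
  shows "div_op cK \<phi> x = - (cK x * q x powr (s - 1) *
    (2 * \<gamma> * (X1 u - m / 2 * X0 u) * Y0 v
      + (4 * (X2 u - (m + 1) * X1 u + m / 2 * (m / 2 + 1) * X0 u) + 2 * real n * (X1 u - m / 2 * X0 u)) * Y0 v
      + q x / r x * X0 u * (4 * (Y2 v - Y1 v) + 2 * real k * Y1 v)))"
proof -
  have qp: "q x > 0" and rp: "r x > 0" using T0_facts[OF x] by auto
  define E where "E = q x powr (s - 1)"
  have G1: "G1 (q x) = E * q x * X0 u" "G1' (q x) = E * (X1 u + s * X0 u)"
    "G1'' (q x) = E / q x * ((X2 u + s * X1 u) + (s - 1) * (X1 u + s * X0 u))"
    unfolding G1_def G1'_def G1''_def E_def u_def pull_pos[OF qp]
    using qp powr_diff[of "q x" s 1] powr_diff[of "q x" "s - 1" 1] by simp_all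
  have G2: "G2 (r x) = Y0 v" "G2' (r x) = Y1 v / r x" "G2'' (r x) = (Y2 v - Y1 v) / r x / r x"
    unfolding G2_def G2'_def G2''_def v_def pull_pos[OF rp]
    using rp powr_diff[of "r x" "-1" 1] by (simp_all add: powr_minus_divide)
  have "div_op cK \<phi> x = - (\<gamma> * cK x / q x * (2 * G1' (q x) * G2 (r x) * q x)
     + cK x * ((4 * q x * G1'' (q x) + 2 * card B2 * G1' (q x)) * G2 (r x)
            + G1 (q x) * (4 * r x * G2'' (r x) + 2 * card B1 * G2' (r x))))"
    unfolding \<gamma>_def
    by (rule div_op_product_test[OF G1_deriv cont_G''(1) G2_deriv cont_G''(2) B c_deriv_T0[OF x]])
  also have "\<dots> = - (cK x * E *
    (2 * \<gamma> * (X1 u + s * X0 u) * Y0 v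
      + (4 * ((X2 u + s * X1 u) + (s - 1) * (X1 u + s * X0 u)) + 2 * real n * (X1 u + s * X0 u)) * Y0 v
      + q x / r x * X0 u * (4 * (Y2 v - Y1 v) + 2 * real k * Y1 v)))"
  proof -
    have "\<gamma> * cK x / q x * (2 * G1' (q x) * G2 (r x) * q x) = cK x * E * (2 * \<gamma> * (X1 u + s * X0 u) * Y0 v)"
      unfolding G1 G2 using qp by simp
    moreover have "cK x * ((4 * q x * G1'' (q x) + 2 * card B2 * G1' (q x)) * G2 (r x))
       = cK x * E * ((4 * ((X2 u + s * X1 u) + (s - 1) * (X1 u + s * X0 u)) + 2 * real n * (X1 u + s * X0 u)) * Y0 v)"
      unfolding G1 G2 card(2) using qp by (simp add: algebra_simps)
    moreover have "4 * r x * G2'' (r x) + 2 * card B1 * G2' (r x) = (4 * (Y2 v - Y1 v) + 2 * real k * Y1 v) / r x"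
      unfolding G2 card(1) using rp by (simp add: field_simps)
    then have "cK x * (G1 (q x) * (4 * r x * G2'' (r x) + 2 * card B1 * G2' (r x)))
       = cK x * E * (q x / r x * X0 u * (4 * (Y2 v - Y1 v) + 2 * real k * Y1 v))"
      unfolding G1 by simp
    ultimately show ?thesis by (simp only: distrib_left)
  qed
  also have "X1 u + s * X0 u = X1 u - m / 2 * X0 u" unfolding s_def by simp
  also have "(X2 u + s * X1 u) + (s - 1) * (X1 u - m / 2 * X0 u) = X2 u - (m + 1) * X1 u + m / 2 * (m / 2 + 1) * X0 u"
    unfolding s_def by (simp add: field_simps)
  finally show ?thesis unfolding E_def .
qed

text \<open>Main (index 1) and error (index 2) profiles; \<open>J A E\<close> is the density \<open>\<bar>z\<bar>\<^sup>-\<^sup>n \<bar>y\<bar>\<^sup>-\<^sup>k\<close> times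
  functions of the logarithms, to which the proportionality applies in \<open>z\<close> and in \<open>y\<close>.\<close>

private definition "A1 = (\<lambda>t. bump t powr p)"
private definition "A2 = (\<lambda>t. tent t powr p)"
private definition "E1 = (\<lambda>t. exp (real k / 2 * t) * bump t powr p)"
private definition "E2 = (\<lambda>t. exp (real k / 2 * t) * tent t powr p)"
private definition "J A E = (\<lambda>x. pull (- real n / 2) (\<lambda>u. A (tu u)) (q x) * pull (- real k / 2) (\<lambda>v. E ((v - V) / 1)) (r x))"

private lemma AE_props: "continuous_on S A1" "continuous_on S A2" "continuous_on S E1" "continuous_on S E2"
  "t \<notin> {0..1} \<Longrightarrow> A1 t = 0" "t \<notin> {0..1} \<Longrightarrow> A2 t = 0" "t \<notin> {0..1} \<Longrightarrow> E1 t = 0" "t \<notin> {0..1} \<Longrightarrow> E2 t = 0"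
  "A1 t \<ge> 0" "A2 t \<ge> 0" "E1 t \<ge> 0" "E2 t \<ge> 0"
proof -
  have cb: "continuous_on S bump" by (meson DERIV_bump DERIV_isCont continuous_at_imp_continuous_on)
  have ct: "continuous_on S tent" using continuous_on_tent[OF continuous_on_id] by simp
  show c1: "continuous_on S A1" unfolding A1_def
    by (rule continuous_on_powr') (use p bump_bounds(1) in \<open>auto intro!: cb continuous_intros\<close>)
  show c2: "continuous_on S A2" unfolding A2_def
    by (rule continuous_on_powr') (use p tent_nonneg in \<open>auto intro!: ct continuous_intros\<close>)
  show "continuous_on S E1" "continuous_on S E2"
    using c1 c2 unfolding E1_def E2_def A1_def A2_def by (auto intro!: continuous_on_mult continuous_intros)
  show "t \<notin> {0..1} \<Longrightarrow> A1 t = 0" "t \<notin> {0..1} \<Longrightarrow> E1 t = 0" unfolding A1_def E1_def using bump_zero(1)[of t] by simp_all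
  show "t \<notin> {0..1} \<Longrightarrow> A2 t = 0" "t \<notin> {0..1} \<Longrightarrow> E2 t = 0" unfolding A2_def E2_def using tent_zero[of t] by simp_all
  show "A1 t \<ge> 0" "A2 t \<ge> 0" "E1 t \<ge> 0" "E2 t \<ge> 0" unfolding A1_def A2_def E1_def E2_def by auto
qed

private lemma I_pos: "integral {0..1} A1 > 0" "integral {0..1} A2 > 0" "integral {0..1} E1 > 0" "integral {0..1} E2 > 0"
proof -
  have b: "bump t powr p = tent t powr (3 * p)" for t
    unfolding bump_def using tent_nonneg[of t] p by (cases "tent t = 0") (auto simp: powr_powr simp flip: powr_numeral)
  have ce: "continuous_on {0..1} (\<lambda>t. exp (real k / 2 * t))" by (intro continuous_intros)
  show "integral {0..1} A1 > 0" "integral {0..1} A2 > 0" "integral {0..1} E1 > 0" "integral {0..1} E2 > 0"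
    unfolding A1_def A2_def E1_def E2_def b
    using integral_tent_powr_pos[of "3 * p" "\<lambda>_. 1"] integral_tent_powr_pos[of p "\<lambda>_. 1"]
      integral_tent_powr_pos[OF _ ce, of "3 * p"] integral_tent_powr_pos[OF _ ce, of p] p
    by simp_all
qed

private lemma cont_W:
  fixes A :: "real \<Rightarrow> real" and B :: "'a set" and M L :: real
  assumes A: "continuous_on UNIV A" "\<And>t. t \<notin> {0..1} \<Longrightarrow> A t = 0" and M: "M > 0"
  shows "continuous_on UNIV (\<lambda>x. pull e (\<lambda>u. A ((u - L) / M)) (sqn B (x - a)))"
proof -
  have "continuous_on UNIV (\<lambda>u. A ((u - L) / M))"
    by (rule continuous_on_compose2[OF A(1)]) (use M in \<open>auto intro!: continuous_intros\<close>)
  moreover have "A ((u - L) / M) = 0" if "u < L" for u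
    using that M by (intro A(2)) (auto simp: divide_less_0_iff not_le)
  ultimately have "continuous_on UNIV (pull e (\<lambda>u. A ((u - L) / M)))" by (rule continuous_on_pull)
  then show ?thesis by (rule continuous_on_compose2[OF _ continuous_on_sqn]) auto
qed

private lemma J_out:
  assumes "\<And>t. t \<notin> {0..1} \<Longrightarrow> A t = 0" "\<And>t. t \<notin> {0..1} \<Longrightarrow> E t = 0" "x \<notin> T0"
  shows "J A E x = 0"
proof -
  consider "q x \<notin> {exp S0..exp (S0 + N)}" | "r x \<notin> {exp V..exp (V + 1)}" using assms(3) unfolding T0_def by blast
  then show ?thesis
  proof cases
    case 1
    have "pull (- real n / 2) (\<lambda>u. A (tu u)) (q x) = 0"
      by (rule pull_out[OF 1]) (rule assms(1)[OF tu_out])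
    then show ?thesis unfolding J_def by simp
  next
    case 2
    have "pull (- real k / 2) (\<lambda>v. E ((v - V) / 1)) (r x) = 0"
      by (rule pull_out[OF 2]) (rule assms(2), auto)
    then show ?thesis unfolding J_def by simp
  qed
qed

private lemma J_integrable:
  assumes "continuous_on UNIV A" "\<And>t. t \<notin> {0..1} \<Longrightarrow> A t = 0" "continuous_on UNIV E" "\<And>t. t \<notin> {0..1} \<Longrightarrow> E t = 0"
  shows "integrable lborel (J A E)"
proof (rule integrable_compact_support[OF _ compact_T0])
  show "continuous_on UNIV (J A E)" unfolding J_def
    by (intro continuous_on_mult cont_W assms) (use Npos in auto)
qed (rule J_out[OF assms(2,4)])

text \<open>Change the normal profile with the tangential one fixed, and then the other way round.\<close>

private lemma J_ratio: "(\<integral>x. J A2 E2 x \<partial>lborel) = tent_ratio p k * (\<integral>x. J A1 E1 x \<partial>lborel)"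
proof -
  have sh: "sqn B (x + t *\<^sub>R e - a) = sqn B (x - a)" if "\<And>b. b \<in> B \<Longrightarrow> e \<bullet> b = 0" for B e x t
    unfolding sqn_def using that by (intro sum.cong refl) (simp add: inner_add_left inner_diff_left)
  have E2out: "pull (- real k / 2) (\<lambda>v. E2 ((v - V) / 1)) (r x) = 0" if "x \<notin> TT" "q x \<le> exp (S0 + N)" for x
    by (rule pull_out[of _ V "V + 1"]) (use in_TT[OF that] AE_props(8) in auto)
  have A1out: "pull (- real n / 2) (\<lambda>u. A1 (tu u)) (q x) = 0" if "x \<notin> TT" "r x \<le> exp (V + 1)" for x
    by (rule pull_out[of _ S0 "S0 + N"]) (use in_TT[OF that(1)] that(2) AE_props(5) tu_out in force)+
  have inv1: "pull (- real k / 2) (\<lambda>v. E2 ((v - V) / 1)) (r (x + t *\<^sub>R e)) = pull (- real k / 2) (\<lambda>v. E2 ((v - V) / 1)) (r x)"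
    if "e \<in> B2" for x e t
  proof -
    have "r (x + t *\<^sub>R e) = r x"
      by (rule sh) (metis B(3) inner_commute that)
    then show ?thesis by simp
  qed
  have inv2: "pull (- real n / 2) (\<lambda>u. A1 (tu u)) (q (x + t *\<^sub>R e)) = pull (- real n / 2) (\<lambda>u. A1 (tu u)) (q x)"
    if "e \<in> B1" for x e t
  proof -
    have "q (x + t *\<^sub>R e) = q x" by (rule sh) (rule B(3)[OF that])
    then show ?thesis by simp
  qed
  have cTT: "compact TT" unfolding TT_def by simp
  have 1: "(\<integral>x. J A2 E2 x \<partial>lborel) * integral {0..1} A1 = (\<integral>x. J A1 E2 x \<partial>lborel) * integral {0..1} A2"
    unfolding J_def
    by (rule integral_log_radial_proportional[OF B(2), unfolded card(2), OF Npos AE_props(2,1,6,5)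
          cont_W[OF AE_props(4,8) zero_less_one] inv1 cTT E2out])
  have "(\<integral>x. J A1 E2 x \<partial>lborel) * integral {0..1} E1 = (\<integral>x. J A1 E1 x \<partial>lborel) * integral {0..1} E2"
    unfolding J_def mult.commute[of "pull (- real n / 2) _ _"]
    by (rule integral_log_radial_proportional[OF B(1), unfolded card(1), OF zero_less_one AE_props(4,3,8,7)
          cont_W[OF AE_props(1,5) Npos] inv2 cTT A1out])
  then have "(\<integral>x. J A1 E2 x \<partial>lborel) = integral {0..1} E2 / integral {0..1} E1 * (\<integral>x. J A1 E1 x \<partial>lborel)"
    using I_pos by (simp add: field_simps)
  moreover have "(\<integral>x. J A2 E2 x \<partial>lborel) = integral {0..1} A2 / integral {0..1} A1 * (\<integral>x. J A1 E2 x \<partial>lborel)"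
    using 1 I_pos by (simp add: field_simps)
  ultimately show ?thesis
    unfolding tent_ratio_def A1_def[symmetric] A2_def[symmetric] E1_def[symmetric] E2_def[symmetric]
    by simp
qed

private lemma T0_ranges:
  assumes "x \<in> T0"
  shows "ln (q x) \<in> {S0..S0 + N}" "ln (r x) \<in> {V..V + 1}"
  using assms T0_facts(1,2)[OF assms] unfolding T0_def
  by (auto simp: ln_ge_iff intro: ln_le_cancel_iff[of _ "exp _", simplified, THEN iffD2])

private lemma J_T0:
  assumes x: "x \<in> T0"
  shows "exp (k * V / 2) * J A1 E1 x = q x powr (- real n / 2) * (X0 (ln (q x)) powr p * Y0 (ln (r x)) powr p)"
    and "exp (k * V / 2) * J A2 E2 x = q x powr (- real n / 2) * (tent (tu (ln (q x))) powr p * tent (ln (r x) - V) powr p)"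
proof -
  have qp: "q x > 0" and rp: "r x > 0" using T0_facts[OF x] by auto
  have one: "exp (k * V / 2) * (r x powr (- real k / 2) * exp (real k / 2 * ((ln (r x) - V) / 1))) = 1"
    using rp unfolding powr_def by (simp flip: exp_add) (simp add: field_simps)
  have *: "exp (k * V / 2) * (w1 * w2 * (r x powr (- real k / 2) * (exp (real k / 2 * ((ln (r x) - V) / 1)) * w3))) = w1 * (w2 * w3)" for w1 w2 w3
  proof -
    have "z * (w1 * w2 * (b * (e * w3))) = (z * (b * e)) * (w1 * (w2 * w3))" for z b e :: real
      by (simp only: mult_ac)
    then show ?thesis unfolding one by (simp only: one mult_1)
  qed
  show "exp (k * V / 2) * J A1 E1 x = q x powr (- real n / 2) * (X0 (ln (q x)) powr p * Y0 (ln (r x)) powr p)"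
    unfolding J_def pull_pos[OF qp] pull_pos[OF rp] A1_def E1_def X0_def Y0_def * by simp
  show "exp (k * V / 2) * J A2 E2 x = q x powr (- real n / 2) * (tent (tu (ln (q x))) powr p * tent (ln (r x) - V) powr p)"
    unfolding J_def pull_pos[OF qp] pull_pos[OF rp] A2_def E2_def * by simp
qed

private lemma c_T0:
  assumes x: "x \<in> T0"
  shows "\<bar>degen_exponent \<delta> \<delta>' (sqrt (q x)) - \<gamma>0\<bar> \<le> \<epsilon>"
    "(1 - \<epsilon>) * q x powr (\<gamma>0 / 2) \<le> cK x" "cK x \<le> (1 + \<epsilon>) * q x powr (\<gamma>0 / 2)"
proof -
  have qp: "q x > 0" using T0_facts[OF x] by auto
  have "sqrt (q x) powr \<gamma>0 = q x powr (\<gamma>0 / 2)"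
    using qp by (simp add: powr_half_sqrt[symmetric] powr_powr)
  moreover have "2 * ln (sqrt (q x)) = ln (q x)" using qp by (simp add: ln_sqrt)
  ultimately show "\<bar>degen_exponent \<delta> \<delta>' (sqrt (q x)) - \<gamma>0\<bar> \<le> \<epsilon>"
    "(1 - \<epsilon>) * q x powr (\<gamma>0 / 2) \<le> cK x" "cK x \<le> (1 + \<epsilon>) * q x powr (\<gamma>0 / 2)"
    using asym[of "sqrt (q x)"] qp T0_ranges(1)[OF x] unfolding T0_facts(4)[OF x] by auto
qed

private lemma err_nonneg: "err m n k \<ge> 0"
  unfolding err_def using m(1) by simp

text \<open>Since \<open>p m = n + p \<gamma>0 - 2 p\<close>, the \<open>p\<close>-th power of \<open>c q\<^sup>-\<^sup>1 q\<^sup>-\<^sup>m\<^sup>/\<^sup>2\<close> is \<open>q\<^sup>-\<^sup>n\<^sup>/\<^sup>2\<close> up to a factor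
  close to one.  The same cancellation gives the lower bound for the weighted \<open>p\<close>-th power of \<open>\<phi>\<close>.\<close>

private lemma upper_point:
  "\<bar>div_op cK \<phi> x\<bar> powr p \<le> (1 + \<epsilon>) powr p * exp (k * V / 2) *
    ((1 - l) powr (1 - p) * (C + m * \<epsilon>) powr p * J A1 E1 x + l powr (1 - p) * (err m n k * \<epsilon>) powr p * J A2 E2 x)"
proof (cases "x \<in> T0")
  case False
  have "J A1 E1 x = 0" by (rule J_out[OF AE_props(5,7) False])
  moreover have "J A2 E2 x = 0" by (rule J_out[OF AE_props(6,8) False])
  ultimately show ?thesis using H_out[OF False] by simp
next
  case x: True
  have qp: "q x > 0" and rp: "r x > 0" using T0_facts[OF x] by auto
  define u where "u = ln (q x)"
  define v where "v = ln (r x)"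
  define \<alpha> where "\<alpha> = tent (tu u)"
  define \<beta> where "\<beta> = tent (v - V)"
  define W0 where "W0 = cK x * q x powr (s - 1)"
  have ab: "\<alpha> \<ge> 0" "\<beta> \<ge> 0" unfolding \<alpha>_def \<beta>_def by (rule tent_nonneg)+
  have iN: "1 / N \<le> \<epsilon>" "1 / N \<le> 1" using N by (auto simp: field_simps)
  have X1b: "\<bar>X1 u\<bar> \<le> 3 * \<epsilon> * \<alpha>"
  proof -
    have "\<bar>X1 u\<bar> = \<bar>bump' (tu u)\<bar> * (1 / N)" unfolding X1_def using Npos by simp
    also have "\<dots> \<le> (3 * \<alpha>) * \<epsilon>" unfolding \<alpha>_def
      by (intro mult_mono bump_bounds iN) (use Npos tent_nonneg in auto)
    finally show ?thesis by (simp add: mult_ac)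
  qed
  have X2b: "\<bar>X2 u\<bar> \<le> 8 * \<epsilon> * \<alpha>"
  proof -
    have "\<bar>X2 u\<bar> = \<bar>bump'' (tu u)\<bar> * (1 / N * (1 / N))" unfolding X2_def using Npos by simp
    also have "\<dots> \<le> (8 * \<alpha>) * (\<epsilon> * 1)" unfolding \<alpha>_def
      by (intro mult_mono bump_bounds iN) (use Npos tent_nonneg eps in auto)
    finally show ?thesis by (simp add: mult_ac)
  qed
  define E where "E = (2 * degen_exponent \<delta> \<delta>' (sqrt (q x)) * (X1 u - m / 2 * X0 u) * Y0 v
      + (4 * (X2 u - (m + 1) * X1 u + m / 2 * (m / 2 + 1) * X0 u) + 2 * real n * (X1 u - m / 2 * X0 u)) * Y0 v
      + q x / r x * X0 u * (4 * (Y2 v - Y1 v) + 2 * real k * Y1 v))"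
  have Eb: "\<bar>E\<bar> \<le> (C + m * \<epsilon>) * (X0 u * Y0 v) + err m n k * \<epsilon> * (\<alpha> * \<beta>)"
    unfolding E_def
  proof (rule operator_bound[OF _ _ X1b X2b])
    show "0 \<le> X0 u" "X0 u \<le> \<alpha>" unfolding X0_def \<alpha>_def by (rule bump_bounds)+
    show "0 \<le> Y0 v" "Y0 v \<le> \<beta>" "\<bar>Y1 v\<bar> \<le> 3 * \<beta>" "\<bar>Y2 v\<bar> \<le> 8 * \<beta>"
      unfolding Y0_def Y1_def Y2_def \<beta>_def by (rule bump_bounds)+
    show "0 \<le> degen_exponent \<delta> \<delta>' (sqrt (q x))" "degen_exponent \<delta> \<delta>' (sqrt (q x)) \<le> 2"
      using degen_exponent_bounds[OF _ \<delta>] qp by auto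
    show "\<bar>degen_exponent \<delta> \<delta>' (sqrt (q x)) - \<gamma>0\<bar> \<le> \<epsilon>" by (rule c_T0(1)[OF x])
    show "0 \<le> q x / r x" "q x / r x \<le> \<epsilon>" using qp rp T0_facts(6)[OF x] by auto
  qed (use m C in auto)
  define P where "P = (C + m * \<epsilon>) * (X0 u * Y0 v)"
  define Q where "Q = err m n k * \<epsilon> * (\<alpha> * \<beta>)"
  have P0: "P \<ge> 0" unfolding P_def X0_def Y0_def using C(2) m eps bump_bounds(1) by simp
  have Q0: "Q \<ge> 0" unfolding Q_def using err_nonneg eps ab by simp
  have cpos: "cK x \<ge> 0" unfolding degen_coeff_def by simp
  have W0: "W0 \<ge> 0" unfolding W0_def using cpos by simp
  have W0p: "W0 powr p \<le> (1 + \<epsilon>) powr p * q x powr (- real n / 2)"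
  proof -
    have "W0 \<le> (1 + \<epsilon>) * q x powr (\<gamma>0 / 2) * q x powr (s - 1)"
      unfolding W0_def using c_T0(3)[OF x] by (intro mult_right_mono) auto
    also have "\<dots> = (1 + \<epsilon>) * q x powr (\<gamma>0 / 2 + (s - 1))" by (simp add: powr_add)
    finally have "W0 powr p \<le> ((1 + \<epsilon>) * q x powr (\<gamma>0 / 2 + (s - 1))) powr p"
      using W0 p by (intro powr_mono2) auto
    also have "\<dots> = (1 + \<epsilon>) powr p * q x powr ((\<gamma>0 / 2 + (s - 1)) * p)"
      using eps by (simp add: powr_mult powr_powr)
    also have "(\<gamma>0 / 2 + (s - 1)) * p = - real n / 2"
      unfolding m(2) s_def by (simp add: field_simps)
    finally show ?thesis .
  qed
  have "\<bar>div_op cK \<phi> x\<bar> = W0 * \<bar>E\<bar>"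
    using W0 unfolding H_formula[OF x] u_def[symmetric] v_def[symmetric] E_def[symmetric] W0_def[symmetric]
    by (simp add: abs_mult)
  also have "\<dots> \<le> W0 * (P + Q)" using Eb W0 unfolding P_def Q_def by (intro mult_left_mono)
  finally have "\<bar>div_op cK \<phi> x\<bar> powr p \<le> (W0 * (P + Q)) powr p"
    using p by (intro powr_mono2) auto
  also have "\<dots> = W0 powr p * (P + Q) powr p" by (rule powr_mult)
  also have "\<dots> \<le> ((1 + \<epsilon>) powr p * q x powr (- real n / 2)) * ((1 - l) powr (1 - p) * P powr p + l powr (1 - p) * Q powr p)"
    by (intro mult_mono W0p powr_add_le P0 Q0 p l powr_ge_zero) (use eps in auto)
  also have "P powr p = (C + m * \<epsilon>) powr p * (X0 u powr p * Y0 v powr p)"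
    unfolding P_def X0_def Y0_def using C(2) m eps bump_bounds(1) by (simp add: powr_mult)
  also have "Q powr p = (err m n k * \<epsilon>) powr p * (\<alpha> powr p * \<beta> powr p)"
    unfolding Q_def using err_nonneg eps ab by (simp add: powr_mult)
  also have "((1 + \<epsilon>) powr p * q x powr (- real n / 2)) * ((1 - l) powr (1 - p) * ((C + m * \<epsilon>) powr p * (X0 u powr p * Y0 v powr p))
        + l powr (1 - p) * ((err m n k * \<epsilon>) powr p * (\<alpha> powr p * \<beta> powr p)))
    = (1 + \<epsilon>) powr p * ((1 - l) powr (1 - p) * (C + m * \<epsilon>) powr p * (exp (k * V / 2) * J A1 E1 x)
        + l powr (1 - p) * (err m n k * \<epsilon>) powr p * (exp (k * V / 2) * J A2 E2 x))"
    unfolding J_T0[OF x] u_def[symmetric] v_def[symmetric] \<alpha>_def[symmetric] \<beta>_def[symmetric]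
    by (simp add: algebra_simps)
  also have "\<dots> = (1 + \<epsilon>) powr p * exp (k * V / 2) *
    ((1 - l) powr (1 - p) * (C + m * \<epsilon>) powr p * J A1 E1 x + l powr (1 - p) * (err m n k * \<epsilon>) powr p * J A2 E2 x)"
    by (simp add: algebra_simps)
  finally show ?thesis .
qed

private lemma lower_point:
  "(1 - \<epsilon>) powr p * exp (k * V / 2) * J A1 E1 x \<le> cK x powr p * infdist x K powr (- 2 * p) * \<bar>\<phi> x\<bar> powr p"
proof (cases "x \<in> T0")
  case False
  then show ?thesis using J_out[OF AE_props(5,7) False] by simp
next
  case x: True
  have qp: "q x > 0" and rp: "r x > 0" using T0_facts[OF x] by auto
  define u where "u = ln (q x)"
  define v where "v = ln (r x)"
  define \<theta> where "\<theta> = X0 u powr p * Y0 v powr p"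
  have "((1 - \<epsilon>) * q x powr (\<gamma>0 / 2)) powr p \<le> cK x powr p"
    using c_T0(2)[OF x] eps p by (intro powr_mono2) auto
  then have cp: "(1 - \<epsilon>) powr p * q x powr (\<gamma>0 / 2 * p) \<le> cK x powr p"
    using eps by (simp add: powr_mult powr_powr)
  have dp: "infdist x K powr (- 2 * p) = q x powr (- p)"
    unfolding T0_facts(4)[OF x] using qp by (simp add: powr_half_sqrt[symmetric] powr_powr)
  have "\<phi> x = q x powr s * (X0 u * Y0 v)"
    unfolding G1_def G2_def pull_pos[OF qp] pull_pos[OF rp] u_def v_def using rp by simp
  then have "\<bar>\<phi> x\<bar> = q x powr s * (X0 u * Y0 v)"
    unfolding X0_def Y0_def using bump_bounds(1) by simp
  then have fp: "\<bar>\<phi> x\<bar> powr p = q x powr (s * p) * \<theta>"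
    unfolding \<theta>_def X0_def Y0_def using bump_bounds(1) by (simp add: powr_mult powr_powr)
  have "(1 - \<epsilon>) powr p * exp (k * V / 2) * J A1 E1 x = (1 - \<epsilon>) powr p * (q x powr (- real n / 2) * \<theta>)"
    unfolding mult.assoc J_T0[OF x] \<theta>_def u_def v_def ..
  also have "- real n / 2 = \<gamma>0 / 2 * p + - p + s * p" unfolding m(2) s_def by (simp add: field_simps)
  also have "(1 - \<epsilon>) powr p * (q x powr (\<gamma>0 / 2 * p + - p + s * p) * \<theta>)
      = ((1 - \<epsilon>) powr p * q x powr (\<gamma>0 / 2 * p)) * (q x powr (- p) * (q x powr (s * p) * \<theta>))"
    unfolding powr_add by (simp add: mult_ac)
  also have "\<dots> \<le> cK x powr p * (q x powr (- p) * (q x powr (s * p) * \<theta>))"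
    by (intro mult_right_mono cp) (simp add: \<theta>_def)
  finally show ?thesis unfolding dp fp by (simp add: mult_ac)
qed

lemma rellich_test_function:
  "\<exists>\<phi>\<in>Cc2 (- K). \<phi> \<noteq> (\<lambda>_. 0) \<and>
     (LINT x:- K|lebesgue. \<bar>div_op cK \<phi> x\<bar> powr p)
       \<le> test_bound p C m n k l \<epsilon> * (LINT x:- K|lebesgue. cK x powr p * infdist x K powr (- 2 * p) * \<bar>\<phi> x\<bar> powr p)"
proof (intro bexI[OF _ phi_Cc2] conjI phi_nonzero)
  define j1 where "j1 = (\<integral>x. J A1 E1 x \<partial>lborel)"
  have op: "open (- K)" using K(1) by (rule open_Compl)
  have T0K: "T0 \<subseteq> - K" using T0_facts(5) by blast
  have iJ: "integrable lborel (J A1 E1)" "integrable lborel (J A2 E2)"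
    using J_integrable[OF AE_props(1,5,3,7)] J_integrable[OF AE_props(2,6,4,8)] by blast+
  have contH: "continuous_on UNIV (\<lambda>x. \<bar>div_op cK \<phi> x\<bar> powr p)"
  proof (rule continuous_on_extend_by_zero[OF op closed_T0 T0K])
    have "continuous_on (- K) (div_op cK \<phi>)"
      by (rule continuous_on_div_op[OF phi_Cc2 refl has_derivative_degen_infdist[OF K] continuous_on_degen_gradient[OF K]])
    then show "continuous_on (- K) (\<lambda>x. \<bar>div_op cK \<phi> x\<bar> powr p)"
      by (intro continuous_on_powr') (use p in \<open>auto intro!: continuous_intros\<close>)
  qed (simp add: H_out)
  have iH: "integrable lborel (\<lambda>x. \<bar>div_op cK \<phi> x\<bar> powr p)"
    by (rule integrable_compact_support[OF contH compact_T0]) (simp add: H_out)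
  have contD: "continuous_on UNIV (\<lambda>x. cK x powr p * infdist x K powr (- 2 * p) * \<bar>\<phi> x\<bar> powr p)"
  proof (rule continuous_on_extend_by_zero[OF op closed_T0 T0K])
    have c1: "continuous_on (- K) cK"
      by (intro continuous_at_imp_continuous_on ballI has_derivative_continuous[OF has_derivative_degen_infdist[OF K]])
    have "continuous_on (- K) (\<lambda>x. cK x powr p)"
      by (rule continuous_on_powr'[OF c1]) (use p in \<open>auto simp: degen_coeff_def\<close>)
    moreover have "infdist x K \<noteq> 0" if "x \<in> - K" for x using infdist_pos[OF K, of x] that by auto
    then have "continuous_on (- K) (\<lambda>x. infdist x K powr (- 2 * p))"
      by (intro continuous_intros ballI)
    moreover have "continuous_on (- K) \<phi>" by (rule Cc2_continuous_on[OF phi_Cc2 refl])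
    then have "continuous_on (- K) (\<lambda>x. \<bar>\<phi> x\<bar> powr p)"
      by (intro continuous_on_powr') (use p in \<open>auto intro!: continuous_intros\<close>)
    ultimately show "continuous_on (- K) (\<lambda>x. cK x powr p * infdist x K powr (- 2 * p) * \<bar>\<phi> x\<bar> powr p)"
      by (intro continuous_on_mult)
  qed (use phi_out in simp)
  have iD: "integrable lborel (\<lambda>x. cK x powr p * infdist x K powr (- 2 * p) * \<bar>\<phi> x\<bar> powr p)"
    by (rule integrable_compact_support[OF contD compact_T0]) (use phi_out in simp)
  have num: "(LINT x:- K|lebesgue. \<bar>div_op cK \<phi> x\<bar> powr p) = (\<integral>x. \<bar>div_op cK \<phi> x\<bar> powr p \<partial>lborel)"
    by (rule set_integral_lebesgue_eq_lborel[OF borel_measurable_continuous_onI[OF contH]])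
       (use H_out T0K in auto)
  have den: "(LINT x:- K|lebesgue. cK x powr p * infdist x K powr (- 2 * p) * \<bar>\<phi> x\<bar> powr p)
      = (\<integral>x. cK x powr p * infdist x K powr (- 2 * p) * \<bar>\<phi> x\<bar> powr p \<partial>lborel)"
    by (rule set_integral_lebesgue_eq_lborel[OF borel_measurable_continuous_onI[OF contD]])
       (use phi_out T0K in auto)
  define \<Theta> where "\<Theta> = (1 - l) powr (1 - p) * (C + m * \<epsilon>) powr p + l powr (1 - p) * (err m n k * \<epsilon>) powr p * tent_ratio p k"
  have R0: "tent_ratio p k \<ge> 0"
    unfolding tent_ratio_def A1_def[symmetric] A2_def[symmetric] E1_def[symmetric] E2_def[symmetric]
    using I_pos by simp
  have \<Theta>0: "\<Theta> \<ge> 0" unfolding \<Theta>_def using R0 by simp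
  have "(\<integral>x. \<bar>div_op cK \<phi> x\<bar> powr p \<partial>lborel) \<le> (\<integral>x. (1 + \<epsilon>) powr p * exp (k * V / 2) *
    ((1 - l) powr (1 - p) * (C + m * \<epsilon>) powr p * J A1 E1 x + l powr (1 - p) * (err m n k * \<epsilon>) powr p * J A2 E2 x) \<partial>lborel)"
    by (rule integral_mono[OF iH _ upper_point]) (use iJ in simp)
  also have "\<dots> = (1 + \<epsilon>) powr p * exp (k * V / 2) * (\<Theta> * j1)"
    using iJ J_ratio unfolding j1_def \<Theta>_def by (simp add: algebra_simps)
  finally have up: "(\<integral>x. \<bar>div_op cK \<phi> x\<bar> powr p \<partial>lborel) \<le> (1 + \<epsilon>) powr p * exp (k * V / 2) * (\<Theta> * j1)" .
  have "(1 - \<epsilon>) powr p * exp (k * V / 2) * j1 = (\<integral>x. (1 - \<epsilon>) powr p * exp (k * V / 2) * J A1 E1 x \<partial>lborel)"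
    unfolding j1_def using iJ by simp
  also have "\<dots> \<le> (\<integral>x. cK x powr p * infdist x K powr (- 2 * p) * \<bar>\<phi> x\<bar> powr p \<partial>lborel)" (is "_ \<le> ?D")
    by (rule integral_mono[OF _ iD lower_point]) (use iJ in simp)
  finally have low: "(1 - \<epsilon>) powr p * exp (k * V / 2) * j1 \<le> ?D" .
  have "(1 + \<epsilon>) powr p = ((1 + \<epsilon>) / (1 - \<epsilon>)) powr p * (1 - \<epsilon>) powr p"
    using eps by (simp add: powr_mult[symmetric])
  then have "(1 + \<epsilon>) powr p * exp (k * V / 2) * (\<Theta> * j1) = (((1 + \<epsilon>) / (1 - \<epsilon>)) powr p * \<Theta>) * ((1 - \<epsilon>) powr p * exp (k * V / 2) * j1)"
    by simp
  also have "\<dots> \<le> (((1 + \<epsilon>) / (1 - \<epsilon>)) powr p * \<Theta>) * ?D"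
    using low \<Theta>0 by (intro mult_left_mono) auto
  finally show "(LINT x:- K|lebesgue. \<bar>div_op cK \<phi> x\<bar> powr p)
       \<le> test_bound p C m n k l \<epsilon> * (LINT x:- K|lebesgue. cK x powr p * infdist x K powr (- 2 * p) * \<bar>\<phi> x\<bar> powr p)"
    using up unfolding num den test_bound_def \<Theta>_def by linarith
qed

end

section \<open>Large balls and the dimension at infinity\<close>

definition shift :: "nat \<Rightarrow> nat \<Rightarrow> real \<Rightarrow> (nat \<Rightarrow> real) \<Rightarrow> nat \<Rightarrow> real"
  where "shift k i s y = (\<lambda>j\<in>{..<k}. y j + (if j = i then s else 0))"

abbreviation lebesgue_product :: "nat \<Rightarrow> (nat \<Rightarrow> real) measure"
  where "lebesgue_product k \<equiv> Pi\<^sub>M {..<k} (\<lambda>_. lborel)"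

lemma measurable_shift: "shift k i s \<in> measurable (lebesgue_product k) (lebesgue_product k)"
  unfolding shift_def[abs_def]
proof (rule measurable_restrict)
  fix j assume "j \<in> {..<k}"
  then have [measurable]: "(\<lambda>y. y j) \<in> borel_measurable (lebesgue_product k)"
    using measurable_component_singleton[of j "{..<k}" "\<lambda>_. lborel"] by simp
  show "(\<lambda>y. y j + (if j = i then s else 0)) \<in> lebesgue_product k \<rightarrow>\<^sub>M lborel" by simp
qed

lemma distr_shift: "distr (lebesgue_product k) (lebesgue_product k) (shift k i s) = lebesgue_product k"
proof -
  interpret product_sigma_finite "\<lambda>_::nat. lborel :: real measure" by standard
  show ?thesis
  proof (rule PiM_eqI)
    fix A :: "nat \<Rightarrow> real set" assume A: "\<And>j. j \<in> {..<k} \<Longrightarrow> A j \<in> sets lborel"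
    define B where "B = (\<lambda>j. (+) (if j = i then s else 0) -` A j)"
    have B: "B j \<in> sets lborel" "emeasure lborel (B j) = emeasure lborel (A j)" if "j \<in> {..<k}" for j
    proof -
      have Aj: "A j \<in> sets borel" using A[OF that] by simp
      have m: "(+) c \<in> measurable borel (borel :: real measure)" for c by measurable
      show "B j \<in> sets lborel" unfolding B_def using measurable_sets[OF m Aj] by simp
      have "emeasure lborel (A j) = emeasure (distr lborel borel ((+) (if j = i then s else 0))) (A j)"
        by (simp add: lborel_distr_plus)
      also have "\<dots> = emeasure lborel (B j)"
        unfolding B_def using Aj m by (subst emeasure_distr) auto
      finally show "emeasure lborel (B j) = emeasure lborel (A j)" by simp
    qed
    have pre: "shift k i s -` (Pi\<^sub>E {..<k} A) \<inter> space (lebesgue_product k) = Pi\<^sub>E {..<k} B"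
      unfolding shift_def B_def space_PiM by (auto simp: PiE_iff extensional_def add.commute)
    have "emeasure (distr (lebesgue_product k) (lebesgue_product k) (shift k i s)) (Pi\<^sub>E {..<k} A)
        = emeasure (lebesgue_product k) (Pi\<^sub>E {..<k} B)"
      using A by (subst emeasure_distr[OF measurable_shift]) (auto intro!: sets_PiM_I_finite simp: pre)
    also have "\<dots> = (\<Prod>j<k. emeasure lborel (A j))"
      using B by (subst emeasure_PiM) auto
    finally show "emeasure (distr (lebesgue_product k) (lebesgue_product k) (shift k i s)) (Pi\<^sub>E {..<k} A)
        = (\<Prod>j<k. emeasure lborel (A j))" .
  qed auto
qed

lemma emeasure_shift_vimage:
  assumes "D \<in> sets (lebesgue_product k)"
  shows "shift k i s -` D \<inter> space (lebesgue_product k) \<in> sets (lebesgue_product k)"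
    and "emeasure (lebesgue_product k) (shift k i s -` D \<inter> space (lebesgue_product k)) = emeasure (lebesgue_product k) D"
proof -
  show "shift k i s -` D \<inter> space (lebesgue_product k) \<in> sets (lebesgue_product k)"
    by (rule measurable_sets[OF measurable_shift assms])
  have "emeasure (lebesgue_product k) D = emeasure (distr (lebesgue_product k) (lebesgue_product k) (shift k i s)) D"
    by (simp add: distr_shift)
  also have "\<dots> = emeasure (lebesgue_product k) (shift k i s -` D \<inter> space (lebesgue_product k))"
    by (rule emeasure_distr[OF measurable_shift assms])
  finally show "emeasure (lebesgue_product k) (shift k i s -` D \<inter> space (lebesgue_product k)) = emeasure (lebesgue_product k) D" ..
qed

lemma frame_point_shift:
  assumes "i < k"
  shows "frame_point k a e (shift k i s y) = frame_point k a e y + s *\<^sub>R e i"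
proof -
  have "(\<Sum>j<k. shift k i s y j *\<^sub>R e j) = (\<Sum>j<k. y j *\<^sub>R e j + (if j = i then s *\<^sub>R e i else 0))"
    unfolding shift_def by (intro sum.cong) (auto simp: scaleR_add_left)
  also have "\<dots> = (\<Sum>j<k. y j *\<^sub>R e j) + s *\<^sub>R e i"
    using assms by (simp add: sum.distrib)
  finally show ?thesis unfolding frame_point_def by simp
qed

definition slice :: "nat \<Rightarrow> 'a::euclidean_space \<Rightarrow> (nat \<Rightarrow> 'a) \<Rightarrow> 'a set \<Rightarrow> real \<Rightarrow> (nat \<Rightarrow> real) set"
  where "slice k a e K r = {y \<in> {..<k} \<rightarrow>\<^sub>E UNIV. frame_point k a e y \<in> K \<and> L2_set y {..<k} < r}"

lemma measurable_frame_point [measurable]: "frame_point k a e \<in> borel_measurable (lebesgue_product k)"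
  for a :: "'a::euclidean_space"
proof -
  have [measurable]: "(\<lambda>y. y j) \<in> borel_measurable (lebesgue_product k)" if "j < k" for j
    using measurable_component_singleton[of j "{..<k}" "\<lambda>_. lborel"] that by simp
  have "(\<lambda>y. \<Sum>i<k. y i *\<^sub>R e i) \<in> borel_measurable (lebesgue_product k)"
    by (intro borel_measurable_sum borel_measurable_scaleR) auto
  then show ?thesis unfolding frame_point_def[abs_def] by simp
qed

lemma sets_slice:
  assumes "closed K"
  shows "slice k a e K r \<in> sets (lebesgue_product k)"
proof -
  have c: "(\<lambda>y. y j) \<in> borel_measurable (lebesgue_product k)" if "j < k" for j
    using measurable_component_singleton[of j "{..<k}" "\<lambda>_. lborel"] that by simp
  have L: "(\<lambda>y. L2_set y {..<k}) \<in> borel_measurable (lebesgue_product k)"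
    unfolding L2_set_def
    by (intro measurable_compose[OF _ borel_measurable_continuous_onI[OF continuous_on_real_sqrt[OF continuous_on_id]]]
          borel_measurable_sum borel_measurable_power c) auto
  have K: "K \<in> sets borel" using assms by simp
  have "slice k a e K r = (frame_point k a e -` K \<inter> space (lebesgue_product k))
      \<inter> ((\<lambda>y. L2_set y {..<k}) -` {..<r} \<inter> space (lebesgue_product k))"
    unfolding slice_def space_PiM by auto
  then show ?thesis
    using measurable_sets[OF measurable_frame_point K, of k a e] measurable_sets[OF L, of "{..<r}"] by auto
qed

lemma box_measure:
  assumes "b \<ge> 0"
  shows "emeasure (lebesgue_product k) (Pi\<^sub>E {..<k} (\<lambda>_. {-b..b})) = ennreal ((2 * b) ^ k)"
proof -
  interpret product_sigma_finite "\<lambda>_::nat. lborel :: real measure" by standard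
  have "emeasure (lebesgue_product k) (Pi\<^sub>E {..<k} (\<lambda>_. {-b..b})) = (\<Prod>j<k. emeasure lborel {-b..b})"
    by (rule emeasure_PiM) auto
  then show ?thesis using assms by (simp add: ennreal_power)
qed

lemma abs_component_le_L2: "(j :: nat) < k \<Longrightarrow> \<bar>y j\<bar> \<le> L2_set y {..<k}"
  using member_le_L2_set[of "{..<k}" j "\<lambda>i. \<bar>y i\<bar>"] by (simp add: L2_set_def)

text \<open>The points of the slice that leave \<open>K\<close> when pushed by \<open>s\<close> in direction \<open>e\<^sub>i\<close> form a set whose
  translates by multiples of \<open>s e\<^sub>i\<close> are disjoint: a line meets \<open>K\<close> in a segment, which it leaves only
  once.  Packing \<open>n\<close> translates into a larger cube bounds the volume of the set.\<close>

lemma slice_exit_volume: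
  fixes K :: "'a::euclidean_space set" and a :: 'a and e :: "nat \<Rightarrow> 'a" and s r :: real and i k n :: nat
  assumes K: "closed K" "convex K" and i: "i < k" and r: "r > 0"
  defines "D \<equiv> {y \<in> slice k a e K r. frame_point k a e (shift k i s y) \<notin> K}"
  shows "D \<in> sets (lebesgue_product k)"
    and "real n * measure (lebesgue_product k) D \<le> (2 * (r + n * \<bar>s\<bar>)) ^ k"
proof -
  let ?M = "lebesgue_product k"
  have spM: "space ?M = {..<k} \<rightarrow>\<^sub>E UNIV" by (simp add: space_PiM)
  have D_eq: "D = slice k a e K r - (shift k i s -` (frame_point k a e -` K \<inter> space ?M) \<inter> space ?M)"
    unfolding D_def slice_def spM shift_def by auto
  have "frame_point k a e -` K \<inter> space ?M \<in> sets ?M"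
    by (rule measurable_sets[OF measurable_frame_point]) (use K(1) in simp)
  then show Dm: "D \<in> sets ?M"
    unfolding D_eq by (intro sets.Diff sets_slice K(1) emeasure_shift_vimage(1))
  define T where "T = (\<lambda>j::nat. shift k i (- (j * s)) -` D \<inter> space ?M)"
  define b where "b = r + n * \<bar>s\<bar>"
  have b: "b \<ge> 0" unfolding b_def using r by simp
  have Tm: "T j \<in> sets ?M" "emeasure ?M (T j) = emeasure ?M D" for j
    unfolding T_def using emeasure_shift_vimage[OF Dm] by auto
  have sub: "T j \<subseteq> Pi\<^sub>E {..<k} (\<lambda>_. {-b..b})" if j: "j < n" for j
  proof
    fix y assume y: "y \<in> T j"
    have "\<bar>y l\<bar> \<le> b" if l: "l < k" for l
    proof -
      have "L2_set (shift k i (- (j * s)) y) {..<k} < r"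
        using y unfolding T_def D_def slice_def by auto
      then have "\<bar>shift k i (- (j * s)) y l\<bar> < r" using abs_component_le_L2[OF l] by (meson le_less_trans)
      then have "\<bar>y l\<bar> < r + \<bar>j * s\<bar>" unfolding shift_def using l by (auto split: if_splits)
      also have "\<bar>j * s\<bar> \<le> n * \<bar>s\<bar>" using j by (auto simp: abs_mult intro!: mult_right_mono)
      finally show ?thesis unfolding b_def by simp
    qed
    moreover have "y \<in> extensional {..<k}" using y unfolding T_def spM by (simp add: PiE_iff)
    ultimately show "y \<in> Pi\<^sub>E {..<k} (\<lambda>_. {-b..b})" by (auto simp: PiE_iff abs_le_iff minus_le_iff)
  qed
  have disj: "disjoint_family_on T {..<n}"
  proof -
    have aux: False if y: "y \<in> T j" "y \<in> T j'" and jj: "j < j'" for y j j'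
    proof -
      define u where "u = shift k i (- (j * s)) y"
      define w where "w = shift k i (- (j' * s)) y"
      have uD: "u \<in> D" and wD: "w \<in> D" using y unfolding T_def u_def w_def by auto
      define c where "c = 1 / real (j' - j)"
      have c: "0 \<le> c" "c \<le> 1" "c * (real j' - real j) = 1" using jj unfolding c_def by (auto simp: of_nat_diff)
      have fu: "frame_point k a e u = frame_point k a e y - (j * s) *\<^sub>R e i"
        "frame_point k a e w = frame_point k a e y - (j' * s) *\<^sub>R e i"
        unfolding u_def w_def frame_point_shift[OF i] by simp_all
      have "(1 - c) *\<^sub>R frame_point k a e w + c *\<^sub>R frame_point k a e u \<in> K"
        using uD wD c by (intro convexD_alt[OF K(2)]) (auto simp: D_def slice_def)
      moreover have "(1 - c) *\<^sub>R frame_point k a e w + c *\<^sub>R frame_point k a e u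
          = frame_point k a e w + (c * (real j' - real j) * s) *\<^sub>R e i"
        unfolding fu by (simp add: algebra_simps)
      ultimately have "frame_point k a e (shift k i s w) \<in> K"
        unfolding c(3) frame_point_shift[OF i] by simp
      then show False using wD unfolding D_def by simp
    qed
    show ?thesis unfolding disjoint_family_on_def
    proof (intro ballI impI)
      fix m n' assume "m \<noteq> (n' :: nat)"
      then consider "m < n'" | "n' < m" by linarith
      then show "T m \<inter> T n' = {}" using aux by cases blast+
    qed
  qed
  have boxm: "Pi\<^sub>E {..<k} (\<lambda>_. {-b..b}) \<in> sets ?M" by (rule sets_PiM_I_finite) auto
  have fin: "emeasure ?M (T j) \<noteq> \<infinity>" if "j < n" for j
    using emeasure_mono[OF sub[OF that] boxm] unfolding box_measure[OF b] by (auto simp: top_unique)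
  have "real n * measure ?M D = (\<Sum>j<n. measure ?M (T j))"
    using Tm(2) by (simp add: measure_def)
  also have "\<dots> = measure ?M (\<Union>j<n. T j)"
    using Tm(1) disj fin by (intro measure_finite_Union[symmetric]) auto
  also have "\<dots> \<le> measure ?M (Pi\<^sub>E {..<k} (\<lambda>_. {-b..b}))"
    using sub Tm(1) boxm box_measure[OF b] by (intro measure_mono_fmeasurable) (auto simp: fmeasurable_def)
  also have "\<dots> = (2 * b) ^ k" using box_measure[OF b] b by (simp add: measure_def)
  finally show "real n * measure ?M D \<le> (2 * (r + n * \<bar>s\<bar>)) ^ k" unfolding b_def .
qed

text \<open>If every point left \<open>K\<close> in one of the \<open>2 k\<close> directions, the exit sets would cover the slice; each has
  volume at most \<open>(4 r)\<^sup>k / n\<close> for \<open>r = n t\<close>.\<close>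

lemma cross_polytope_exists:
  fixes K :: "'a::euclidean_space set" and a :: 'a and e :: "nat \<Rightarrow> 'a" and t :: real and n k :: nat
  assumes K: "closed K" "convex K" and t: "t > 0" and n: "n > 0"
    and vol: "slice_volume k a e K (n * t) > 2 * real k * (4 * (n * t)) ^ k / n"
  shows "\<exists>y. frame_point k a e y \<in> K \<and> (\<forall>i s. i < k \<longrightarrow> \<bar>s\<bar> = t \<longrightarrow> frame_point k a e y + s *\<^sub>R e i \<in> K)"
proof (rule ccontr)
  assume "\<not> ?thesis"
  then have no: "\<exists>i s. i < k \<and> \<bar>s\<bar> = t \<and> frame_point k a e y + s *\<^sub>R e i \<notin> K"
    if "frame_point k a e y \<in> K" for y using that by blast
  let ?M = "lebesgue_product k"
  define r where "r = n * t"
  have r: "r > 0" unfolding r_def using n t by simp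
  define D where "D = (\<lambda>(i, s). {y \<in> slice k a e K r. frame_point k a e (shift k i s y) \<notin> K})"
  define I where "I = {..<k} \<times> {t, - t}"
  have bound: "D (i, s) \<in> sets ?M" "measure ?M (D (i, s)) \<le> (4 * r) ^ k / n" if "(i, s) \<in> I" for i s
  proof -
    have i: "i < k" and s: "\<bar>s\<bar> = t" using that t unfolding I_def by auto
    show "D (i, s) \<in> sets ?M" unfolding D_def using slice_exit_volume(1)[OF K i r] by simp
    have "real n * measure ?M (D (i, s)) \<le> (2 * (r + n * t)) ^ k"
      using slice_exit_volume(2)[OF K i r, of n a e s] unfolding D_def s by simp
    also have "2 * (r + n * t) = 4 * r" unfolding r_def by simp
    finally show "measure ?M (D (i, s)) \<le> (4 * r) ^ k / n" using n by (simp add: field_simps)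
  qed
  have Dsub: "D x \<subseteq> Pi\<^sub>E {..<k} (\<lambda>_. {-r..r})" for x
  proof
    fix y assume "y \<in> D x"
    then have y: "L2_set y {..<k} < r" "y \<in> extensional {..<k}"
      unfolding D_def slice_def by (auto simp: PiE_iff split: prod.splits)
    have "y j \<in> {-r..r}" if "j < k" for j
      using abs_component_le_L2[OF that, of y] y(1) by (simp add: abs_le_iff)
    then show "y \<in> Pi\<^sub>E {..<k} (\<lambda>_. {-r..r})"
      using y(2) by (simp add: PiE_iff)
  qed
  have boxm: "Pi\<^sub>E {..<k} (\<lambda>_. {-r..r}) \<in> sets ?M" by (rule sets_PiM_I_finite) auto
  have fin: "emeasure ?M (D x) \<noteq> \<infinity>" for x
    by (rule neq_top_trans[OF _ emeasure_mono[OF Dsub boxm], unfolded infinity_ennreal_def[symmetric]])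
       (use box_measure[of r k] r in simp)
  have cov: "slice k a e K r = (\<Union>x\<in>I. D x)"
  proof
    show "(\<Union>x\<in>I. D x) \<subseteq> slice k a e K r" unfolding D_def by auto
    show "slice k a e K r \<subseteq> (\<Union>x\<in>I. D x)"
    proof
      fix y assume y: "y \<in> slice k a e K r"
      then obtain i s where ws: "i < k" "\<bar>s\<bar> = t" "frame_point k a e y + s *\<^sub>R e i \<notin> K"
        using no[of y] unfolding slice_def by auto
      from ws have "(i, s) \<in> I" unfolding I_def by (auto simp: abs_if split: if_splits)
      moreover have "y \<in> D (i, s)" unfolding D_def using y ws by (simp add: frame_point_shift)
      ultimately show "y \<in> (\<Union>x\<in>I. D x)" by blast
    qed
  qed
  have "slice_volume k a e K r = measure ?M (\<Union>x\<in>I. D x)"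
    unfolding slice_volume_def cov[symmetric] slice_def ..
  also have "\<dots> \<le> (\<Sum>x\<in>I. measure ?M (D x))"
    using bound(1) fin by (intro measure_subadditive_finite) (auto simp: I_def)
  also have "\<dots> \<le> (\<Sum>x\<in>I. (4 * r) ^ k / n)"
    using bound(2) by (intro sum_mono) auto
  also have "\<dots> = 2 * real k * ((4 * r) ^ k / n)"
    unfolding I_def using t by (simp add: card_cartesian_product)
  finally show False using vol unfolding r_def by simp
qed

text \<open>A point \<open>x + \<Sum> d\<^sub>i e\<^sub>i\<close> is the average of the \<open>k\<close> points \<open>x + k d\<^sub>i e\<^sub>i\<close>, each of which lies on an axis
  of the cross-polytope.\<close>

lemma ball_subset_of_cross_polytope:
  fixes K :: "'a::euclidean_space set"
  assumes K: "convex K" and k: "k > 0" and fr: "affine_frame A k a e"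
    and cross: "\<And>i s. i < k \<Longrightarrow> \<bar>s\<bar> = t \<Longrightarrow> frame_point k a e y + s *\<^sub>R e i \<in> K" and t: "t > 0"
  shows "ball (frame_point k a e y) (t / k) \<inter> A \<subseteq> K"
proof
  fix b assume b: "b \<in> ball (frame_point k a e y) (t / k) \<inter> A"
  define x where "x = frame_point k a e y"
  have on: "e i \<bullet> e j = (if i = j then 1 else 0)" if "i < k" "j < k" for i j
    using fr that unfolding affine_frame_def by auto
  obtain w where w: "b = frame_point k a e w" using b fr unfolding affine_frame_def by auto
  define d where "d = (\<lambda>i. w i - y i)"
  have bx: "b = x + (\<Sum>i<k. d i *\<^sub>R e i)"
    unfolding w x_def frame_point_def d_def by (simp add: scaleR_diff_left sum_subtractf)
  have dk: "\<bar>k * d i\<bar> \<le> t" if i: "i < k" for i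
  proof -
    have "(b - x) \<bullet> e i = (\<Sum>j<k. d j * (if j = i then 1 else 0))"
      unfolding bx by (simp add: inner_sum_left) (intro sum.cong, use on i in auto)
    also have "\<dots> = (\<Sum>j<k. if j = i then d j else 0)" by (intro sum.cong) auto
    also have "\<dots> = d i" using i by simp
    finally have "\<bar>d i\<bar> \<le> norm (b - x) * norm (e i)" using Cauchy_Schwarz_ineq2[of "b - x" "e i"] by simp
    also have "norm (e i) = 1" using on[OF i i] by (simp add: norm_eq_1)
    also have "norm (b - x) * 1 \<le> t / k" using b unfolding x_def by (auto simp: dist_norm norm_minus_commute)
    finally show ?thesis using k by (simp add: abs_mult field_simps)
  qed
  have seg: "x + (k * d i) *\<^sub>R e i \<in> K" if i: "i < k" for i
  proof -
    define c where "c = (k * d i + t) / (2 * t)"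
    have c: "0 \<le> c" "c \<le> 1" using dk[OF i] t unfolding c_def by (auto simp: abs_le_iff field_simps)
    have mem: "(1 - c) *\<^sub>R (x + (- t) *\<^sub>R e i) + c *\<^sub>R (x + t *\<^sub>R e i) \<in> K"
      using cross[OF i, of "- t"] cross[OF i, of t] t c unfolding x_def by (intro convexD_alt[OF K]) auto
    have comb: "(1 - c) *\<^sub>R (x + u *\<^sub>R e i) + c *\<^sub>R (x + w *\<^sub>R e i) = x + ((1 - c) * u + c * w) *\<^sub>R e i" for u w
      by (simp add: algebra_simps)
    have "c * (2 * t) = k * d i + t" unfolding c_def using t by simp
    then have "(1 - c) * (- t) + c * t = k * d i" by (simp add: algebra_simps)
    then show ?thesis using mem unfolding comb by simp
  qed
  have "(\<Sum>i<k. (1 / real k) *\<^sub>R (x + (k * d i) *\<^sub>R e i)) \<in> K"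
    using k seg by (intro convex_sum[OF _ K]) auto
  moreover have "(\<Sum>i<k. (1 / real k) *\<^sub>R (x + (k * d i) *\<^sub>R e i)) = b"
    unfolding bx using k by (simp add: scaleR_add_right sum.distrib sum_constant_scaleR)
  ultimately show "b \<in> K" by simp
qed

text \<open>For large \<open>r\<close> the slice has volume above \<open>r\<^sup>k\<^sup>-\<^sup>1\<^sup>/\<^sup>2\<close>, which beats the exit volume, of order \<open>t r\<^sup>k\<^sup>-\<^sup>1\<close>, for every fixed \<open>t\<close>.\<close>

lemma large_balls:
  fixes K :: "'a::euclidean_space set"
  assumes K: "closed K" "convex K" "K \<noteq> {}" and dim: "aff_dim K = int k" and k: "k \<ge> 1"
    and inf: "dim_at_infinity K = ereal k" and \<rho>: "\<rho> > 0"
  shows "\<exists>x. x \<in> K \<and> ball x \<rho> \<inter> affine hull K \<subseteq> K"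
proof -
  define ae where "ae = (SOME (a, e). affine_frame (affine hull K) k a e)"
  obtain a e where ae: "ae = (a, e)" by (cases ae)
  have "\<exists>ae. case ae of (a, e) \<Rightarrow> affine_frame (affine hull K) k a e"
    using affine_frame_exists[OF K(3)] dim by simp
  then have "case ae of (a, e) \<Rightarrow> affine_frame (affine hull K) k a e"
    unfolding ae_def by (rule someI_ex)
  then have fr: "affine_frame (affine hull K) k a e" unfolding ae by simp
  have L: "Liminf at_top (\<lambda>r::real. ereal (ln (slice_volume k a e K r) / ln r)) = ereal k"
    using inf dim unfolding dim_at_infinity_def Let_def ae_def[symmetric] by (simp add: ae_def[symmetric] ae)
  have "ereal (k - 1 / 2) < Liminf at_top (\<lambda>r::real. ereal (ln (slice_volume k a e K r) / ln r))"
    unfolding L by simp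
  from less_LiminfD[OF this]
  have ev: "\<forall>\<^sub>F r in at_top. real k - 1 / 2 < ln (slice_volume k a e K r) / ln r" by simp
  define t where "t = k * \<rho>"
  have t: "t > 0" unfolding t_def using k \<rho> by simp
  have "filterlim (\<lambda>n. real n * t) at_top sequentially"
    using filterlim_tendsto_pos_mult_at_top[OF tendsto_const t filterlim_real_sequentially]
    by (simp add: mult.commute)
  then have ev1: "\<forall>\<^sub>F n in sequentially. real k - 1 / 2 < ln (slice_volume k a e K (n * t)) / ln (n * t)"
    using ev by (rule eventually_compose_filterlim[rotated])
  have ev2: "\<forall>\<^sub>F n in sequentially. real n * t > 1"
    using \<open>filterlim (\<lambda>n. real n * t) at_top sequentially\<close> unfolding filterlim_at_top_dense by blast
  have "filterlim (\<lambda>n. sqrt (real n)) at_top sequentially"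
    by (rule filterlim_compose[OF sqrt_at_top filterlim_real_sequentially])
  then have ev3: "\<forall>\<^sub>F n in sequentially. sqrt (real n) > 2 * real k * 4 ^ k * sqrt t"
    unfolding filterlim_at_top_dense by blast
  have "\<forall>\<^sub>F n in sequentially. n > 0 \<and> slice_volume k a e K (n * t) > 2 * real k * (4 * (n * t)) ^ k / n"
    using ev1 ev2 ev3 eventually_gt_at_top[of "0::nat"]
  proof eventually_elim
    case (elim n)
    define r where "r = real n * t"
    have r: "r > 1" and n: "n > 0" using elim unfolding r_def by auto
    define v where "v = slice_volume k a e K r"
    have v0: "v \<ge> 0" unfolding v_def slice_volume_def by simp
    have lnr: "ln r > 0" using r by simp
    have 1: "(real k - 1 / 2) * ln r < ln v" using elim(1) lnr unfolding v_def r_def by (simp add: field_simps)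
    have "(real k - 1 / 2) * ln r > 0" using lnr k by (intro mult_pos_pos) auto
    then have "v > 0" using 1 v0 by (cases "v = 0") auto
    then have "r powr (real k - 1 / 2) < v" using 1 r by (simp add: powr_def flip: exp_less_cancel_iff[of _ "ln v"])
    moreover have "2 * real k * (4 * r) ^ k / n \<le> r powr (real k - 1 / 2)"
    proof -
      have eq: "r powr (real k - 1 / 2) = r ^ k / sqrt r"
        using r by (simp add: powr_diff powr_realpow powr_half_sqrt)
      have "2 * real k * 4 ^ k * sqrt r \<le> n"
      proof -
        have "2 * real k * 4 ^ k * sqrt r = (2 * real k * 4 ^ k * sqrt t) * sqrt n"
          unfolding r_def by (simp add: real_sqrt_mult)
        also have "\<dots> \<le> sqrt n * sqrt n" using elim(3) by (intro mult_right_mono) auto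
        finally show ?thesis by simp
      qed
      then have "2 * real k * 4 ^ k * sqrt r * r ^ k \<le> n * r ^ k" using r by (intro mult_right_mono) auto
      then show ?thesis unfolding eq using r n by (simp add: field_simps power_mult_distrib)
    qed
    ultimately show ?case using n unfolding v_def r_def by simp
  qed
  then obtain n :: nat where n: "n > 0" "slice_volume k a e K (n * t) > 2 * real k * (4 * (n * t)) ^ k / n"
    using eventually_happens'[of sequentially] by auto
  obtain y where y: "frame_point k a e y \<in> K"
    "\<And>i s. i < k \<Longrightarrow> \<bar>s\<bar> = t \<Longrightarrow> frame_point k a e y + s *\<^sub>R e i \<in> K"
    using cross_polytope_exists[OF K(1,2) t n] by blast
  have "ball (frame_point k a e y) (t / k) \<inter> affine hull K \<subseteq> K"
    by (rule ball_subset_of_cross_polytope[OF K(2) _ fr y(2) t]) (use k in auto)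
  then show ?thesis using y(1) k unfolding t_def by (intro exI[of _ "frame_point k a e y"]) simp
qed

section \<open>Bounds for the optimal constant\<close>

lemma bdist_compl: "bdist (- K) x = infdist x K"
  unfolding bdist_def by simp

lemma rellich_quotient_nonneg:
  "0 \<le> (LINT x:\<Omega>|lebesgue. \<bar>div_op c \<phi> x\<bar> powr p) /
         (LINT x:\<Omega>|lebesgue. c x powr p * bdist \<Omega> x powr (- 2 * p) * \<bar>\<phi> x\<bar> powr p)"
  unfolding set_lebesgue_integral_def by (intro divide_nonneg_nonneg integral_nonneg_AE) auto

lemma rellich_const_le:
  assumes "\<phi> \<in> Cc2 \<Omega>" "\<phi> \<noteq> (\<lambda>_. 0)" "\<Theta> \<ge> 0"
    and le: "(LINT x:\<Omega>|lebesgue. \<bar>div_op c \<phi> x\<bar> powr p)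
      \<le> \<Theta> * (LINT x:\<Omega>|lebesgue. c x powr p * bdist \<Omega> x powr (- 2 * p) * \<bar>\<phi> x\<bar> powr p)"
  shows "rellich_const \<Omega> c p \<le> \<Theta>"
proof -
  define A where "A = (LINT x:\<Omega>|lebesgue. \<bar>div_op c \<phi> x\<bar> powr p)"
  define D where "D = (LINT x:\<Omega>|lebesgue. c x powr p * bdist \<Omega> x powr (- 2 * p) * \<bar>\<phi> x\<bar> powr p)"
  have D0: "D \<ge> 0" unfolding D_def set_lebesgue_integral_def by (intro integral_nonneg_AE) auto
  have "rellich_const \<Omega> c p \<le> A / D"
    unfolding rellich_const_def A_def D_def
    by (rule cInf_lower) (use assms(1,2) rellich_quotient_nonneg[of \<Omega> c _ p] in \<open>auto intro!: bdd_belowI[of _ 0]\<close>)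
  also have "A / D \<le> \<Theta>"
  proof (cases "D = 0")
    case False
    then show ?thesis using D0 le unfolding A_def[symmetric] D_def[symmetric] by (simp add: divide_le_eq)
  qed (use assms(3) in simp)
  finally show ?thesis .
qed

text \<open>If the orthogonal projection of \<open>x\<close> to the affine hull already lies in \<open>K\<close>, it is the closest point.\<close>

lemma flat_distance:
  fixes K :: "'a::euclidean_space set"
  assumes K: "closed K" "convex K" and a: "a \<in> K" and ball: "ball a \<rho> \<inter> affine hull K \<subseteq> K" and \<rho>: "\<rho> > 0"
    and B: "orthonormal B1" "span B1 = (\<lambda>x. - a + x) ` (affine hull K)"
      "\<And>e v. e \<in> B2 \<Longrightarrow> v \<in> span B1 \<Longrightarrow> v \<bullet> e = 0"
    and total: "\<And>v :: 'a. v \<bullet> v = sqn B1 v + sqn B2 v"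
    and x: "sqn B1 (x - a) < \<rho>\<^sup>2"
  shows "infdist x K = sqrt (sqn B2 (x - a))"
proof (rule antisym)
  have Kne: "K \<noteq> {}" using a by auto
  define w where "w = pr B1 (x - a)"
  have wL: "w \<in> span B1" unfolding w_def pr_def by (intro span_sum span_scale span_base) auto
  have ww: "w \<bullet> w = sqn B1 (x - a)" unfolding w_def pr_inner_pr[OF B(1)] by (rule pr_inner_self)
  have wx: "w \<bullet> (x - a) = sqn B1 (x - a)" unfolding w_def by (rule pr_inner_self)
  have "a + w \<in> affine hull K" using wL unfolding B(2) by auto
  moreover have "(norm w)\<^sup>2 < \<rho>\<^sup>2" unfolding power2_norm_eq_inner ww by (rule x)
  then have "norm w < \<rho>" using \<rho> by (simp add: power2_less_imp_less)
  then have "a + w \<in> ball a \<rho>" by (simp add: dist_norm)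
  ultimately have wK: "a + w \<in> K" using ball by blast
  have "(norm ((x - a) - w))\<^sup>2 = sqn B2 (x - a)"
    unfolding power2_norm_eq_inner inner_diff_left[of "x - a" w] inner_diff_right[of _ "x - a" w]
    using total[of "x - a"] ww wx by (simp add: inner_commute[of "x - a" w])
  then have "norm ((x - a) - w) = sqrt (sqn B2 (x - a))" by (metis norm_ge_zero real_sqrt_unique)
  then have "dist x (a + w) = sqrt (sqn B2 (x - a))" by (simp add: dist_norm diff_diff_eq)
  then show "infdist x K \<le> sqrt (sqn B2 (x - a))" using infdist_le[OF wK, of x] by simp
  define y where "y = closest_point K x"
  have "y \<in> K" unfolding y_def by (rule closest_point_in_set[OF K(1) Kne])
  then have yL: "y - a \<in> span B1" unfolding B(2) using hull_inc by (auto intro!: image_eqI[of _ _ y])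
  have "sqn B2 (x - a) = sqn B2 (x - y)"
    unfolding sqn_def
  proof (intro sum.cong refl)
    fix e assume "e \<in> B2"
    from B(3)[OF this yL] show "((x - a) \<bullet> e)\<^sup>2 = ((x - y) \<bullet> e)\<^sup>2" by (simp add: inner_diff_left)
  qed
  also have "\<dots> \<le> (x - y) \<bullet> (x - y)" using total[of "x - y"] sqn_nonneg[of B1 "x - y"] by linarith
  also have "\<dots> = (infdist x K)\<^sup>2"
    using norm_offset[OF K Kne, of x] unfolding offset_def y_def by (simp add: power2_norm_eq_inner[symmetric])
  finally show "sqrt (sqn B2 (x - a)) \<le> infdist x K" by (simp add: real_le_lsqrt infdist_nonneg)
qed

definition asymptotic_on :: "real \<Rightarrow> real \<Rightarrow> real \<Rightarrow> real \<Rightarrow> real \<Rightarrow> bool"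
  where "asymptotic_on \<delta> \<delta>' \<gamma>0 \<epsilon> s \<longleftrightarrow> \<bar>degen_exponent \<delta> \<delta>' s - \<gamma>0\<bar> \<le> \<epsilon>
        \<and> (1 - \<epsilon>) * s powr \<gamma>0 \<le> degen_coeff \<delta> \<delta>' s \<and> degen_coeff \<delta> \<delta>' s \<le> (1 + \<epsilon>) * s powr \<gamma>0"

lemma asymptotic_onI:
  assumes "s > 0" "\<bar>degen_exponent \<delta> \<delta>' s - \<gamma>0\<bar> < \<epsilon>" "\<bar>w - 1\<bar> < \<epsilon>" "degen_coeff \<delta> \<delta>' s = w * s powr \<gamma>0"
  shows "asymptotic_on \<delta> \<delta>' \<gamma>0 \<epsilon> s"
  unfolding asymptotic_on_def assms(4) using assms(2,3) by (auto intro!: mult_right_mono)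

lemma asymptotic_at_0:
  assumes "\<epsilon> > 0"
  shows "\<forall>\<^sub>F s in at_right 0. asymptotic_on \<delta> \<delta>' \<delta> \<epsilon> s"
proof -
  have "((\<lambda>s. degen_exponent \<delta> \<delta>' s) \<longlongrightarrow> \<delta> + (\<delta>' - \<delta>) * (0 / (1 + 0))) (at_right 0)"
    unfolding degen_exponent_def by (intro tendsto_intros) auto
  then have "((\<lambda>s. degen_exponent \<delta> \<delta>' s) \<longlongrightarrow> \<delta>) (at_right 0)" by simp
  from tendstoD[OF this assms] have 1: "\<forall>\<^sub>F s in at_right 0. \<bar>degen_exponent \<delta> \<delta>' s - \<delta>\<bar> < \<epsilon>"
    by (simp add: dist_real_def)
  have "((\<lambda>s::real. (1 + s) powr (\<delta>' - \<delta>)) \<longlongrightarrow> (1 + 0) powr (\<delta>' - \<delta>)) (at_right 0)"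
    by (intro tendsto_intros) auto
  then have "((\<lambda>s::real. (1 + s) powr (\<delta>' - \<delta>)) \<longlongrightarrow> 1) (at_right 0)" by simp
  from tendstoD[OF this assms] have 2: "\<forall>\<^sub>F s in at_right 0. \<bar>(1 + s) powr (\<delta>' - \<delta>) - 1\<bar> < \<epsilon>"
    by (simp add: dist_real_def)
  have 3: "\<forall>\<^sub>F s::real in at_right 0. s > 0" by (simp add: eventually_at_filter)
  from 1 2 3 show ?thesis
    by eventually_elim (rule asymptotic_onI, auto simp: degen_coeff_def mult.commute)
qed

lemma asymptotic_at_top:
  assumes "\<epsilon> > 0"
  shows "\<forall>\<^sub>F s in at_top. asymptotic_on \<delta> \<delta>' \<delta>' \<epsilon> s"
proof -
  have "filterlim (\<lambda>s::real. 1 + s) at_top at_top"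
    by (rule filterlim_tendsto_add_at_top[OF tendsto_const filterlim_ident])
  from tendsto_inverse_0_at_top[OF this]
  have "((\<lambda>s::real. 1 - inverse (1 + s)) \<longlongrightarrow> 1 - 0) at_top" by (intro tendsto_intros)
  moreover have "\<forall>\<^sub>F s::real in at_top. 1 - inverse (1 + s) = s / (1 + s)"
    using eventually_gt_at_top[of 0] by eventually_elim (simp add: field_simps)
  ultimately have lim: "((\<lambda>s::real. s / (1 + s)) \<longlongrightarrow> 1) at_top"
    by (simp add: tendsto_cong)
  have "((\<lambda>s. degen_exponent \<delta> \<delta>' s) \<longlongrightarrow> \<delta> + (\<delta>' - \<delta>) * 1) at_top"
    unfolding degen_exponent_def by (intro tendsto_intros lim)
  then have "((\<lambda>s. degen_exponent \<delta> \<delta>' s) \<longlongrightarrow> \<delta>') at_top" by simp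
  from tendstoD[OF this assms] have 1: "\<forall>\<^sub>F s in at_top. \<bar>degen_exponent \<delta> \<delta>' s - \<delta>'\<bar> < \<epsilon>"
    by (simp add: dist_real_def)
  have "((\<lambda>s::real. (s / (1 + s)) powr (\<delta> - \<delta>')) \<longlongrightarrow> 1 powr (\<delta> - \<delta>')) at_top"
    by (intro tendsto_intros lim) auto
  then have "((\<lambda>s::real. (s / (1 + s)) powr (\<delta> - \<delta>')) \<longlongrightarrow> 1) at_top" by simp
  from tendstoD[OF this assms] have 2: "\<forall>\<^sub>F s in at_top. \<bar>(s / (1 + s)) powr (\<delta> - \<delta>') - 1\<bar> < \<epsilon>"
    by (simp add: dist_real_def)
  have 3: "\<forall>\<^sub>F s::real in at_top. s > 0" by (rule eventually_gt_at_top)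
  from 1 2 3 show ?thesis
  proof eventually_elim
    case (elim s)
    have "(s / (1 + s)) powr (\<delta> - \<delta>') * s powr \<delta>' = s powr \<delta> * (1 + s) powr (\<delta>' - \<delta>)"
    proof -
      have "(1 + s) powr (\<delta>' - \<delta>) = inverse ((1 + s) powr (\<delta> - \<delta>'))"
        using powr_minus[of "1 + s" "\<delta> - \<delta>'"] by simp
      moreover have "(s / (1 + s)) powr (\<delta> - \<delta>') = s powr (\<delta> - \<delta>') / (1 + s) powr (\<delta> - \<delta>')"
        using elim(3) by (simp add: powr_divide)
      ultimately have "(s / (1 + s)) powr (\<delta> - \<delta>') = s powr (\<delta> - \<delta>') * (1 + s) powr (\<delta>' - \<delta>)"
        by (simp only: divide_inverse)
      then show ?thesis using powr_add[of s "\<delta> - \<delta>'" \<delta>'] by (simp add: mult_ac)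
    qed
    then show ?case using elim by (intro asymptotic_onI) (auto simp: degen_coeff_def)
  qed
qed

lemma test_bound_tendsto:
  assumes "p > 1" "C > 0" "m > 0" "0 < l" "l < 1"
  shows "((\<lambda>\<epsilon>. test_bound p C m n k l \<epsilon>) \<longlongrightarrow> (1 - l) powr (1 - p) * C powr p) (at_right 0)"
proof -
  have e: "((\<lambda>\<epsilon>. (err m n k * \<epsilon>) powr p) \<longlongrightarrow> 0) (at_right 0)"
  proof -
    have "err m n k > 0" unfolding err_def using assms(3) by (simp add: add_pos_nonneg)
    then have ev: "\<forall>\<^sub>F \<epsilon> in at_right 0. 0 \<le> err m n k * \<epsilon>" by (auto simp: eventually_at_filter)
    have "((\<lambda>\<epsilon>. (err m n k * \<epsilon>) powr p) \<longlongrightarrow> (err m n k * 0) powr p) (at_right 0)"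
      using assms(1) ev by (intro tendsto_powr' tendsto_intros) auto
    then show ?thesis by simp
  qed
  have "((\<lambda>\<epsilon>. test_bound p C m n k l \<epsilon>) \<longlongrightarrow> ((1 + 0) / (1 - 0)) powr p
      * ((1 - l) powr (1 - p) * (C + m * 0) powr p + l powr (1 - p) * 0 * tent_ratio p k)) (at_right 0)"
    unfolding test_bound_def by (intro tendsto_intros e) (use assms in auto)
  then show ?thesis by simp
qed

lemma test_bound_nonneg:
  assumes "p > 1" "m > 0"
  shows "test_bound p C m n k l \<epsilon> \<ge> 0"
proof -
  have "integral {0..1} (\<lambda>t. w t * f t powr p) \<ge> 0" if "\<And>t. w t \<ge> 0" for w f :: "real \<Rightarrow> real"
    by (cases "(\<lambda>t. w t * f t powr p) integrable_on {0..1}")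
       (auto intro!: integral_nonneg mult_nonneg_nonneg that simp: not_integrable_integral)
  from this[of "\<lambda>_. 1"] this[of "\<lambda>t. exp (real k / 2 * t)"] have "tent_ratio p k \<ge> 0"
    unfolding tent_ratio_def by simp
  then show ?thesis unfolding test_bound_def by (intro mult_nonneg_nonneg add_nonneg_nonneg) auto
qed

text \<open>The hypothesis \<open>geometry\<close> provides the ball in \<open>K\<close> and the scales for a test function of any quality
  \<open>\<epsilon>\<close>; it is the only place where the limits \<open>d \<rightarrow> 0\<close> and \<open>d \<rightarrow> \<infinity>\<close> differ.\<close>

context
  fixes K :: "'a::euclidean_space set" and k n :: nat and p \<delta> \<delta>' \<gamma>0 C :: real
  assumes K: "closed K" "convex K" "K \<noteq> {}" and dim: "aff_dim K = int k" and k: "k > 0" and n: "n > 0" "n + k = DIM('a)"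
    and p: "p > 1" and \<delta>: "0 \<le> \<delta>" "\<delta> < 2" "0 \<le> \<delta>'" "\<delta>' < 2"
    and pos: "n + p * \<gamma>0 - 2 * p > 0" and C: "C = (p - 1) * n * (n + p * \<gamma>0 - 2 * p) / p\<^sup>2"
    and geometry: "\<And>\<epsilon>. 0 < \<epsilon> \<Longrightarrow> \<epsilon> < 1 \<Longrightarrow> \<exists>a \<rho> S0 N V. a \<in> K \<and> \<rho> > 0 \<and> ball a \<rho> \<inter> affine hull K \<subseteq> K \<and>
       N \<ge> 1 \<and> 1 \<le> \<epsilon> * N \<and> exp (S0 + N) \<le> \<epsilon> * exp V \<and> exp (V + 1) < \<rho>\<^sup>2 \<and>
       (\<forall>s>0. S0 \<le> 2 * ln s \<longrightarrow> 2 * ln s \<le> S0 + N \<longrightarrow> asymptotic_on \<delta> \<delta>' \<gamma>0 \<epsilon> s)"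
begin

private abbreviation "c \<equiv> (\<lambda>x. degen_coeff \<delta> \<delta>' (bdist (- K) x))"

lemma rellich_test_function_exists:
  assumes \<epsilon>: "0 < \<epsilon>" "\<epsilon> < 1" and l: "0 < l" "l < 1"
  shows "\<exists>\<phi>\<in>Cc2 (- K). \<phi> \<noteq> (\<lambda>_. 0) \<and>
     (LINT x:- K|lebesgue. \<bar>div_op c \<phi> x\<bar> powr p)
       \<le> test_bound p C (n / p + \<gamma>0 - 2) n k l \<epsilon>
          * (LINT x:- K|lebesgue. c x powr p * bdist (- K) x powr (- 2 * p) * \<bar>\<phi> x\<bar> powr p)"
proof -
  obtain a \<rho> S0 N V where g: "a \<in> K" "\<rho> > 0" "ball a \<rho> \<inter> affine hull K \<subseteq> K" "N \<ge> 1" "1 \<le> \<epsilon> * N"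
      "exp (S0 + N) \<le> \<epsilon> * exp V" "exp (V + 1) < \<rho>\<^sup>2"
      "\<And>s. s > 0 \<Longrightarrow> S0 \<le> 2 * ln s \<Longrightarrow> 2 * ln s \<le> S0 + N \<Longrightarrow> asymptotic_on \<delta> \<delta>' \<gamma>0 \<epsilon> s"
    using geometry[OF \<epsilon>] by blast
  define m where "m = n / p + \<gamma>0 - 2"
  have m: "m > 0" "real n = (m + 2 - \<gamma>0) * p" using pos p unfolding m_def by (auto simp: field_simps)
  have "C = m * (\<gamma>0 + real n - 2 - m)"
    unfolding C m_def using p by (simp add: field_simps power2_eq_square)
  moreover have "C \<ge> 0" unfolding C using p pos by simp
  moreover define L where "L = (\<lambda>x. - a + x) ` (affine hull K)"
  have sub: "subspace L" and dimL: "dim L = k"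
    unfolding L_def using direction_subspace[OF g(1) dim] by auto
  obtain B1 B2 where B: "orthonormal B1" "orthonormal B2" "span B1 = L" "card B1 = dim L" "card B2 = DIM('a) - dim L"
      "\<And>e l. e \<in> B2 \<Longrightarrow> l \<in> L \<Longrightarrow> l \<bullet> e = 0"
      "\<And>v w :: 'a. v \<bullet> w = (\<Sum>e\<in>B1. (v \<bullet> e) * (w \<bullet> e)) + (\<Sum>e\<in>B2. (v \<bullet> e) * (w \<bullet> e))"
    by (rule orthonormal_split_exists[OF sub]) blast
  have total: "v \<bullet> v = sqn B1 v + sqn B2 v" for v :: 'a
    using B(7)[of v v] unfolding sqn_def by (simp add: power2_eq_square)
  have perp: "e \<bullet> e' = 0" if "e \<in> B1" "e' \<in> B2" for e e'
    using B(6)[OF that(2), of e] span_base[OF that(1)] B(3) by simp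
  have flat: "infdist x K = sqrt (sqn B2 (x - a))" if "sqn B1 (x - a) < \<rho>\<^sup>2" for x
    by (rule flat_distance[OF K(1,2) g(1,3,2) B(1) _ _ total that]) (use B(3,6) L_def in auto)
  have cards: "card B1 = k" "card B2 = n" using B(4,5) dimL n by auto
  have asym: "\<bar>degen_exponent \<delta> \<delta>' s - \<gamma>0\<bar> \<le> \<epsilon> \<and> (1 - \<epsilon>) * s powr \<gamma>0 \<le> degen_coeff \<delta> \<delta>' s
        \<and> degen_coeff \<delta> \<delta>' s \<le> (1 + \<epsilon>) * s powr \<gamma>0" if "s > 0" "S0 \<le> 2 * ln s" "2 * ln s \<le> S0 + N" for s
    using g(8)[OF that] unfolding asymptotic_on_def .
  ultimately show ?thesis
    unfolding bdist_compl m_def[symmetric]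
    by (intro rellich_test_function[where R = "\<rho>\<^sup>2", OF K B(1,2) perp total cards k n(1) flat p m _ _ \<delta> \<epsilon> l g(4,5,6,7) asym])
qed

lemma rellich_const_upper_bound: "rellich_const (- K) c p \<le> C powr p"
proof -
  define m where "m = n / p + \<gamma>0 - 2"
  have m: "m > 0" using pos p unfolding m_def by (auto simp: field_simps)
  have Cpos: "C > 0" unfolding C using p pos n by simp
  have 1: "rellich_const (- K) c p \<le> (1 - l) powr (1 - p) * C powr p" if l: "0 < l" "l < 1" for l
  proof (rule tendsto_lowerbound[OF test_bound_tendsto[OF p Cpos m l, of n k]])
    have "rellich_const (- K) c p \<le> test_bound p C m n k l \<epsilon>" if \<epsilon>: "0 < \<epsilon>" "\<epsilon> < 1" for \<epsilon>
      using rellich_test_function_exists[OF \<epsilon> l] test_bound_nonneg[OF p m]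
      unfolding m_def[symmetric] by (auto intro: rellich_const_le)
    moreover have "\<forall>\<^sub>F \<epsilon>::real in at_right 0. 0 < \<epsilon> \<and> \<epsilon> < 1"
      using eventually_at_right_real[of 0 1] by (auto elim: eventually_mono)
    ultimately show "\<forall>\<^sub>F \<epsilon> in at_right 0. rellich_const (- K) c p \<le> test_bound p C m n k l \<epsilon>"
      by (auto elim: eventually_mono)
  qed simp
  have "((\<lambda>l. (1 - l) powr (1 - p) * C powr p) \<longlongrightarrow> (1 - 0) powr (1 - p) * C powr p) (at_right 0)"
    by (intro tendsto_intros) auto
  then have "((\<lambda>l. (1 - l) powr (1 - p) * C powr p) \<longlongrightarrow> C powr p) (at_right 0)" by simp
  then show ?thesis
  proof (rule tendsto_lowerbound)
    have "\<forall>\<^sub>F l::real in at_right 0. 0 < l \<and> l < 1"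
      using eventually_at_right_real[of 0 1] by (auto elim: eventually_mono)
    then show "\<forall>\<^sub>F l in at_right 0. rellich_const (- K) c p \<le> (1 - l) powr (1 - p) * C powr p"
      using 1 by (auto elim: eventually_mono)
  qed simp
qed

end

text \<open>The ball is fixed and the normal scale is pushed to zero below it.\<close>

lemma geometry_near_boundary:
  fixes K :: "'a::euclidean_space set"
  assumes K: "convex K" "K \<noteq> {}" and \<epsilon>: "0 < \<epsilon>" "\<epsilon> < 1"
  shows "\<exists>a \<rho> S0 N V. a \<in> K \<and> \<rho> > 0 \<and> ball a \<rho> \<inter> affine hull K \<subseteq> K \<and>
       N \<ge> 1 \<and> 1 \<le> \<epsilon> * N \<and> exp (S0 + N) \<le> \<epsilon> * exp V \<and> exp (V + 1) < \<rho>\<^sup>2 \<and>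
       (\<forall>s>0. S0 \<le> 2 * ln s \<longrightarrow> 2 * ln s \<le> S0 + N \<longrightarrow> asymptotic_on \<delta> \<delta>' \<delta> \<epsilon> s)"
proof -
  obtain a \<rho> where a: "a \<in> K" "\<rho> > 0" "ball a \<rho> \<inter> affine hull K \<subseteq> K"
    using rel_interior_eq_empty[OF K(1)] K(2) mem_rel_interior_ball[of _ K] by blast
  obtain b where b: "b > 0" "\<And>s. 0 < s \<Longrightarrow> s < b \<Longrightarrow> asymptotic_on \<delta> \<delta>' \<delta> \<epsilon> s"
    using asymptotic_at_0[OF \<epsilon>(1), of \<delta> \<delta>'] unfolding eventually_at_right_field by auto
  define V where "V = 2 * ln \<rho> - 2"
  define M where "M = min (2 * ln (b / 2)) (V + ln \<epsilon>)"
  define N where "N = 1 / \<epsilon>"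
  have "exp M \<le> exp (V + ln \<epsilon>)" unfolding M_def by simp
  then have "exp M \<le> \<epsilon> * exp V" using \<epsilon> by (simp add: exp_add mult.commute)
  moreover have "exp (V + 1) < \<rho>\<^sup>2"
  proof -
    have "exp (V + 1) < exp (2 * ln \<rho>)" unfolding V_def by simp
    also have "\<dots> = \<rho>\<^sup>2" using a(2) by (simp add: exp_double)
    finally show ?thesis .
  qed
  moreover have "asymptotic_on \<delta> \<delta>' \<delta> \<epsilon> s" if "s > 0" "2 * ln s \<le> M" for s
  proof -
    have "ln s \<le> ln (b / 2)" using that(2) unfolding M_def by simp
    then have "s \<le> b / 2" using that(1) b(1) by simp
    then show ?thesis using b that(1) by simp
  qed
  moreover have "N \<ge> 1" "1 \<le> \<epsilon> * N" unfolding N_def using \<epsilon> by auto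
  ultimately show ?thesis using a by (intro exI[of _ a] exI[of _ \<rho>] exI[of _ "M - N"] exI[of _ N] exI[of _ V]) auto
qed

text \<open>The normal scale is chosen first, far out; the ball must then be larger still.\<close>

lemma geometry_at_infinity:
  fixes K :: "'a::euclidean_space set"
  assumes balls: "\<And>\<rho>. \<rho> > 0 \<Longrightarrow> \<exists>a. a \<in> K \<and> ball a \<rho> \<inter> affine hull K \<subseteq> K" and \<epsilon>: "0 < \<epsilon>" "\<epsilon> < 1"
  shows "\<exists>a \<rho> S0 N V. a \<in> K \<and> \<rho> > 0 \<and> ball a \<rho> \<inter> affine hull K \<subseteq> K \<and>
       N \<ge> 1 \<and> 1 \<le> \<epsilon> * N \<and> exp (S0 + N) \<le> \<epsilon> * exp V \<and> exp (V + 1) < \<rho>\<^sup>2 \<and>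
       (\<forall>s>0. S0 \<le> 2 * ln s \<longrightarrow> 2 * ln s \<le> S0 + N \<longrightarrow> asymptotic_on \<delta> \<delta>' \<delta>' \<epsilon> s)"
proof -
  obtain b where b: "\<And>s. s \<ge> b \<Longrightarrow> asymptotic_on \<delta> \<delta>' \<delta>' \<epsilon> s"
    using asymptotic_at_top[OF \<epsilon>(1), of \<delta> \<delta>'] unfolding eventually_at_top_linorder by auto
  define S0 where "S0 = 2 * ln (max b 1)"
  define N where "N = 1 / \<epsilon>"
  define V where "V = S0 + N - ln \<epsilon>"
  define \<rho> where "\<rho> = exp ((V + 1) / 2) + 1"
  have \<rho>: "\<rho> > 0" unfolding \<rho>_def by (simp add: add_pos_pos)
  obtain a where a: "a \<in> K" "ball a \<rho> \<inter> affine hull K \<subseteq> K" using balls[OF \<rho>] by blast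
  have "exp (S0 + N) = \<epsilon> * exp V" unfolding V_def using \<epsilon> by (simp add: exp_diff)
  moreover have "exp (V + 1) < \<rho>\<^sup>2"
  proof -
    have "exp (V + 1) = (exp ((V + 1) / 2))\<^sup>2" by (simp flip: exp_double)
    also have "\<dots> < \<rho>\<^sup>2" unfolding \<rho>_def by (intro power_strict_mono) auto
    finally show ?thesis .
  qed
  moreover have "asymptotic_on \<delta> \<delta>' \<delta>' \<epsilon> s" if "s > 0" "S0 \<le> 2 * ln s" for s
  proof -
    have "ln (max b 1) \<le> ln s" using that(2) unfolding S0_def by simp
    then have "max b 1 \<le> s" using that(1) by simp
    then show ?thesis using b by simp
  qed
  moreover have "N \<ge> 1" "1 \<le> \<epsilon> * N" unfolding N_def using \<epsilon> by auto
  ultimately show ?thesis using a \<rho> by (intro exI[of _ a] exI[of _ \<rho>] exI[of _ S0] exI[of _ N] exI[of _ V]) auto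
qed

lemma integral_continuous_pos:
  fixes f :: "'a::euclidean_space \<Rightarrow> real"
  assumes "continuous_on UNIV f" "integrable lborel f" "\<And>x. f x \<ge> 0" "f x0 \<noteq> 0"
  shows "(\<integral>x. f x \<partial>lborel) > 0"
proof -
  have "(\<integral>x. f x \<partial>lborel) \<noteq> 0"
  proof
    assume "(\<integral>x. f x \<partial>lborel) = 0"
    then have "AE x in lborel. f x = 0"
      using integral_nonneg_eq_0_iff_AE[OF assms(2)] assms(3) by simp
    moreover have op: "open {x. f x \<noteq> 0}"
      using open_Collect_neq[OF assms(1) continuous_on_const] .
    ultimately have "{x. f x \<noteq> 0} \<in> null_sets lborel"
      using AE_iff_null[of lborel "\<lambda>x. f x = 0"] by simp
    then have "negligible {x. f x \<noteq> 0}"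
      unfolding negligible_iff_null_sets by (rule null_sets_completionI)
    with op show False using open_not_negligible[of "{x. f x \<noteq> 0}"] assms(4) by blast
  qed
  moreover have "(\<integral>x. f x \<partial>lborel) \<ge> 0" using assms(3) by simp
  ultimately show ?thesis by linarith
qed

text \<open>The weighted norm of a nonzero test function is positive, so that the quotient is a genuine one;
  the test functions of the upper bound show that the infimum is not taken over the empty set.\<close>

lemma rellich_const_lower_bound:
  fixes K :: "'a::euclidean_space set" and k n :: nat and p \<delta> C :: real
  assumes K: "closed K" "convex K" "K \<noteq> {}" and dim: "aff_dim K = int k" and n: "n > 0" "n + k = DIM('a)"
    and p: "p > 1" and \<delta>: "0 \<le> \<delta>" "\<delta> < 2"
    and pos: "n + p * \<delta> - 2 * p > 0" and C: "C = (p - 1) * n * (n + p * \<delta> - 2 * p) / p\<^sup>2"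
    and nonempty: "\<exists>\<phi>\<in>Cc2 (- K). \<phi> \<noteq> (\<lambda>_. 0)"
  shows "C powr p \<le> rellich_const (- K) (\<lambda>x. degen_coeff \<delta> \<delta> (bdist (- K) x)) p"
proof -
  define c where "c = (\<lambda>x. infdist x K powr \<delta>)"
  have c: "(\<lambda>x. degen_coeff \<delta> \<delta> (bdist (- K) x)) = c"
  proof
    fix x
    have "1 + infdist x K \<noteq> 0" using infdist_nonneg[of x K] by linarith
    then show "degen_coeff \<delta> \<delta> (bdist (- K) x) = c x" unfolding degen_coeff_def bdist_compl c_def by simp
  qed
  have op: "open (- K)" using K(1) by (rule open_Compl)
  have "C powr p \<le> (LINT x:- K|lebesgue. \<bar>div_op c \<phi> x\<bar> powr p) /
         (LINT x:- K|lebesgue. c x powr p * bdist (- K) x powr (- 2 * p) * \<bar>\<phi> x\<bar> powr p)"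
    if \<phi>: "\<phi> \<in> Cc2 (- K)" "\<phi> \<noteq> (\<lambda>_. 0)" for \<phi>
  proof -
    define T where "T = closure {x. \<phi> x \<noteq> 0}"
    note supp = Cc2_support[OF \<phi>(1) T_def]
    have clT: "closed T" unfolding T_def by simp
    have dpos: "infdist x K \<noteq> 0" if "x \<in> - K" for x using infdist_pos[OF K, of x] that by auto
    have cd: "(c has_derivative (\<lambda>h. ((\<delta> * infdist x K powr (\<delta> - 2)) *\<^sub>R offset K x) \<bullet> h)) (at x)" if "x \<in> - K" for x
      unfolding c_def using has_derivative_infdist_powr[OF K, of x \<delta>] that by simp
    have cg: "continuous_on (- K) (\<lambda>x. (\<delta> * infdist x K powr (\<delta> - 2)) *\<^sub>R offset K x)"
      by (intro continuous_intros continuous_on_offset K ballI dpos)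
    have H0: "div_op c \<phi> x = 0" if "x \<notin> T" for x
      by (rule div_op_zero_outside_support[OF clT supp(3) that])
    have contH: "continuous_on UNIV (\<lambda>x. \<bar>div_op c \<phi> x\<bar> powr p)"
    proof (rule continuous_on_extend_by_zero[OF op clT supp(2)])
      have "continuous_on (- K) (div_op c \<phi>)" by (rule continuous_on_div_op[OF \<phi>(1) T_def cd cg])
      then show "continuous_on (- K) (\<lambda>x. \<bar>div_op c \<phi> x\<bar> powr p)"
        by (intro continuous_on_powr') (use p in \<open>auto intro!: continuous_intros\<close>)
    qed (simp add: H0)
    define f where "f = (\<lambda>x. infdist x K powr (- (2 - \<delta>) * p) * \<bar>\<phi> x\<bar> powr p)"
    have f0: "f x = 0" if "x \<notin> T" for x unfolding f_def using supp(3)[OF that] by simp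
    have contf: "continuous_on UNIV f"
    proof (rule continuous_on_extend_by_zero[OF op clT supp(2) _ f0])
      have "continuous_on (- K) (\<lambda>x. infdist x K powr (- (2 - \<delta>) * p))" by (intro continuous_intros ballI dpos)
      moreover have "continuous_on (- K) \<phi>" by (rule Cc2_continuous_on[OF \<phi>(1) T_def])
      then have "continuous_on (- K) (\<lambda>x. \<bar>\<phi> x\<bar> powr p)"
        by (intro continuous_on_powr') (use p in \<open>auto intro!: continuous_intros\<close>)
      ultimately show "continuous_on (- K) f" unfolding f_def by (rule continuous_on_mult)
    qed
    have intf: "integrable lborel f" by (rule integrable_compact_support[OF contf supp(1) f0])
    obtain x0 where x0: "\<phi> x0 \<noteq> 0" using \<phi>(2) by auto
    then have "x0 \<in> T" using supp(3) by blast
    then have "f x0 \<noteq> 0" unfolding f_def using x0 dpos[of x0] supp(2) by auto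
    from integral_continuous_pos[OF contf intf _ this] have D0: "(\<integral>x. f x \<partial>lborel) > 0"
      unfolding f_def by simp
    have num: "(LINT x:- K|lebesgue. \<bar>div_op c \<phi> x\<bar> powr p) = (\<integral>x. \<bar>div_op c \<phi> x\<bar> powr p \<partial>lborel)"
      by (rule set_integral_lebesgue_eq_lborel[OF borel_measurable_continuous_onI[OF contH]])
         (use H0 supp(2) in auto)
    have feq: "c x powr p * bdist (- K) x powr (- 2 * p) * \<bar>\<phi> x\<bar> powr p = f x" for x
      unfolding f_def c_def bdist_compl powr_powr powr_add[symmetric] by (simp add: algebra_simps)
    have den: "(LINT x:- K|lebesgue. c x powr p * bdist (- K) x powr (- 2 * p) * \<bar>\<phi> x\<bar> powr p) = (\<integral>x. f x \<partial>lborel)"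
      unfolding feq
      by (rule set_integral_lebesgue_eq_lborel[OF borel_measurable_continuous_onI[OF contf]])
         (use f0 supp(2) in auto)
    have "C powr p * (\<integral>x. f x \<partial>lborel) \<le> (\<integral>x. \<bar>div_op c \<phi> x\<bar> powr p \<partial>lborel)"
      unfolding f_def c_def
      by (rule rellich_lower_bound_lborel[OF K dim p \<delta>(2) _ refl _ _ \<phi>(1) T_def, of "real n"])
         (use n pos C in auto)
    then show ?thesis unfolding num den using D0 by (simp add: pos_le_divide_eq)
  qed
  then show ?thesis
    unfolding c rellich_const_def using nonempty by (intro cInf_greatest) auto
qed

theorem theorem4p8:
  fixes K \<Omega> :: "'a::euclidean_space set"
    and k :: nat
    and p \<delta> \<delta>' d :: real
    and c :: "'a \<Rightarrow> real"
  assumes "closed K" and "convex K"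
    and "aff_dim K = int k" and "1 \<le> k" and "k \<le> DIM('a) - 1"
    and "d = real DIM('a)"
    and "\<Omega> = - K"
    and "0 \<le> \<delta>" and "\<delta> < 2" and "0 \<le> \<delta>'" and "\<delta>' < 2"
    and "c = (\<lambda>x. degen_coeff \<delta> \<delta>' (bdist \<Omega> x))"
    and "1 < p"
    and "d - k + p * min \<delta> \<delta>' - 2 * p > 0"
  shows "rellich_const \<Omega> c p
           \<le> ((p - 1) * (d - k) * (d - k + p * \<delta> - 2 * p) / p\<^sup>2) powr p
       \<and> (dim_at_infinity K = ereal k \<longrightarrow>
           rellich_const \<Omega> c p
             \<le> ((p - 1) * (d - k) * (d - k + p * min \<delta> \<delta>' - 2 * p) / p\<^sup>2) powr p)
       \<and> (\<delta> = \<delta>' \<longrightarrow>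
           rellich_const \<Omega> c p
             = ((p - 1) * (d - k) * (d - k + p * min \<delta> \<delta>' - 2 * p) / p\<^sup>2) powr p)"
proof -
  define n where "n = DIM('a) - k"
  have n: "n > 0" "n + k = DIM('a)" unfolding n_def using assms(5) DIM_positive[where 'a='a] by linarith+
  have dn: "d - k = real n" using n(2) assms(6) by linarith
  have Kne: "K \<noteq> {}" using assms(3) by auto
  have k: "k > 0" using assms(4) by simp
  note K = assms(1,2) Kne
  have pos: "n + p * min \<delta> \<delta>' - 2 * p > 0" using assms(14) unfolding dn .
  have "p * min \<delta> \<delta>' \<le> p * \<delta>" using assms(13) by (intro mult_left_mono) auto
  then have pos1: "n + p * \<delta> - 2 * p > 0" using pos by linarith
  have up1: "rellich_const \<Omega> c p \<le> ((p - 1) * n * (n + p * \<delta> - 2 * p) / p\<^sup>2) powr p"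
    unfolding assms(7,12)
    by (rule rellich_const_upper_bound[OF K assms(3) k n assms(13) assms(8-11) pos1 refl])
       (rule geometry_near_boundary[OF assms(2) Kne])
  moreover have "rellich_const \<Omega> c p \<le> ((p - 1) * n * (n + p * min \<delta> \<delta>' - 2 * p) / p\<^sup>2) powr p"
    if "dim_at_infinity K = ereal k"
  proof (cases "\<delta> \<le> \<delta>'")
    case True
    then show ?thesis using up1 by (simp add: min_def)
  next
    case False
    then have m: "min \<delta> \<delta>' = \<delta>'" by simp
    show ?thesis
      unfolding assms(7,12) m
      by (rule rellich_const_upper_bound[OF K assms(3) k n assms(13) assms(8-11) pos[unfolded m] refl])
         (rule geometry_at_infinity[OF large_balls[OF K assms(3,4) that]])
  qed
  moreover have "rellich_const \<Omega> c p = ((p - 1) * n * (n + p * min \<delta> \<delta>' - 2 * p) / p\<^sup>2) powr p"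
    if eq: "\<delta> = \<delta>'"
  proof (rule antisym)
    show "rellich_const \<Omega> c p \<le> ((p - 1) * n * (n + p * min \<delta> \<delta>' - 2 * p) / p\<^sup>2) powr p"
      using up1 eq by simp
    have "\<exists>\<phi>\<in>Cc2 (- K). \<phi> \<noteq> (\<lambda>_. 0)"
      using rellich_test_function_exists[OF K assms(3) k n assms(13) assms(8-11) pos1 refl
          geometry_near_boundary[OF assms(2) Kne], of "1/2" "1/2"] by auto
    from rellich_const_lower_bound[OF K assms(3) n assms(13,8,9) pos1 refl this]
    show "((p - 1) * n * (n + p * min \<delta> \<delta>' - 2 * p) / p\<^sup>2) powr p \<le> rellich_const \<Omega> c p"
      unfolding assms(7,12) eq[symmetric] by simp
  qed
  ultimately show ?thesis unfolding dn by blast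
qed

end
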